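(* Let $m\in\mathbb{N}=\{1,2,3,\dots\}$, and let $\mathscr{B}$ be a Banach algebra (with pointwise operations and norm $\|\cdot\|_{\mathscr{B}}$) such that (1) $\mathscr{P}\subset\mathscr{B}\subset\mathscr{H}^\infty$; (2) there exists $C>0$ such that $\|f\|_\infty\le C\|f\|_{\mathscr{B}}$ for all $f\in\mathscr{B}$; (3) $\mathscr{B}$ has the Wiener property: for all $f\in\mathscr{B}$ satisfying $\inf_{s\in\mathbb{C}_+}|f(s)|>0$, we have $\frac1f\in\mathscr{B}$. Then $\partial^{-m}\mathscr{B}$ is a projective free ring.
   Context: $\mathbb{C}_+=\{s\in\mathbb{C}:\mathrm{Re}(s)>0\}$. $\mathscr{H}^\infty$ is the set of all Dirichlet series $f(s)=\sum_{n=1}^\infty \frac{a_n}{n^s}$ ($a_n\in\mathbb{C}$) that converge at every $s\in\mathbb{C}_+$ and satisfy $\|f\|_\infty:=\sup_{s\in\mathbb{C}_+}|f(s)|<\infty$; it is a Banach algebra with pointwise operations and the norm $\|\cdot\|_\infty$. $\mathscr{P}\subset\mathscr{H}^\infty$ is the set of Dirichlet polynomials, i.e. Dirichlet series $\sum_{n=1}^N\frac{a_n}{n^s}$ with $N\in\mathbb{N}$, $a_1,\dots,a_N\in\mathbb{C}$. For $m\in\mathbb{N}$, $\partial^{-m}\mathscr{B}$ denotes the Banach algebra of all $f\in\mathscr{B}$ such that $f',\dots,f^{(m)}\in\mathscr{B}$ (derivatives with respect to $s\in\mathbb{C}_+$), with pointwise operations and the norm $\|f\|_{\partial^{-m}\mathscr{B}}=\sum_{\ell=0}^m\frac{1}{\ell!}\|f^{(\ell)}\|_{\mathscr{B}}$.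 A commutative unital ring $A$ is projective free if every finitely generated projective $A$-module is free, i.e. isomorphic to $A^k$ for some $k\in\mathbb{N}\cup\{0\}$. *)

theory Defs
  imports "HOL-Analysis.Analysis" "HOL-Algebra.Module"
begin

section \<open>Modules and projective free rings\<close>

text \<open>A module record extends a ring record; its fields \<open>mult\<close> and \<open>one\<close> play no role in the
  locale \<open>module\<close> and are left \<open>undefined\<close> below.\<close>

definition free_module :: "('a, 'c) ring_scheme \<Rightarrow> 'i set \<Rightarrow> ('a, 'i \<Rightarrow> 'a) module" where
  "free_module R I =
    \<lparr> carrier = {x \<in> I \<rightarrow>\<^sub>E carrier R. finite {i \<in> I. x i \<noteq> \<zero>\<^bsub>R\<^esub>}},
      monoid.mult = undefined, one = undefined,
      zero = (\<lambda>i\<in>I. \<zero>\<^bsub>R\<^esub>),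
      add = (\<lambda>x y. \<lambda>i\<in>I. x i \<oplus>\<^bsub>R\<^esub> y i),
      smult = (\<lambda>a x. \<lambda>i\<in>I. a \<otimes>\<^bsub>R\<^esub> x i) \<rparr>"

definition module_direct_sum :: "('a, 'b) module \<Rightarrow> ('a, 'c) module \<Rightarrow> ('a, 'b \<times> 'c) module" where
  "module_direct_sum M N =
    \<lparr> carrier = carrier M \<times> carrier N,
      monoid.mult = undefined, one = undefined,
      zero = (\<zero>\<^bsub>M\<^esub>, \<zero>\<^bsub>N\<^esub>),
      add = (\<lambda>x y. (fst x \<oplus>\<^bsub>M\<^esub> fst y, snd x \<oplus>\<^bsub>N\<^esub> snd y)),
      smult = (\<lambda>a x. (a \<odot>\<^bsub>M\<^esub> fst x, a \<odot>\<^bsub>N\<^esub> snd x)) \<rparr>"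

definition module_isomorphic ::
    "('a, 'c) ring_scheme \<Rightarrow> ('a, 'b) module \<Rightarrow> ('a, 'd) module \<Rightarrow> bool" where
  "module_isomorphic R M N \<longleftrightarrow>
    (\<exists>\<phi> \<in> iso (add_monoid M) (add_monoid N).
      \<forall>a \<in> carrier R. \<forall>x \<in> carrier M. \<phi> (a \<odot>\<^bsub>M\<^esub> x) = a \<odot>\<^bsub>N\<^esub> \<phi> x)"

definition finitely_generated_module :: "('a, 'c) ring_scheme \<Rightarrow> ('a, 'b) module \<Rightarrow> bool" where
  "finitely_generated_module R M \<longleftrightarrow>
    (\<exists>S. finite S \<and> S \<subseteq> carrier M \<and>
      (\<forall>x \<in> carrier M. \<exists>c \<in> S \<rightarrow> carrier R. x = (\<Oplus>\<^bsub>M\<^esub>s\<in>S. c s \<odot>\<^bsub>M\<^esub> s)))"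

text \<open>Projective means: a direct summand of a free module, of arbitrary rank. It costs no generality
  that the index set and the complement live in types determined by those of \<open>R\<close> and \<open>M\<close>: if \<open>M\<close> is
  a direct summand of any free module at all, then the canonical surjection onto \<open>M\<close> from the free
  module indexed by \<open>carrier M\<close> splits, and its kernel is a complement.\<close>

definition projective_module :: "('a, 'c) ring_scheme \<Rightarrow> ('a, 'b) module \<Rightarrow> bool" where
  "projective_module R M \<longleftrightarrow>
    (\<exists>(N :: ('a, 'b \<Rightarrow> 'a) module) (I :: 'b set).
      module R N \<and> module_isomorphic R (module_direct_sum M N) (free_module R I))"

text \<open>HOL definitions cannot quantify over types, so the type \<open>'b\<close> carrying the modules is an explicit
  parameter. A theorem with conclusion \<open>projective_free TYPE('b) R\<close> for a type variable \<open>'b\<close> covers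
  modules of every type.\<close>

definition projective_free :: "'b itself \<Rightarrow> ('a, 'c) ring_scheme \<Rightarrow> bool" where
  "projective_free (ty :: 'b itself) R \<longleftrightarrow> cring R \<and>
    (\<forall>M :: ('a, 'b) module.
      module R M \<and> finitely_generated_module R M \<and> projective_module R M \<longrightarrow>
        (\<exists>k::nat. module_isomorphic R M (free_module R {..<k})))"


section \<open>Algebras of Dirichlet series\<close>

text \<open>Functions on a set \<open>X\<close> are represented by elements of \<open>extensional X\<close>, so that equality in HOL
  is equality on \<open>X\<close>.\<close>

definition pointwise_ring :: "'x set \<Rightarrow> ('x \<Rightarrow> complex) set \<Rightarrow> ('x \<Rightarrow> complex) ring" where
  "pointwise_ring X A =
    \<lparr> carrier = A,
      monoid.mult = (\<lambda>f g. \<lambda>x\<in>X. f x * g x), one = (\<lambda>x\<in>X. 1),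
      zero = (\<lambda>x\<in>X. 0), add = (\<lambda>f g. \<lambda>x\<in>X. f x + g x) \<rparr>"

text \<open>A complex Banach algebra of functions on \<open>X\<close> with pointwise operations. Neither a unit nor
  norm \<open>1\<close> of the unit is required.\<close>

locale banach_function_algebra =
  fixes X :: "'x set" and B :: "('x \<Rightarrow> complex) set" and nrm :: "('x \<Rightarrow> complex) \<Rightarrow> real"
  assumes extensional: "B \<subseteq> extensional X"
    and zero_mem: "(\<lambda>x\<in>X. 0) \<in> B"
    and add_mem: "f \<in> B \<Longrightarrow> g \<in> B \<Longrightarrow> (\<lambda>x\<in>X. f x + g x) \<in> B"
    and scale_mem: "f \<in> B \<Longrightarrow> (\<lambda>x\<in>X. c * f x) \<in> B"
    and mult_mem: "f \<in> B \<Longrightarrow> g \<in> B \<Longrightarrow> (\<lambda>x\<in>X. f x * g x) \<in> B"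
    and norm_nonneg: "f \<in> B \<Longrightarrow> 0 \<le> nrm f"
    and norm_eq_0_iff: "f \<in> B \<Longrightarrow> nrm f = 0 \<longleftrightarrow> f = (\<lambda>x\<in>X. 0)"
    and norm_triangle: "f \<in> B \<Longrightarrow> g \<in> B \<Longrightarrow> nrm (\<lambda>x\<in>X. f x + g x) \<le> nrm f + nrm g"
    and norm_scale: "f \<in> B \<Longrightarrow> nrm (\<lambda>x\<in>X. c * f x) = cmod c * nrm f"
    and norm_mult: "f \<in> B \<Longrightarrow> g \<in> B \<Longrightarrow> nrm (\<lambda>x\<in>X. f x * g x) \<le> nrm f * nrm g"
    and complete:
      "(\<And>n::nat. F n \<in> B) \<Longrightarrow>
       (\<And>e. e > 0 \<Longrightarrow> \<exists>N. \<forall>i\<ge>N. \<forall>j\<ge>N. nrm (\<lambda>x\<in>X. F i x - F j x) < e) \<Longrightarrow>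
       \<exists>f\<in>B. (\<lambda>n. nrm (\<lambda>x\<in>X. F n x - f x)) \<longlonglongrightarrow> 0"

definition Cplus :: "complex set" where
  "Cplus = {s. Re s > 0}"

definition Hinf :: "(complex \<Rightarrow> complex) set" where
  "Hinf = {f \<in> extensional Cplus.
    (\<exists>a :: nat \<Rightarrow> complex. \<forall>s\<in>Cplus. (\<lambda>n. a (Suc n) / of_nat (Suc n) powr s) sums f s) \<and>
    bounded (f ` Cplus)}"

definition Hinf_norm :: "(complex \<Rightarrow> complex) \<Rightarrow> real" where
  "Hinf_norm f = (SUP s\<in>Cplus. cmod (f s))"

definition Dirichlet_polynomials :: "(complex \<Rightarrow> complex) set" where
  "Dirichlet_polynomials =
    {(\<lambda>s\<in>Cplus. \<Sum>n=1..N. a n / of_nat n powr s) | (N :: nat) (a :: nat \<Rightarrow> complex). True}"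

text \<open>As \<open>Cplus\<close> is open, the values of \<open>(deriv ^^ l) f\<close> on \<open>Cplus\<close> depend only on \<open>f\<close> on \<open>Cplus\<close>.
  Elements of \<open>Hinf\<close> are holomorphic there, so for \<open>B \<subseteq> Hinf\<close> all these derivatives
  exist.\<close>

definition smooth_subalgebra :: "nat \<Rightarrow> (complex \<Rightarrow> complex) set \<Rightarrow> (complex \<Rightarrow> complex) set" where
  "smooth_subalgebra m B = {f \<in> B. \<forall>l\<in>{1..m}. restrict ((deriv ^^ l) f) Cplus \<in> B}"

end

theory Submission
  imports Defs "HOL-Probability.Probability" "HOL-Complex_Analysis.Complex_Analysis"
    Jordan_Normal_Form.Determinant
begin

text \<open>
  Over a commutative ring in which every idempotent matrix \<open>P\<close> factors as \<open>P = u v\<close> with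
  \<open>v u = 1\<close>, finitely generated projective modules are free, by the dual basis lemma.

  Let \<open>P\<close> be an idempotent matrix over \<open>smooth_subalgebra m B\<close>. Its entries have bounded derivatives,
  hence are Lipschitz on \<open>Cplus\<close>. Convolving a Lipschitz function in \<open>Hinf\<close> with a narrow Gaussian
  along vertical lines moves it little and makes its Dirichlet series absolutely convergent on
  \<open>Cplus\<close>, so the entries of \<open>P\<close> are uniform limits of Dirichlet polynomials. Consequently all
  translates \<open>P (s + h)\<close>, \<open>h \<ge> 0\<close>, have entries in the uniform closure of the algebra, they vary
  uniformly continuously with \<open>h\<close>, and they approach a constant as \<open>h\<close> grows. Close idempotents
  are similar, so a finite chain of translates gives an invertible \<open>G\<close> over the uniform closure,
  with \<open>det G\<close> bounded away from \<open>0\<close>, and a constant idempotent \<open>E\<close> with \<open>P G = G E\<close>. If \<open>H\<close> over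
  the algebra itself is close to \<open>G\<close>, then \<open>T = P H E + (1 - P) H (1 - E)\<close> still satisfies
  \<open>P T = T E\<close> and is close to \<open>G\<close>; by the Wiener property \<open>T\<close> is invertible over the algebra. So \<open>P\<close>
  is similar to a constant idempotent, which factors by linear algebra over the complex numbers.
\<close>

section \<open>General Dirichlet series\<close>

text \<open>The obstacle is that \<open>B\<close> need be neither translation invariant nor
  uniformly closed. Translates of \<open>P\<close> may leave the algebra, and uniform approximation
  says nothing about convergence in the norm of \<open>B\<close>. The homotopy therefore runs in the
  uniform closure, where translates of Dirichlet polynomials stay, and the return to the algebra
  rests on an exact identity: \<open>P T = T E\<close> holds for every \<open>H\<close>, because
  \<open>T\<close> is the projection of \<open>H\<close> onto the intertwiners. Only the
  invertibility of \<open>T\<close> depends on closeness, through a lower bound on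
  \<open>|det T|\<close>, and that bound is what the Wiener property consumes. A bounded Dirichlet
  series on \<open>Cplus\<close> need not be uniformly continuous, so its horizontal translates need
  not vary continuously in the sup norm; one bounded derivative removes this difficulty. The chain
  of translates ends at the value of \<open>P\<close> at a single far real point instead of a limit
  at infinity: such a value is idempotent as it stands.\<close>

lemma norm_exp_diff_le:
  fixes z :: complex and a b :: real
  assumes "Re z > 0" "a \<le> b"
  shows "cmod (exp (- z * of_real a) - exp (- z * of_real b))
    \<le> cmod z / Re z * (exp (- Re z * a) - exp (- Re z * b))"
proof (cases "a = b")
  case False
  then have "a < b" using assms by simp
  \<comment> \<open>The right side is the increment of an antiderivative of
    \<open>|z| exp (- Re z t)\<close>, the norm of the derivative of \<open>exp (- z t)\<close>. As
    a difference of two values it telescopes when summed over successive exponents.\<close>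
  have "norm (exp (- z * of_real b) - exp (- z * of_real a))
      \<le> (- (cmod z / Re z * exp (- Re z * b))) - (- (cmod z / Re z * exp (- Re z * a)))"
  proof (rule differentiable_bound_general[OF \<open>a < b\<close>])
    show "continuous_on {a..b} (\<lambda>t. exp (- z * of_real t))"
      by (intro continuous_intros)
    show "continuous_on {a..b} (\<lambda>t. - (cmod z / Re z * exp (- Re z * t)))"
      by (intro continuous_intros)
    show "((\<lambda>t. exp (- z * of_real t)) has_vector_derivative - z * exp (- z * of_real x)) (at x)" for x
      by (rule has_vector_derivative_real_field) (auto intro!: derivative_eq_intros)
    show "((\<lambda>t. - (cmod z / Re z * exp (- Re z * t))) has_vector_derivative
        cmod z * exp (- Re z * x)) (at x)" for x
      using assms(1) by (auto intro!: derivative_eq_intros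
        simp: has_real_derivative_iff_has_vector_derivative[symmetric])
    show "norm (- z * exp (- z * of_real x)) \<le> cmod z * exp (- Re z * x)" for x
      by (simp add: norm_mult)
  qed
  then show ?thesis by (simp add: norm_minus_commute algebra_simps)
qed simp

lemma sum_by_parts:
  fixes b c :: "nat \<Rightarrow> 'a::comm_ring_1"
  shows "(\<Sum>i<n. b i * c i) =
    (\<Sum>i<n. b i) * c n + (\<Sum>i<n. (\<Sum>j<Suc i. b j) * (c i - c (Suc i)))"
  by (induction n) (simp_all add: algebra_simps)

text \<open>Abel summation moves the estimate from the coefficients to the increments of the
  exponentials, whose bounds telescope. The result depends on \<open>z\<close> only through
  \<open>|z| / Re z\<close>, so it is uniform on sectors, and it does not depend on
  \<open>n\<close>.\<close>

lemma norm_Dirichlet_sum_le: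
  fixes b :: "nat \<Rightarrow> complex" and lam :: "nat \<Rightarrow> real"
  assumes "incseq lam" "lam 0 \<ge> 0" "Re z > 0"
    and K: "\<And>j. cmod (\<Sum>i<j. b i) \<le> K"
  shows "cmod (\<Sum>i<n. b i * exp (- z * of_real (lam i))) \<le> K * (cmod z / Re z)"
proof -
  define c where "c = (\<lambda>i. exp (- z * of_real (lam i)))"
  define e where "e = (\<lambda>i. exp (- Re z * lam i))"
  define q where "q = cmod z / Re z"
  have q: "q \<ge> 1" unfolding q_def using assms(3) abs_Re_le_cmod[of z] by (simp add: field_simps)
  have K0: "K \<ge> 0" using K[of 0] by simp
  have cN: "cmod (c n) = e n" by (simp add: c_def e_def)
  have e0: "e 0 \<le> 1" using assms by (simp add: e_def mult_nonneg_nonneg)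
  have "cmod (\<Sum>i<n. b i * c i) \<le> cmod ((\<Sum>i<n. b i) * c n)
      + cmod (\<Sum>i<n. (\<Sum>j<Suc i. b j) * (c i - c (Suc i)))"
    unfolding sum_by_parts[of b c] by (rule norm_triangle_ineq)
  also have "\<dots> \<le> K * e n + (\<Sum>i<n. K * (q * (e i - e (Suc i))))"
  proof (rule add_mono)
    show "cmod ((\<Sum>i<n. b i) * c n) \<le> K * e n"
      unfolding norm_mult cN using K by (intro mult_right_mono) (auto simp: e_def)
    show "cmod (\<Sum>i<n. (\<Sum>j<Suc i. b j) * (c i - c (Suc i))) \<le> (\<Sum>i<n. K * (q * (e i - e (Suc i))))"
    proof (rule sum_norm_le)
      fix i
      have "cmod (c i - c (Suc i)) \<le> q * (e i - e (Suc i))"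
        unfolding c_def e_def q_def
        using assms by (intro norm_exp_diff_le) (auto simp: incseq_SucD)
      then show "cmod ((\<Sum>j<Suc i. b j) * (c i - c (Suc i))) \<le> K * (q * (e i - e (Suc i)))"
        unfolding norm_mult using K[of "Suc i"] K0 by (intro mult_mono) auto
    qed
  qed
  also have "(\<Sum>i<n. K * (q * (e i - e (Suc i)))) = K * (q * (e 0 - e n))"
    by (simp add: sum_distrib_left[symmetric] sum_lessThan_telescope')
  \<comment> \<open>The boundary term is absorbed because \<open>q \<ge> 1\<close>; with
    \<open>e 0 \<le> 1\<close> the terms in \<open>e n\<close> cancel.\<close>
  also have "K * e n + K * (q * (e 0 - e n)) \<le> K * (q * e n) + K * (q * (1 - e n))"
    using q e0 K0 by (intro add_mono mult_left_mono) (auto simp: e_def)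
  also have "\<dots> = K * q" by (simp add: algebra_simps)
  finally show ?thesis by (simp add: c_def q_def)
qed

lemma Dirichlet_tail_le:
  fixes b :: "nat \<Rightarrow> complex" and lam :: "nat \<Rightarrow> real"
  assumes "incseq lam" "lam 0 \<ge> 0" "Re z > 0"
    and K: "\<And>j. cmod (\<Sum>i<j. b (M + i)) \<le> K"
    and S: "(\<lambda>n. b n * exp (- z * of_real (lam n))) sums S"
  shows "cmod (S - (\<Sum>n<M. b n * exp (- z * of_real (lam n)))) \<le> K * (cmod z / Re z)"
proof -
  have "(\<lambda>i. b (M + i) * exp (- z * of_real (lam (M + i)))) sums
      (S - (\<Sum>n<M. b n * exp (- z * of_real (lam n))))"
    using sums_split_initial_segment[OF S, of M] by (simp add: add.commute)
  moreover have "cmod (\<Sum>i<n. b (M + i) * exp (- z * of_real (lam (M + i)))) \<le> K * (cmod z / Re z)" for n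
    using assms(1,2,3) K
    by (intro norm_Dirichlet_sum_le[where lam = "\<lambda>i. lam (M + i)"])
       (auto simp: incseq_def intro: order_trans)
  ultimately show ?thesis
    unfolding sums_def by (intro Lim_norm_ubound[OF sequentially_bot]) auto
qed

text \<open>Convergence at a point \<open>w\<close> to the left of a disc makes late blocks of
  partial sums small there. With the terms at \<open>w\<close> taken as coefficients, the tail
  estimate for \<open>z = s - w\<close> turns this into uniform convergence on the disc, and uniform
  limits of holomorphic functions are holomorphic.\<close>

lemma Dirichlet_series_holomorphic:
  fixes a :: "nat \<Rightarrow> complex" and lam :: "nat \<Rightarrow> real"
  assumes lam: "incseq lam" "lam 0 \<ge> 0"
    and f: "\<And>s. s \<in> Cplus \<Longrightarrow> (\<lambda>n. a n * exp (- s * of_real (lam n))) sums f s"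
  shows "f holomorphic_on Cplus"
proof (rule holomorphic_uniform_sequence)
  show "open Cplus" unfolding Cplus_def by (rule open_halfspace_Re_gt)
  let ?P = "\<lambda>N s. \<Sum>n<N. a n * exp (- s * of_real (lam n))"
  show "?P N holomorphic_on Cplus" for N
    by (intro holomorphic_intros)
  fix s0 assume s0: "s0 \<in> Cplus"
  \<comment> \<open>With \<open>Re s0 = 4 d\<close> and \<open>w = 2 d\<close>, every
    \<open>s\<close> within \<open>d\<close> of \<open>s0\<close> satisfies
    \<open>Re (s - w) \<ge> d\<close>; then \<open>Q\<close> bounds
    \<open>|s - w| / Re (s - w)\<close> on the disc.\<close>
  define d where "d = Re s0 / 4"
  have d: "d > 0" using s0 by (simp add: d_def Cplus_def)
  define w :: complex where "w = of_real (2 * d)"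
  define b where "b = (\<lambda>n. a n * exp (- w * of_real (lam n)))"
  define Q where "Q = (cmod (s0 - w) + d) / d"
  have Q: "Q > 0" unfolding Q_def using d by (intro divide_pos_pos add_nonneg_pos) auto
  have sub: "cball s0 d \<subseteq> Cplus"
  proof
    fix s assume "s \<in> cball s0 d"
    then have "\<bar>Re s0 - Re s\<bar> \<le> d" using abs_Re_le_cmod[of "s0 - s"] by (simp add: dist_norm)
    then show "s \<in> Cplus" using d unfolding d_def Cplus_def mem_Collect_eq by linarith
  qed
  have "w \<in> Cplus" using d by (simp add: w_def Cplus_def)
  then have "summable b" using f[of w] by (auto simp: b_def sums_iff)
  have "uniform_limit (cball s0 d) ?P f sequentially"
    unfolding uniform_limit_sequentially_iff
  proof (intro allI impI)
    fix \<epsilon> :: real assume "\<epsilon> > 0"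
    then have e: "\<epsilon> / (2 * Q) > 0" using Q by simp
    obtain N where N: "\<And>m n. m \<ge> N \<Longrightarrow> norm (sum b {m..<n}) < \<epsilon> / (2 * Q)"
      using \<open>summable b\<close> e unfolding summable_Cauchy by blast
    show "\<exists>N. \<forall>n\<ge>N. \<forall>x\<in>cball s0 d. dist (?P n x) (f x) < \<epsilon>"
    proof (intro exI allI impI ballI)
      fix M s assume M: "M \<ge> N" and s: "s \<in> cball s0 d"
      define z where "z = s - w"
      have dist: "cmod (s - s0) \<le> d" using s by (simp add: dist_norm norm_minus_commute)
      have Rez: "Re z \<ge> d"
        using dist abs_Re_le_cmod[of "s - s0"] by (simp add: z_def w_def d_def)
      have "z = (s - s0) + (s0 - w)" by (simp add: z_def)
      then have cz: "cmod z \<le> cmod (s0 - w) + d"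
        using norm_triangle_ineq[of "s - s0" "s0 - w"] dist by simp
      have eq: "b n * exp (- z * of_real (lam n)) = a n * exp (- s * of_real (lam n))" for n
        by (simp add: b_def z_def mult.assoc exp_add[symmetric] algebra_simps)
      have "cmod (f s - (\<Sum>n<M. b n * exp (- z * of_real (lam n)))) \<le> \<epsilon> / (2 * Q) * (cmod z / Re z)"
      proof (rule Dirichlet_tail_le[OF lam])
        show "Re z > 0" using Rez d by simp
        show "cmod (\<Sum>i<j. b (M + i)) \<le> \<epsilon> / (2 * Q)" for j
          using N[OF M, of "j + M"] sum.shift_bounds_nat_ivl[of b 0 M j]
          by (simp add: add.commute lessThan_atLeast0)
        show "(\<lambda>n. b n * exp (- z * of_real (lam n))) sums f s"
          unfolding eq using f s sub by blast
      qed
      also have "\<dots> \<le> \<epsilon> / (2 * Q) * Q"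
        unfolding Q_def using cz Rez d \<open>\<epsilon> > 0\<close>
        by (intro mult_left_mono frac_le divide_nonneg_nonneg) auto
      also have "\<dots> = \<epsilon> / 2" using Q by simp
      also have "\<epsilon> / 2 < \<epsilon>" using \<open>\<epsilon> > 0\<close> by simp
      finally show "dist (?P M s) (f s) < \<epsilon>"
        unfolding eq dist_norm by (simp add: norm_minus_commute)
    qed
  qed
  with sub d show "\<exists>d>0. cball s0 d \<subseteq> Cplus \<and> uniform_limit (cball s0 d) ?P f sequentially" by blast
qed

section \<open>Gaussian smoothing along vertical lines\<close>

text \<open>The number \<open>g\<close> is the average of \<open>f (s + i h u)\<close> over a
  standard normal \<open>u\<close>. Each summand gets multiplied by the characteristic function at
  \<open>- h lam n\<close>, which is the Gaussian factor, and the Lipschitz bound controls the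
  distance of the average from \<open>f s\<close>. The delicate point is exchanging sum and
  integral, since the series need not converge absolutely.\<close>

lemma Gaussian_smoothing_sums:
  fixes a :: "nat \<Rightarrow> complex" and lam :: "nat \<Rightarrow> real"
  assumes lam: "incseq lam" "lam 0 \<ge> 0"
    and f: "\<And>s. s \<in> Cplus \<Longrightarrow> (\<lambda>n. a n * exp (- s * of_real (lam n))) sums f s"
    and lip: "\<And>t. cmod (f (s + \<i> * of_real t) - f s) \<le> L * \<bar>t\<bar>"
    and s: "s \<in> Cplus" and h: "h > 0"
  obtains g where "(\<lambda>n. a n * exp (- s * of_real (lam n)) * of_real (exp (- (h * lam n)\<^sup>2 / 2))) sums g"
    and "cmod (g - f s) \<le> L * h * (LINT u|std_normal_distribution. \<bar>u\<bar>)"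
proof -
  let ?N = std_normal_distribution
  interpret N: real_distribution ?N by (rule real_dist_normal_dist)
  define w :: complex where "w = of_real (Re s / 2)"
  define b where "b = (\<lambda>n. a n * exp (- w * of_real (lam n)))"
  define T where "T = (\<lambda>n u. a n * exp (- (s + \<i> * of_real (h * u)) * of_real (lam n)))"
  define F where "F = (\<lambda>u. f (s + \<i> * of_real (h * u)))"
  have Res: "Re s > 0" using s by (simp add: Cplus_def)
  have "w \<in> Cplus" using Res by (simp add: w_def Cplus_def)
  then have "summable b" using f[of w] by (auto simp: b_def sums_iff)
  then have "convergent (\<lambda>n. \<Sum>i<n. b i)" by (simp add: summable_iff_convergent)
  then have "Bseq (\<lambda>n. \<Sum>i<n. b i)" by (rule convergent_imp_Bseq)
  then obtain K where K: "\<And>n. cmod (\<Sum>i<n. b i) \<le> K" by (auto simp: Bseq_def)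
  have K0: "K \<ge> 0" using K[of 0] by simp
  have conv: "(\<lambda>M. \<Sum>n<M. T n u) \<longlonglongrightarrow> F u" for u
    using f[of "s + \<i> * of_real (h * u)"] Res by (simp add: T_def F_def sums_def Cplus_def)
  \<comment> \<open>Measured from the point \<open>w\<close> at half the abscissa of
    \<open>s\<close>, the ratio \<open>|z| / Re z\<close> grows only linearly in \<open>|u|\<close>,
    and the normal law has a finite first moment; so this is an integrable majorant for all partial
    sums.\<close>
  have bound: "cmod (\<Sum>n<M. T n u) \<le> K * ((cmod s + cmod w + h * \<bar>u\<bar>) / (Re s / 2))" for M u
  proof -
    define z where "z = s + \<i> * of_real (h * u) - w"
    have Rez: "Re z = Re s / 2" by (simp add: z_def w_def)
    have cz: "cmod z \<le> cmod s + cmod w + h * \<bar>u\<bar>"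
      using norm_triangle_ineq4[of "s + \<i> * of_real (h * u)" w]
        norm_triangle_ineq[of s "\<i> * of_real (h * u)"] h
      by (simp add: z_def norm_mult abs_mult)
    have eq: "T n u = b n * exp (- z * of_real (lam n))" for n
      by (simp add: T_def b_def z_def mult.assoc exp_add[symmetric] algebra_simps)
    have "cmod (\<Sum>n<M. T n u) \<le> K * (cmod z / Re z)"
      unfolding eq using lam K Res Rez by (intro norm_Dirichlet_sum_le) auto
    also have "\<dots> \<le> K * ((cmod s + cmod w + h * \<bar>u\<bar>) / (Re s / 2))"
      unfolding Rez using cz K0 Res by (intro mult_left_mono divide_right_mono) auto
    finally show ?thesis .
  qed
  have int_abs: "integrable ?N (\<lambda>u. \<bar>u\<bar>)"
    using integrable_std_normal_distribution_moment[of 1] by (simp add: integrable_abs)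
  have intw: "integrable ?N (\<lambda>u. K * ((cmod s + cmod w + h * \<bar>u\<bar>) / (Re s / 2)))"
    using int_abs by simp
  have Tmeas: "T n \<in> borel_measurable ?N" for n
    unfolding T_def by measurable
  have Fmeas: "F \<in> borel_measurable ?N"
    by (rule borel_measurable_LIMSEQ_metric[OF _ conv]) (intro borel_measurable_sum Tmeas)
  note dc = integral_dominated_convergence[OF Fmeas _ intw, of "\<lambda>M u. \<Sum>n<M. T n u"]
    integrable_dominated_convergence[OF Fmeas _ intw, of "\<lambda>M u. \<Sum>n<M. T n u"]
  have lim: "(\<lambda>M. LINT u|?N. (\<Sum>n<M. T n u)) \<longlonglongrightarrow> (LINT u|?N. F u)"
    using conv bound Tmeas by (intro dc) auto
  have intF: "integrable ?N F"
    using conv bound Tmeas by (intro dc) auto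
  have T_eq: "T n u = a n * exp (- s * of_real (lam n)) * iexp (- h * lam n * u)" for n u
    by (simp add: T_def mult.assoc exp_add[symmetric] algebra_simps)
  have int_iexp: "integrable ?N (\<lambda>u. iexp (t * u))" for t
    by (rule N.integrable_iexp) simp_all
  have intT: "integrable ?N (T n)" for n
    unfolding T_eq by (intro integrable_mult_right int_iexp)
  have T_int: "(LINT u|?N. T n u) = a n * exp (- s * of_real (lam n)) * of_real (exp (- (h * lam n)\<^sup>2 / 2))" for n
  proof -
    have "(LINT u|?N. iexp (- h * lam n * u)) = of_real (exp (- (h * lam n)\<^sup>2 / 2))"
      using fun_cong[OF char_std_normal_distribution, of "- h * lam n"] by (simp add: char_def)
    then show ?thesis unfolding T_eq by simp
  qed
  show thesis
  proof (rule that)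
    show "(\<lambda>n. a n * exp (- s * of_real (lam n)) * of_real (exp (- (h * lam n)\<^sup>2 / 2))) sums (LINT u|?N. F u)"
      unfolding sums_def T_int[symmetric] using lim intT by (simp add: Bochner_Integration.integral_sum)
    have "(LINT u|?N. F u) - f s = (LINT u|?N. F u - f s)"
      using intF N.prob_space by (subst Bochner_Integration.integral_diff) auto
    also have "cmod \<dots> \<le> (LINT u|?N. L * h * \<bar>u\<bar>)"
    proof (rule Bochner_Integration.integral_norm_bound_integral)
      show "integrable ?N (\<lambda>u. F u - f s)" using intF by simp
      show "integrable ?N (\<lambda>u. L * h * \<bar>u\<bar>)" using int_abs by simp
      show "cmod (F u - f s) \<le> L * h * \<bar>u\<bar>" for u
        using lip[of "h * u"] h by (simp add: F_def abs_mult mult.assoc)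
    qed
    finally show "cmod ((LINT u|?N. F u) - f s) \<le> L * h * (LINT u|?N. \<bar>u\<bar>)" by simp
  qed
qed

text \<open>After smoothing, the coefficients decay like \<open>exp (- (h ln n)\<^sup>2 / 2)\<close>, so the series converges
  absolutely and uniformly on \<open>Cplus\<close> and may be truncated.\<close>

lemma lipschitz_Dirichlet_approximable:
  fixes a :: "nat \<Rightarrow> complex"
  assumes f: "\<And>s. s \<in> Cplus \<Longrightarrow> (\<lambda>n. a (Suc n) / of_nat (Suc n) powr s) sums f s"
    and lip: "\<And>s t. s \<in> Cplus \<Longrightarrow> cmod (f (s + \<i> * of_real t) - f s) \<le> L * \<bar>t\<bar>"
    and "\<epsilon> > 0"
  obtains N :: nat and c :: "nat \<Rightarrow> complex" where
    "\<And>s. s \<in> Cplus \<Longrightarrow> cmod (f s - (\<Sum>n=1..N. c n / of_nat n powr s)) < \<epsilon>"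
proof -
  define lam where "lam = (\<lambda>n. ln (real (Suc n)))"
  define C where "C = (LINT u|std_normal_distribution. \<bar>u\<bar>)"
  \<comment> \<open>The smoothing error is \<open>L h C\<close>, and this width makes it at most
    \<open>\<epsilon> / 2\<close>; the added 1 keeps the denominator positive.\<close>
  define h where "h = \<epsilon> / (2 * (\<bar>L * C\<bar> + 1))"
  have h: "h > 0" using \<open>\<epsilon> > 0\<close> by (simp add: h_def)
  have "L * h * C \<le> h * (\<bar>L * C\<bar> + 1)" using h
    by (simp add: mult.assoc mult.left_commute[of L] mult_left_mono)
  also have "h * (\<bar>L * C\<bar> + 1) = \<epsilon> / 2"
  proof -
    have "\<bar>L * C\<bar> + 1 \<noteq> 0" using abs_ge_zero[of "L * C"] by linarith
    moreover have "x \<noteq> 0 \<Longrightarrow> \<epsilon> / (2 * x) * x = \<epsilon> / 2" for x :: real by simp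
    ultimately show ?thesis unfolding h_def by blast
  qed
  finally have hC: "L * h * C \<le> \<epsilon> / 2" .
  have lam: "incseq lam" "lam 0 \<ge> 0" by (auto simp: lam_def incseq_def)
  have dterm: "x / of_nat (Suc n) powr s = x * exp (- s * of_real (lam n))" for x s :: complex and n
    by (simp add: lam_def powr_def divide_inverse exp_minus Ln_of_nat del: of_nat_Suc)
  note f' = f[unfolded dterm]
  have "1 \<in> Cplus" by (simp add: Cplus_def)
  then have "(\<lambda>n. a (Suc n) * exp (- 1 * of_real (lam n))) \<longlonglongrightarrow> 0"
    using f' sums_summable summable_LIMSEQ_zero by blast
  then have "Bseq (\<lambda>n. a (Suc n) * exp (- 1 * of_real (lam n)))"
    by (intro convergent_imp_Bseq convergentI)
  then obtain A where A: "\<And>n. cmod (a (Suc n) * exp (- 1 * of_real (lam n))) \<le> A"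
    by (auto simp: Bseq_def)
  define g where "g = (\<lambda>s n. a (Suc n) * exp (- s * of_real (lam n)) * of_real (exp (- (h * lam n)\<^sup>2 / 2)))"
  define D where "D = A * exp (9 / (2 * h\<^sup>2))"
  have A0: "A \<ge> 0" using A[of 0] norm_ge_zero order_trans by blast
  have g_bound: "cmod (g s n) \<le> D * inverse ((real (Suc n))\<^sup>2)" if "s \<in> Cplus" for s n
  proof -
    have l0: "lam n \<ge> 0" by (simp add: lam_def)
    have "cmod (a (Suc n)) * exp (- lam n) \<le> A"
      using A[of n] by (simp add: norm_mult)
    moreover have "exp (lam n) * exp (- Re s * lam n) * exp (- (h * lam n)\<^sup>2 / 2)
        \<le> exp (9 / (2 * h\<^sup>2)) * exp (- 2 * lam n)"
    proof -
      \<comment> \<open>Completing the square trades the Gaussian factor for three powers of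
        \<open>exp (- lam n)\<close>. One compensates the growth of the coefficients allowed by
        convergence at \<open>s = 1\<close>, two make the bound summable.\<close>
      have "0 \<le> (h * lam n - 3 / h)\<^sup>2 / 2" by simp
      also have "\<dots> = (h * lam n)\<^sup>2 / 2 - 3 * lam n + 9 / (2 * h\<^sup>2)"
        using h by (simp add: power2_eq_square field_simps)
      finally have "0 \<le> (h * lam n)\<^sup>2 / 2 - 3 * lam n + 9 / (2 * h\<^sup>2)" .
      then have "lam n - Re s * lam n - (h * lam n)\<^sup>2 / 2 \<le> 9 / (2 * h\<^sup>2) - 2 * lam n"
      proof -
        have "Re s * lam n \<ge> 0" using that l0 by (simp add: Cplus_def)
        with \<open>0 \<le> (h * lam n)\<^sup>2 / 2 - 3 * lam n + 9 / (2 * h\<^sup>2)\<close> show ?thesis by linarith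
      qed
      then show ?thesis unfolding exp_add[symmetric] by (subst exp_le_cancel_iff) simp
    qed
    ultimately have "(cmod (a (Suc n)) * exp (- lam n)) * (exp (lam n) * exp (- Re s * lam n) * exp (- (h * lam n)\<^sup>2 / 2))
        \<le> A * (exp (9 / (2 * h\<^sup>2)) * exp (- 2 * lam n))"
      by (rule mult_mono) (use A0 in auto)
    moreover have "(cmod (a (Suc n)) * exp (- lam n)) * (exp (lam n) * exp (- Re s * lam n) * exp (- (h * lam n)\<^sup>2 / 2))
       = cmod (g s n)"
      by (simp add: g_def norm_mult mult.assoc) (simp add: exp_minus)
    moreover have "exp (- 2 * lam n) = inverse ((real (Suc n))\<^sup>2)"
      by (simp add: lam_def exp_minus exp_double del: of_nat_Suc)
    ultimately show ?thesis by (simp add: D_def mult.assoc)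
  qed
  have sumD: "summable (\<lambda>n. D * inverse ((real (Suc n))\<^sup>2))"
    using inverse_power_summable[of 2, where 'a = real]
    by (intro summable_mult, subst summable_Suc_iff[of "\<lambda>n. inverse ((real n)\<^sup>2)"]) simp
  from suminf_exist_split[OF _ sumD, of "\<epsilon> / 2"] \<open>\<epsilon> > 0\<close>
  obtain M where M: "norm (\<Sum>i. D * inverse ((real (Suc (i + M)))\<^sup>2)) < \<epsilon> / 2"
    by auto
  \<comment> \<open>As \<open>lam\<close> is indexed from zero, the coefficient of index
    \<open>n\<close> carries the Gaussian factor at \<open>ln n = lam (n - 1)\<close>.\<close>
  define c where "c = (\<lambda>n. a n * of_real (exp (- (h * lam (n - 1))\<^sup>2 / 2)))"
  show thesis
  proof (rule that)
    fix s assume s: "s \<in> Cplus"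
    obtain G where G: "g s sums G" "cmod (G - f s) \<le> L * h * C"
      using Gaussian_smoothing_sums[OF lam f' lip[OF s] s h] unfolding g_def C_def by blast
    have "(\<Sum>n=1..M. c n / of_nat n powr s) = (\<Sum>n<M. c (Suc n) / of_nat (Suc n) powr s)"
      by (rule sum.reindex_bij_witness[of _ Suc "\<lambda>n. n - 1"]) auto
    also have "\<dots> = (\<Sum>n<M. g s n)"
      unfolding dterm by (simp add: c_def g_def mult_ac)
    finally have eq: "(\<Sum>n=1..M. c n / of_nat n powr s) = (\<Sum>n<M. g s n)" .
    have "(\<lambda>i. g s (i + M)) sums (G - (\<Sum>n<M. g s n))"
      by (rule sums_split_initial_segment[OF G(1)])
    moreover have "cmod (\<Sum>i. g s (i + M)) \<le> (\<Sum>i. D * inverse ((real (Suc (i + M)))\<^sup>2))"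
      by (intro norm_suminf_le g_bound s summable_ignore_initial_segment[OF sumD])
    ultimately have "cmod (G - (\<Sum>n<M. g s n)) < \<epsilon> / 2"
      using M by (simp add: sums_iff)
    moreover have "f s - (\<Sum>n<M. g s n) = (G - (\<Sum>n<M. g s n)) - (G - f s)" by simp
    ultimately show "cmod (f s - (\<Sum>n=1..M. c n / of_nat n powr s)) < \<epsilon>"
      unfolding eq using norm_triangle_ineq4[of "G - (\<Sum>n<M. g s n)" "G - f s"] G(2) hC by simp
  qed
qed

section \<open>Matrices of functions\<close>

text \<open>Entrywise bounds match the way in which matrices over a function algebra are given. They
  are not submultiplicative, so products carry the inner dimension as a factor.\<close>

definition entries_le :: "complex mat \<Rightarrow> real \<Rightarrow> bool" where
  "entries_le M K \<longleftrightarrow> (\<forall>i<dim_row M. \<forall>j<dim_col M. cmod (M $$ (i, j)) \<le> K)"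

lemma entries_leD: "entries_le M K \<Longrightarrow> M \<in> carrier_mat r c \<Longrightarrow> i < r \<Longrightarrow> j < c \<Longrightarrow> cmod (M $$ (i, j)) \<le> K"
  by (auto simp: entries_le_def)

lemma entries_leI:
  "M \<in> carrier_mat r c \<Longrightarrow> (\<And>i j. i < r \<Longrightarrow> j < c \<Longrightarrow> cmod (M $$ (i, j)) \<le> K) \<Longrightarrow> entries_le M K"
  by (auto simp: entries_le_def)

lemma index_mult_mat_sum:
  "M \<in> carrier_mat r m \<Longrightarrow> N \<in> carrier_mat m c \<Longrightarrow> i < r \<Longrightarrow> j < c \<Longrightarrow>
    (M * N) $$ (i, j) = (\<Sum>k = 0..<m. M $$ (i, k) * N $$ (k, j))"
  by (auto simp: scalar_prod_def)

lemma entries_le_mult: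
  assumes M: "M \<in> carrier_mat r m" "entries_le M a" and N: "N \<in> carrier_mat m c" "entries_le N b"
    and "a \<ge> 0"
  shows "entries_le (M * N) (real m * (a * b))"
proof (rule entries_leI[OF mult_carrier_mat[OF M(1) N(1)]])
  fix i j assume ij: "i < r" "j < c"
  have "cmod (\<Sum>k = 0..<m. M $$ (i, k) * N $$ (k, j)) \<le> (\<Sum>k = 0..<m. a * b)"
  proof (rule sum_norm_le)
    fix k assume "k \<in> {0..<m}"
    then show "cmod (M $$ (i, k) * N $$ (k, j)) \<le> a * b"
      unfolding norm_mult using ij \<open>a \<ge> 0\<close>
      by (intro mult_mono entries_leD[OF M(2,1)] entries_leD[OF N(2,1)]) simp_all
  qed
  then show "cmod ((M * N) $$ (i, j)) \<le> real m * (a * b)"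
    unfolding index_mult_mat_sum[OF M(1) N(1) ij] by simp
qed

lemma entries_le_add:
  assumes M: "M \<in> carrier_mat r c" "entries_le M a" and N: "N \<in> carrier_mat r c" "entries_le N b"
  shows "entries_le (M + N) (a + b)"
proof (rule entries_leI[OF add_carrier_mat[OF N(1)]])
  fix i j assume ij: "i < r" "j < c"
  then show "cmod ((M + N) $$ (i, j)) \<le> a + b"
    using norm_triangle_mono[OF entries_leD[OF M(2,1) ij] entries_leD[OF N(2,1) ij]] N(1) by simp
qed

lemma entries_le_mono: "entries_le M a \<Longrightarrow> a \<le> b \<Longrightarrow> entries_le M b"
  unfolding entries_le_def by (meson order_trans)

text \<open>Factors are exchanged one at a time; an exchange costs \<open>d\<close> times a power of
  \<open>K\<close>. The requirement \<open>K \<ge> 1\<close> lets shorter products be bounded by the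
  full power.\<close>

lemma norm_prod_diff_le:
  fixes a b :: "nat \<Rightarrow> complex"
  assumes "\<And>i. i < n \<Longrightarrow> cmod (a i) \<le> K" "\<And>i. i < n \<Longrightarrow> cmod (b i) \<le> K"
    and "\<And>i. i < n \<Longrightarrow> cmod (a i - b i) \<le> d" and "K \<ge> 1" "d \<ge> 0"
  shows "cmod ((\<Prod>i = 0..<n. a i) - (\<Prod>i = 0..<n. b i)) \<le> real n * K ^ n * d"
  using assms(1-3)
proof (induction n)
  case (Suc n)
  have pa: "cmod (\<Prod>i = 0..<n. a i) \<le> K ^ n"
    using prod_mono[of "{0..<n}" "\<lambda>i. cmod (a i)" "\<lambda>_. K"] Suc.prems(1)
    by (simp flip: prod_norm)
  have IH: "cmod ((\<Prod>i = 0..<n. a i) - (\<Prod>i = 0..<n. b i)) \<le> real n * K ^ n * d"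
    using Suc by simp
  have "(\<Prod>i = 0..<Suc n. a i) - (\<Prod>i = 0..<Suc n. b i)
      = (\<Prod>i = 0..<n. a i) * (a n - b n) + ((\<Prod>i = 0..<n. a i) - (\<Prod>i = 0..<n. b i)) * b n"
    by (simp add: algebra_simps)
  also have "cmod \<dots> \<le> K ^ n * d + (real n * K ^ n * d) * K"
  proof (rule norm_triangle_mono; unfold norm_mult)
    show "cmod (\<Prod>i = 0..<n. a i) * cmod (a n - b n) \<le> K ^ n * d"
      using Suc.prems(3)[of n] assms(4) by (intro mult_mono pa) simp_all
    show "cmod ((\<Prod>i = 0..<n. a i) - (\<Prod>i = 0..<n. b i)) * cmod (b n) \<le> real n * K ^ n * d * K"
      using Suc.prems(2)[of n] assms(4,5) by (intro mult_mono IH) simp_all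
  qed
  also have "K ^ n * d \<le> K * K ^ n * d"
    using assms(4,5) by (intro mult_right_mono) auto
  finally show ?case by (simp add: algebra_simps)
qed simp

lemma cmod_signof: "cmod (signof p) = 1"
  by (simp add: sign_def)

text \<open>The Leibniz expansion reduces this to products of entries. The radius \<open>d\<close>
  depends only on \<open>n\<close>, \<open>K\<close> and \<open>e\<close>, so for matrix-valued
  functions the estimate applies at all points at once.\<close>

lemma det_uniformly_continuous:
  assumes "e > 0"
  obtains d where "d > 0"
    and "\<And>M N. M \<in> carrier_mat n n \<Longrightarrow> N \<in> carrier_mat n n \<Longrightarrow> entries_le M K \<Longrightarrow>
      entries_le (M - N) d \<Longrightarrow> cmod (det M - det N) < e"
proof -
  \<comment> \<open>Only \<open>M\<close> has an assumed bound; since \<open>d \<le> 1\<close>, the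
    entries of \<open>N\<close> are then bounded by \<open>|K| + 1\<close>. The extra 1 in
    \<open>Q\<close> makes the final inequality strict.\<close>
  define L where "L = \<bar>K\<bar> + 1"
  define Q where "Q = fact n * (real n * L ^ n) + 1"
  have L: "L \<ge> 1" by (simp add: L_def)
  have Q: "Q > 0" unfolding Q_def using L by (intro add_nonneg_pos mult_nonneg_nonneg) auto
  define d where "d = min 1 (e / Q)"
  have d: "d > 0" "d \<le> 1" using Q \<open>e > 0\<close> by (auto simp: d_def)
  have "d * Q \<le> e / Q * Q" using Q by (intro mult_right_mono) (auto simp: d_def)
  then have dQ: "d * Q \<le> e" using Q by simp
  show thesis
  proof (rule that[OF d(1)])
    fix M N :: "complex mat"
    assume M: "M \<in> carrier_mat n n" and N: "N \<in> carrier_mat n n"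
      and MK: "entries_le M K" and MN: "entries_le (M - N) d"
    have mK: "cmod (M $$ (i, j)) \<le> K" if "i < n" "j < n" for i j
      using MK M that by (auto simp: entries_le_def)
    have m: "cmod (M $$ (i, j)) \<le> L" "cmod (M $$ (i, j) - N $$ (i, j)) \<le> d" if "i < n" "j < n" for i j
      using mK[OF that] MN M N that by (auto simp: entries_le_def L_def)
    have nb: "cmod (N $$ (i, j)) \<le> L" if "i < n" "j < n" for i j
      using mK[OF that] m(2)[OF that] d(2)
        norm_triangle_ineq4[of "M $$ (i, j)" "M $$ (i, j) - N $$ (i, j)"]
      by (simp add: L_def)
    have "det M - det N = (\<Sum>p\<in>{p. p permutes {0..<n}}.
        signof p * ((\<Prod>i = 0..<n. M $$ (i, p i)) - (\<Prod>i = 0..<n. N $$ (i, p i))))"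
      by (simp add: det_def'[OF M] det_def'[OF N] sum_subtractf right_diff_distrib)
    also have "cmod \<dots> \<le> (\<Sum>p\<in>{p. p permutes {0..<n}}. real n * L ^ n * d)"
    proof (rule sum_norm_le)
      fix p assume "p \<in> {p. p permutes {0..<n}}"
      then have p: "p i < n" if "i < n" for i
        using that permutes_in_image[of p "{0..<n}" i] by simp
      show "cmod (signof p * ((\<Prod>i = 0..<n. M $$ (i, p i)) - (\<Prod>i = 0..<n. N $$ (i, p i))))
          \<le> real n * L ^ n * d"
        unfolding norm_mult cmod_signof mult_1
        using m nb p L d(1) by (intro norm_prod_diff_le) auto
    qed
    also have "\<dots> = d * (Q - 1)"
      by (simp add: card_permutations[of _ n] Q_def)
    also have "\<dots> < d * Q" using d(1) by simp
    finally show "cmod (det M - det N) < e" using dQ by simp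
  qed
qed

text \<open>The algebra and its uniform closure need the same matrix calculus, so products,
  determinants and adjugates are treated once for any class of functions closed under the ring
  operations. The functions live on the whole type; the instances look only at their values on
  \<open>X\<close>.\<close>

locale function_class =
  fixes C :: "('x \<Rightarrow> complex) \<Rightarrow> bool"
  assumes const: "C (\<lambda>s. c)"
    and add: "C f \<Longrightarrow> C g \<Longrightarrow> C (\<lambda>s. f s + g s)"
    and mult: "C f \<Longrightarrow> C g \<Longrightarrow> C (\<lambda>s. f s * g s)"
begin

definition mat_over :: "nat \<Rightarrow> nat \<Rightarrow> ('x \<Rightarrow> complex mat) \<Rightarrow> bool" where
  "mat_over r c M \<longleftrightarrow> (\<forall>s. M s \<in> carrier_mat r c) \<and> (\<forall>i<r. \<forall>j<c. C (\<lambda>s. M s $$ (i, j)))"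

lemma mat_over_carrier: "mat_over r c M \<Longrightarrow> M s \<in> carrier_mat r c"
  by (simp add: mat_over_def)

lemma sum: "(\<And>i. i \<in> I \<Longrightarrow> C (f i)) \<Longrightarrow> C (\<lambda>s. \<Sum>i\<in>I. f i s)"
  by (induction I rule: infinite_finite_induct) (simp_all add: const add)

lemma prod: "(\<And>i. i \<in> I \<Longrightarrow> C (f i)) \<Longrightarrow> C (\<lambda>s. \<Prod>i\<in>I. f i s)"
  by (induction I rule: infinite_finite_induct) (simp_all add: const mult)

lemma minus: "C f \<Longrightarrow> C g \<Longrightarrow> C (\<lambda>s. f s - g s)"
  using add[of f "\<lambda>s. (-1) * g s"] mult[OF const[of "-1"], of g] by simp

lemma mat_over_const: "M \<in> carrier_mat r c \<Longrightarrow> mat_over r c (\<lambda>s. M)"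
  by (simp add: mat_over_def const)

lemma mat_over_mult:
  assumes "mat_over r m M" "mat_over m c N"
  shows "mat_over r c (\<lambda>s. M s * N s)"
  unfolding mat_over_def
proof (intro conjI allI impI)
  show "M s * N s \<in> carrier_mat r c" for s
    using assms[THEN mat_over_carrier] by (rule mult_carrier_mat)
  fix i j assume ij: "i < r" "j < c"
  have eq: "(\<lambda>s. (M s * N s) $$ (i, j)) = (\<lambda>s. \<Sum>k = 0..<m. M s $$ (i, k) * N s $$ (k, j))"
    using index_mult_mat_sum[OF assms[THEN mat_over_carrier] ij] by (rule ext)
  show "C (\<lambda>s. (M s * N s) $$ (i, j))"
    unfolding eq using ij assms by (intro sum mult) (auto simp: mat_over_def)
qed

lemma mat_over_add:
  assumes "mat_over r c M" "mat_over r c N"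
  shows "mat_over r c (\<lambda>s. M s + N s)"
proof -
  have "dim_row (N s) = r" "dim_col (N s) = c" for s
    using mat_over_carrier[OF assms(2)] by (rule carrier_matD)+
  then show ?thesis using assms by (auto simp: mat_over_def add)
qed

lemma mat_over_minus:
  assumes "mat_over r c M" "mat_over r c N"
  shows "mat_over r c (\<lambda>s. M s - N s)"
proof -
  have "dim_row (N s) = r" "dim_col (N s) = c" for s
    using mat_over_carrier[OF assms(2)] by (rule carrier_matD)+
  then show ?thesis using assms by (auto simp: mat_over_def minus minus_carrier_mat)
qed

lemma mat_over_smult:
  assumes "C f" "mat_over r c M"
  shows "mat_over r c (\<lambda>s. f s \<cdot>\<^sub>m M s)"
proof -
  have "dim_row (M s) = r" "dim_col (M s) = c" for s
    using mat_over_carrier[OF assms(2)] by (rule carrier_matD)+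
  then show ?thesis using assms by (auto simp: mat_over_def mult)
qed

lemma det_mem:
  assumes "mat_over n n M"
  shows "C (\<lambda>s. det (M s))"
proof -
  have eq: "(\<lambda>s. det (M s)) = (\<lambda>s. \<Sum>p\<in>{p. p permutes {0..<n}}.
      signof p * (\<Prod>i = 0..<n. M s $$ (i, p i)))"
    using det_def'[OF mat_over_carrier[OF assms]] by (rule ext)
  show ?thesis
    unfolding eq
  proof (intro sum mult const prod)
    fix p i assume "p \<in> {p. p permutes {0..<n}}" "i \<in> {0..<n}"
    then have "i < n" "p i < n"
      using permutes_in_image[of p "{0..<n}" i] by auto
    then show "C (\<lambda>s. M s $$ (i, p i))" using assms by (simp add: mat_over_def)
  qed
qed

lemma adj_mat_mem:
  assumes "mat_over n n M"
  shows "mat_over n n (\<lambda>s. adj_mat (M s))"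
  unfolding mat_over_def
proof (intro conjI allI impI)
  show "adj_mat (M s) \<in> carrier_mat n n" for s
    using mat_over_carrier[OF assms] by (rule adj_mat(1))
  fix i j assume ij: "i < n" "j < n"
  have dims: "dim_row (M s) = n" "dim_col (M s) = n" for s
    using mat_over_carrier[OF assms] by (rule carrier_matD)+
  have "mat_over (n - 1) (n - 1) (\<lambda>s. mat_delete (M s) j i)"
    using ij assms by (auto simp: mat_over_def mat_delete_def dims)
  then have "C (\<lambda>s. (-1) ^ (j + i) * det (mat_delete (M s) j i))"
    by (intro mult const det_mem)
  then show "C (\<lambda>s. adj_mat (M s) $$ (i, j))"
    using ij by (simp add: adj_mat_def cofactor_def dims)
qed

end

section \<open>Pairs of idempotent complex matrices\<close>

lemma idempotent_complement:
  fixes Q :: "complex mat"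
  assumes Q: "Q \<in> carrier_mat n n" and idem: "Q * Q = Q"
  defines "Q' \<equiv> 1\<^sub>m n - Q"
  shows "Q' \<in> carrier_mat n n" "Q + Q' = 1\<^sub>m n" "Q * Q' = 0\<^sub>m n n" "Q' * Q = 0\<^sub>m n n" "Q' * Q' = Q'"
proof -
  show c: "Q' \<in> carrier_mat n n" using Q by (simp add: Q'_def minus_carrier_mat)
  show "Q + Q' = 1\<^sub>m n" using Q by (auto simp: Q'_def)
  show 1: "Q * Q' = 0\<^sub>m n n"
    unfolding Q'_def using Q idem mult_minus_distrib_mat[OF Q one_carrier_mat Q] by auto
  show "Q' * Q = 0\<^sub>m n n"
    unfolding Q'_def using Q idem minus_mult_distrib_mat[OF one_carrier_mat Q Q] by auto
  show "Q' * Q' = Q'"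
    using minus_mult_distrib_mat[OF one_carrier_mat Q c] c 1 by (auto simp: Q'_def[symmetric])
qed

text \<open>For idempotents \<open>Q\<close> and \<open>R\<close>, the matrix \<open>T = Q R + (1 - Q) (1 - R)\<close> intertwines them; it is
  close to the identity when \<open>Q\<close> and \<open>R\<close> are close, because
  \<open>T - 1 = Q (R - Q) + (1 - Q) ((1 - R) - (1 - Q))\<close>.\<close>

lemma idempotent_intertwiner:
  fixes Q R :: "complex mat"
  assumes Q: "Q \<in> carrier_mat n n" "Q * Q = Q" and R: "R \<in> carrier_mat n n" "R * R = R"
  defines "T \<equiv> Q * R + (1\<^sub>m n - Q) * (1\<^sub>m n - R)"
  shows "T \<in> carrier_mat n n" "Q * T = T * R"
    and "entries_le Q K \<Longrightarrow> entries_le (R - Q) d \<Longrightarrow> K \<ge> 0 \<Longrightarrow> d \<ge> 0 \<Longrightarrow>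
      entries_le (1\<^sub>m n - T) (2 * real n * (K + 1) * d)"
proof -
  define Qc where "Qc = 1\<^sub>m n - Q"
  define Rc where "Rc = 1\<^sub>m n - R"
  note q = idempotent_complement[OF Q, folded Qc_def] and r = idempotent_complement[OF R, folded Rc_def]
  have T: "T = Q * R + Qc * Rc" by (simp add: T_def Qc_def Rc_def)
  show Tc: "T \<in> carrier_mat n n" unfolding T using Q R q(1) r(1) by auto
  have "Q * T = Q * (Q * R) + Q * (Qc * Rc)"
    unfolding T using Q R q(1) r(1) by (intro mult_add_distrib_mat[of _ n n _ n]) auto
  also have "Q * (Q * R) = Q * R"
    using assoc_mult_mat[OF Q(1) Q(1) R(1)] Q(2) by simp
  also have "Q * (Qc * Rc) = 0\<^sub>m n n"
    using assoc_mult_mat[OF Q(1) q(1) r(1)] q(3) r(1) by simp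
  finally have 1: "Q * T = Q * R" using Q R by auto
  have "T * R = (Q * R) * R + (Qc * Rc) * R"
    unfolding T using Q R q(1) r(1) by (intro add_mult_distrib_mat[of _ n n]) auto
  also have "(Q * R) * R = Q * R"
    using assoc_mult_mat[OF Q(1) R(1) R(1)] R(2) by simp
  also have "(Qc * Rc) * R = 0\<^sub>m n n"
    using assoc_mult_mat[OF q(1) r(1) R(1)] r(4) q(1) by simp
  finally show "Q * T = T * R" using 1 Q R by auto
  assume K: "entries_le Q K" "K \<ge> 0" and d: "entries_le (R - Q) d" "d \<ge> 0"
  have Qij: "cmod (Q $$ (i, j)) \<le> K" if "i < n" "j < n" for i j
    by (rule entries_leD[OF K(1) Q(1) that])
  have "cmod (Qc $$ (i, j)) \<le> K + 1" if "i < n" "j < n" for i j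
    using Qij[OF that] norm_triangle_ineq4[of "1\<^sub>m n $$ (i, j)" "Q $$ (i, j)"] Q(1) that
    by (auto simp: Qc_def split: if_splits)
  then have Kc: "entries_le Qc (K + 1)" by (rule entries_leI[OF q(1)])
  have d': "entries_le (Q - R) d"
    using d(1) Q(1) R(1) by (auto simp: entries_le_def norm_minus_commute)
  have "Qc * Qc - Qc * Rc = Qc * (R - Q)"
  proof -
    have "Qc - Rc = R - Q" using Q(1) R(1) by (auto simp: Qc_def Rc_def)
    then show ?thesis using mult_minus_distrib_mat[OF q(1) q(1) r(1)] by simp
  qed
  moreover have "Q * Q - Q * R = Q * (Q - R)"
    using mult_minus_distrib_mat[OF Q(1) Q(1) R(1)] by simp
  moreover have "1\<^sub>m n - T = (Q * Q - Q * R) + (Qc * Qc - Qc * Rc)"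
  proof -
    have "1\<^sub>m n - T = (Q + Qc) - (Q * R + Qc * Rc)" using q(2) T by simp
    also have "\<dots> = (Q - Q * R) + (Qc - Qc * Rc)"
      using Q(1) R(1) q(1) r(1) by (auto simp del: index_mult_mat(1))
    finally show ?thesis using Q(2) q(5) by simp
  qed
  ultimately have eq: "1\<^sub>m n - T = Q * (Q - R) + Qc * (R - Q)" by simp
  have c: "Q - R \<in> carrier_mat n n" "R - Q \<in> carrier_mat n n" using Q(1) R(1) by auto
  have "entries_le (Q * (Q - R) + Qc * (R - Q)) (real n * (K * d) + real n * ((K + 1) * d))"
    using K d by (intro entries_le_add[of _ n n] entries_le_mult[of _ n n _ _ n]
      mult_carrier_mat[of _ n n _ n] Q q c d' Kc) simp_all
  then show "entries_le (1\<^sub>m n - T) (2 * real n * (K + 1) * d)"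
    unfolding eq by (rule entries_le_mono) (use d in \<open>simp add: algebra_simps\<close>)
qed

section \<open>Algebras of functions with the Wiener property\<close>

text \<open>These are the properties of the algebra on which the splitting of idempotents rests. The
  Wiener property is stated with an explicit lower bound \<open>\<delta>\<close>, the form in which
  bounds on determinants arise.\<close>

locale wiener_function_algebra =
  fixes X :: "'x set" and A :: "('x \<Rightarrow> complex) set"
  assumes nonempty: "X \<noteq> {}"
    and extensional: "A \<subseteq> extensional X"
    and const_mem: "(\<lambda>x\<in>X. c) \<in> A"
    and add_mem: "f \<in> A \<Longrightarrow> g \<in> A \<Longrightarrow> (\<lambda>x\<in>X. f x + g x) \<in> A"
    and mult_mem: "f \<in> A \<Longrightarrow> g \<in> A \<Longrightarrow> (\<lambda>x\<in>X. f x * g x) \<in> A"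
    and bounded_mem: "f \<in> A \<Longrightarrow> \<exists>K. \<forall>x\<in>X. cmod (f x) \<le> K"
    and wiener: "f \<in> A \<Longrightarrow> \<delta> > 0 \<Longrightarrow> (\<And>x. x \<in> X \<Longrightarrow> \<delta> \<le> cmod (f x)) \<Longrightarrow> (\<lambda>x\<in>X. 1 / f x) \<in> A"
begin

definition mem :: "('x \<Rightarrow> complex) \<Rightarrow> bool" where
  "mem f \<longleftrightarrow> restrict f X \<in> A"

text \<open>Membership in the uniform closure of \<open>A\<close>, judged by the values on
  \<open>X\<close> alone.\<close>

definition approximable :: "('x \<Rightarrow> complex) \<Rightarrow> bool" where
  "approximable f \<longleftrightarrow> (\<forall>e>0. \<exists>g\<in>A. \<forall>x\<in>X. cmod (f x - g x) < e)"

lemma mem_approximable: "mem f \<Longrightarrow> approximable f"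
  unfolding mem_def approximable_def by (intro allI impI bexI[of _ "restrict f X"]) auto

lemma approximableE:
  assumes "approximable f" "e > 0"
  obtains g where "g \<in> A" "\<And>x. x \<in> X \<Longrightarrow> cmod (f x - g x) < e"
  using assms unfolding approximable_def by blast

lemma approximable_bounded:
  assumes "approximable f"
  obtains K where "K \<ge> 0" "\<And>x. x \<in> X \<Longrightarrow> cmod (f x) \<le> K"
proof -
  obtain g where g: "g \<in> A" "\<And>x. x \<in> X \<Longrightarrow> cmod (f x - g x) < 1"
    using approximableE[OF assms, of 1] by auto
  obtain K where K: "\<And>x. x \<in> X \<Longrightarrow> cmod (g x) \<le> K" using bounded_mem[OF g(1)] by blast
  show thesis
  proof (rule that)
    fix x assume x: "x \<in> X"
    show "cmod (f x) \<le> \<bar>K\<bar> + 1"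
      using g(2)[OF x] K[OF x] norm_triangle_ineq[of "f x - g x" "g x"] by simp
  qed simp
qed

sublocale mem: function_class mem
proof
  show "mem (\<lambda>s. c)" for c using const_mem by (simp add: mem_def)
  show "mem (\<lambda>s. f s + g s)" if "mem f" "mem g" for f g
    using add_mem[OF that[unfolded mem_def]] by (simp add: mem_def restrict_def cong: if_cong)
  show "mem (\<lambda>s. f s * g s)" if "mem f" "mem g" for f g
    using mult_mem[OF that[unfolded mem_def]] by (simp add: mem_def restrict_def cong: if_cong)
qed

sublocale approximable: function_class approximable
proof
  show "approximable (\<lambda>s. c)" for c by (intro mem_approximable mem.const)
  fix f g assume f: "approximable f" and g: "approximable g"
  show "approximable (\<lambda>s. f s + g s)"
    unfolding approximable_def
  proof (intro allI impI)
    fix e :: real assume "e > 0"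
    then have "e / 2 > 0" by simp
    obtain f' where f': "f' \<in> A" "\<And>x. x \<in> X \<Longrightarrow> cmod (f x - f' x) < e / 2"
      using approximableE[OF f \<open>e / 2 > 0\<close>] by blast
    obtain g' where g': "g' \<in> A" "\<And>x. x \<in> X \<Longrightarrow> cmod (g x - g' x) < e / 2"
      using approximableE[OF g \<open>e / 2 > 0\<close>] by blast
    have "cmod (f x + g x - (\<lambda>x\<in>X. f' x + g' x) x) < e" if "x \<in> X" for x
      using norm_triangle_ineq[of "f x - f' x" "g x - g' x"] f'(2)[OF that] g'(2)[OF that] that
      by (simp add: algebra_simps)
    then show "\<exists>h\<in>A. \<forall>x\<in>X. cmod (f x + g x - h x) < e" using add_mem[OF f'(1) g'(1)] by blast
  qed
  show "approximable (\<lambda>s. f s * g s)"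
    unfolding approximable_def
  proof (intro allI impI)
    fix e :: real assume "e > 0"
    obtain F where F: "F \<ge> 0" "\<And>x. x \<in> X \<Longrightarrow> cmod (f x) \<le> F" using approximable_bounded[OF f] by blast
    obtain G where G: "G \<ge> 0" "\<And>x. x \<in> X \<Longrightarrow> cmod (g x) \<le> G" using approximable_bounded[OF g] by blast
    \<comment> \<open>The product error is at most \<open>d G + (F + 1) d\<close>, where
      \<open>F + 1\<close> bounds the approximant \<open>f'\<close> because
      \<open>d \<le> 1\<close>; the 2 in the denominator makes the comparison with \<open>e\<close>
      strict.\<close>
    define d where "d = min 1 (e / (F + G + 2))"
    have d: "d > 0" "d \<le> 1" using \<open>e > 0\<close> F(1) G(1) by (auto simp: d_def)
    have "d * (F + G + 2) \<le> e / (F + G + 2) * (F + G + 2)"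
      using F(1) G(1) by (intro mult_right_mono) (auto simp: d_def)
    also have "\<dots> = e" using F(1) G(1) by simp
    finally have de: "d * (F + G + 2) \<le> e" .
    obtain f' where f': "f' \<in> A" "\<And>x. x \<in> X \<Longrightarrow> cmod (f x - f' x) < d"
      using approximableE[OF f d(1)] by blast
    obtain g' where g': "g' \<in> A" "\<And>x. x \<in> X \<Longrightarrow> cmod (g x - g' x) < d"
      using approximableE[OF g d(1)] by blast
    have "cmod (f x * g x - (\<lambda>x\<in>X. f' x * g' x) x) < e" if x: "x \<in> X" for x
    proof -
      have f1: "cmod (f' x) \<le> F + 1"
        using norm_triangle_ineq4[of "f x" "f x - f' x"] f'(2)[OF x] F(2)[OF x] d(2) by simp
      have "f x * g x - f' x * g' x = (f x - f' x) * g x + f' x * (g x - g' x)"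
        by (simp add: algebra_simps)
      also have "cmod \<dots> \<le> d * G + (F + 1) * d"
        by (rule norm_triangle_mono; unfold norm_mult; intro mult_mono f1 G(2)[OF x])
           (use f'(2)[OF x] g'(2)[OF x] d F(1) in simp_all)
      also have "\<dots> < d * (F + G + 2)" using d(1) by (simp add: algebra_simps)
      finally show ?thesis using x de by simp
    qed
    then show "\<exists>h\<in>A. \<forall>x\<in>X. cmod (f x * g x - h x) < e" using mult_mem[OF f'(1) g'(1)] by blast
  qed
qed

lemma mat_over_approximable: "mem.mat_over r c M \<Longrightarrow> approximable.mat_over r c M"
  by (auto simp: mem.mat_over_def approximable.mat_over_def intro: mem_approximable)

lemma mat_over_bounded:
  assumes "approximable.mat_over r c M"
  obtains K where "K \<ge> 0" "\<And>x. x \<in> X \<Longrightarrow> entries_le (M x) K"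
proof -
  have "\<exists>K. K \<ge> 0 \<and> (\<forall>x\<in>X. cmod (M x $$ (i, j)) \<le> K)" if "i < r" "j < c" for i j
  proof -
    have "approximable (\<lambda>x. M x $$ (i, j))" using assms that by (simp add: approximable.mat_over_def)
    then show ?thesis by (rule approximable_bounded) blast
  qed
  then obtain K where K: "\<And>i j. i < r \<Longrightarrow> j < c \<Longrightarrow> K i j \<ge> 0 \<and> (\<forall>x\<in>X. cmod (M x $$ (i, j)) \<le> K i j)"
    by metis
  define L where "L = (\<Sum>i<r. \<Sum>j<c. K i j)"
  show thesis
  proof (rule that)
    show "L \<ge> 0" unfolding L_def using K by (intro sum_nonneg) auto
    fix x assume x: "x \<in> X"
    show "entries_le (M x) L"
    proof (rule entries_leI[OF approximable.mat_over_carrier[OF assms]])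
      fix i j assume ij: "i < r" "j < c"
      have "cmod (M x $$ (i, j)) \<le> K i j" using K ij x by blast
      also have "\<dots> \<le> (\<Sum>j<c. K i j)"
        using K ij by (intro member_le_sum) auto
      also have "\<dots> \<le> L"
        unfolding L_def using K ij
        by (intro member_le_sum[where f = "\<lambda>i. \<Sum>j<c. K i j"] sum_nonneg) auto
      finally show "cmod (M x $$ (i, j)) \<le> L" .
    qed
  qed
qed

lemma mat_over_approximate:
  assumes "approximable.mat_over r c M" "e > 0"
  obtains N where "mem.mat_over r c N" "\<And>x. x \<in> X \<Longrightarrow> entries_le (M x - N x) e"
proof -
  have "\<exists>g\<in>A. \<forall>x\<in>X. cmod (M x $$ (i, j) - g x) < e" if "i < r" "j < c" for i j
    using assms that by (auto simp: approximable.mat_over_def approximable_def)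
  then obtain g where g: "\<And>i j. i < r \<Longrightarrow> j < c \<Longrightarrow> g i j \<in> A"
    "\<And>i j x. i < r \<Longrightarrow> j < c \<Longrightarrow> x \<in> X \<Longrightarrow> cmod (M x $$ (i, j) - g i j x) < e"
    by metis
  define N where "N = (\<lambda>x. mat r c (\<lambda>(i, j). g i j x))"
  have Nc: "N x \<in> carrier_mat r c" for x by (simp add: N_def)
  show thesis
  proof (rule that)
    have "restrict (g i j) X = g i j" if "i < r" "j < c" for i j
      using g(1)[OF that] extensional by (meson extensional_restrict subsetD)
    then show "mem.mat_over r c N"
      using g(1) by (auto simp: mem.mat_over_def mem_def N_def)
    fix x assume x: "x \<in> X"
    show "entries_le (M x - N x) e"
      using g(2)[OF _ _ x] by (intro entries_leI[OF minus_carrier_mat[OF Nc]]) (auto simp: N_def less_imp_le)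
  qed
qed

text \<open>Similarity of \<open>P\<close> and \<open>Q\<close> over the uniform closure.
  Invertibility of \<open>G\<close> is encoded by a lower bound on its determinant: no inverse has
  to be formed in the closure, and the bound survives small perturbations of
  \<open>G\<close>.\<close>

definition intertwined :: "nat \<Rightarrow> ('x \<Rightarrow> complex mat) \<Rightarrow> ('x \<Rightarrow> complex mat) \<Rightarrow> bool" where
  "intertwined n P Q \<longleftrightarrow> (\<exists>G. approximable.mat_over n n G \<and>
    (\<exists>\<delta>>0. \<forall>x\<in>X. \<delta> \<le> cmod (det (G x)) \<and> P x * G x = G x * Q x))"

lemma intertwined_refl: "approximable.mat_over n n P \<Longrightarrow> intertwined n P P"
  unfolding intertwined_def
  using approximable.mat_over_carrier[of n n P]
  by (intro exI[of _ "\<lambda>x. 1\<^sub>m n"] conjI exI[of _ 1] ballI approximable.mat_over_const)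
     (simp_all add: left_mult_one_mat[of _ n n] right_mult_one_mat[of _ n n])

lemma intertwined_trans:
  assumes P: "approximable.mat_over n n P" and Q: "approximable.mat_over n n Q"
    and R: "approximable.mat_over n n R"
    and PQ: "intertwined n P Q" and QR: "intertwined n Q R"
  shows "intertwined n P R"
proof -
  from PQ obtain G \<delta> where G: "approximable.mat_over n n G" and \<delta>: "\<delta> > 0"
    "\<forall>x\<in>X. \<delta> \<le> cmod (det (G x)) \<and> P x * G x = G x * Q x"
    unfolding intertwined_def by blast
  from QR obtain H \<gamma> where H: "approximable.mat_over n n H" and \<gamma>: "\<gamma> > 0"
    "\<forall>x\<in>X. \<gamma> \<le> cmod (det (H x)) \<and> Q x * H x = H x * R x"
    unfolding intertwined_def by blast
  note c = P[THEN approximable.mat_over_carrier] Q[THEN approximable.mat_over_carrier]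
    R[THEN approximable.mat_over_carrier] G[THEN approximable.mat_over_carrier] H[THEN approximable.mat_over_carrier]
  show ?thesis
    unfolding intertwined_def
  proof (rule exI[of _ "\<lambda>x. G x * H x"], intro conjI exI[of _ "\<delta> * \<gamma>"] ballI)
    show "approximable.mat_over n n (\<lambda>x. G x * H x)" by (rule approximable.mat_over_mult[OF G H])
    show "0 < \<delta> * \<gamma>" using \<delta>(1) \<gamma>(1) by simp
    fix x assume x: "x \<in> X"
    show "\<delta> * \<gamma> \<le> cmod (det (G x * H x))"
      unfolding det_mult[OF c(4,5)] norm_mult using \<delta> \<gamma> x by (intro mult_mono) simp_all
    have PG: "P x * G x = G x * Q x" and QH: "Q x * H x = H x * R x" using \<delta>(2) \<gamma>(2) x by simp_all
    have "P x * (G x * H x) = (P x * G x) * H x"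
      by (rule assoc_mult_mat[OF c(1) c(4) c(5), symmetric])
    also have "\<dots> = G x * (Q x * H x)"
      unfolding PG by (rule assoc_mult_mat[OF c(4) c(2) c(5)])
    also have "\<dots> = (G x * H x) * R x"
      unfolding QH by (rule assoc_mult_mat[OF c(4) c(5) c(3), symmetric])
    finally show "P x * (G x * H x) = G x * H x * R x" .
  qed
qed

text \<open>The intertwiner built from two close idempotents is near the identity, whose determinant
  is 1, so its own determinant stays above \<open>1 / 2\<close> in modulus. The radius
  \<open>d\<close> depends only on \<open>n\<close> and \<open>K\<close>; hence one step size serves
  for a whole chain of idempotents with a common bound.\<close>

lemma close_idempotents_intertwined:
  assumes "K \<ge> 0"
  obtains d where "d > 0" and "\<And>P Q. approximable.mat_over n n P \<Longrightarrow> approximable.mat_over n n Q \<Longrightarrow>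
    \<forall>x\<in>X. P x * P x = P x \<and> Q x * Q x = Q x \<and> entries_le (P x) K \<and> entries_le (Q x - P x) d \<Longrightarrow>
    intertwined n P Q"
proof -
  obtain d0 where d0: "d0 > 0" and close: "\<And>M N. M \<in> carrier_mat n n \<Longrightarrow> N \<in> carrier_mat n n \<Longrightarrow>
      entries_le M 1 \<Longrightarrow> entries_le (M - N) d0 \<Longrightarrow> cmod (det M - det N) < 1 / 2"
    using det_uniformly_continuous[of "1 / 2" n 1] by auto
  \<comment> \<open>The factor by which the intertwiner estimate enlarges the distance of the
    idempotents; the added 1 keeps it positive for \<open>n = 0\<close>.\<close>
  define q where "q = 2 * real n * (K + 1) + 1"
  have q: "q > 0" using assms by (simp add: q_def add_nonneg_pos)
  define d where "d = d0 / q"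
  have d: "d > 0" using d0 q by (simp add: d_def)
  have "2 * real n * (K + 1) * d \<le> q * d" using d by (simp add: q_def)
  also have "\<dots> = d0" using q by (simp add: d_def)
  finally have dd0: "2 * real n * (K + 1) * d \<le> d0" .
  show thesis
  proof (rule that[OF d])
    fix P Q assume P: "approximable.mat_over n n P" and Q: "approximable.mat_over n n Q"
      and *: "\<forall>x\<in>X. P x * P x = P x \<and> Q x * Q x = Q x \<and> entries_le (P x) K \<and> entries_le (Q x - P x) d"
    note c = P[THEN approximable.mat_over_carrier] Q[THEN approximable.mat_over_carrier]
    define T where "T = (\<lambda>x. P x * Q x + (1\<^sub>m n - P x) * (1\<^sub>m n - Q x))"
    show "intertwined n P Q"
      unfolding intertwined_def
    proof (rule exI[of _ T], intro conjI exI[of _ "1 / 2"] ballI)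
      show "approximable.mat_over n n T"
        unfolding T_def
        by (intro approximable.mat_over_add approximable.mat_over_mult[of n n] approximable.mat_over_minus
          approximable.mat_over_const P Q one_carrier_mat)
      fix x assume x: "x \<in> X"
      have T: "T x \<in> carrier_mat n n" "P x * T x = T x * Q x"
        "entries_le (1\<^sub>m n - T x) (2 * real n * (K + 1) * d)"
        unfolding T_def using idempotent_intertwiner[of "P x" n "Q x"] c bspec[OF * x] assms d by auto
      show "P x * T x = T x * Q x" by (rule T(2))
      have "entries_le (1\<^sub>m n) 1" by (auto simp: entries_le_def)
      then have "cmod (det (1\<^sub>m n :: complex mat) - det (T x)) < 1 / 2"
        using close[OF one_carrier_mat T(1)] T(3) dd0 entries_le_mono by blast
      then show "1 / 2 \<le> cmod (det (T x))"
        using norm_triangle_ineq4[of "1 - det (T x)" 1] norm_triangle_ineq[of "1 - det (T x)" "det (T x)"]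
        by simp
    qed simp
  qed
qed

end

section \<open>Splitting idempotents\<close>

text \<open>If \<open>k > n\<close>, padding with zeros to size \<open>k\<close> gives square
  matrices with \<open>V U = 1\<close>, hence \<open>U V = 1\<close>; but row \<open>n\<close> of
  the padded \<open>U\<close> is zero.\<close>

lemma left_inverse_dim_le:
  fixes u v :: "complex mat"
  assumes u: "u \<in> carrier_mat n k" and v: "v \<in> carrier_mat k n" and vu: "v * u = 1\<^sub>m k"
  shows "k \<le> n"
proof (rule ccontr)
  assume "\<not> k \<le> n"
  then have k: "n < k" by simp
  define U where "U = mat k k (\<lambda>(a, l). if a < n then u $$ (a, l) else 0)"
  define V where "V = mat k k (\<lambda>(l, b). if b < n then v $$ (l, b) else 0)"
  have UV: "U \<in> carrier_mat k k" "V \<in> carrier_mat k k" by (auto simp: U_def V_def)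
  have "V * U = 1\<^sub>m k"
  proof (rule eq_matI)
    fix i j assume ij: "i < dim_row (1\<^sub>m k :: complex mat)" "j < dim_col (1\<^sub>m k :: complex mat)"
    then have ij: "i < k" "j < k" by auto
    have "(V * U) $$ (i, j) = (\<Sum>b = 0..<k. V $$ (i, b) * U $$ (b, j))"
      by (rule index_mult_mat_sum[OF UV(2,1) ij])
    also have "\<dots> = (\<Sum>b = 0..<n. v $$ (i, b) * u $$ (b, j))"
      using k ij by (intro sum.mono_neutral_cong_right) (auto simp: U_def V_def)
    also have "\<dots> = 1\<^sub>m k $$ (i, j)"
      unfolding vu[symmetric] by (rule index_mult_mat_sum[OF v u ij, symmetric])
    finally show "(V * U) $$ (i, j) = 1\<^sub>m k $$ (i, j)" .
  qed (use UV in auto)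
  then have "U * V = 1\<^sub>m k" by (rule mat_mult_left_right_inverse[OF UV(2,1)])
  then have "(U * V) $$ (n, n) = 1" using k by simp
  moreover have "(U * V) $$ (n, n) = (\<Sum>b = 0..<k. U $$ (n, b) * V $$ (b, n))"
    by (rule index_mult_mat_sum[OF UV k k])
  moreover have "\<dots> = 0" using k by (intro sum.neutral) (auto simp: U_def)
  ultimately show False by simp
qed

text \<open>If \<open>E \<noteq> u v\<close>, a nonzero entry of the idempotent \<open>E - u v\<close> provides one more column for \<open>u\<close>
  and one more row for \<open>v\<close>; so a maximal partial splitting is a splitting.\<close>

lemma extend_partial_splitting:
  fixes E u v :: "complex mat"
  assumes E: "E \<in> carrier_mat n n" "E * E = E"
    and u: "u \<in> carrier_mat n k" "E * u = u" and v: "v \<in> carrier_mat k n" "v * E = v"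
    and vu: "v * u = 1\<^sub>m k" and neq: "E \<noteq> u * v"
  obtains u' v' where "u' \<in> carrier_mat n (Suc k)" "E * u' = u'" "v' \<in> carrier_mat (Suc k) n"
    "v' * E = v'" "v' * u' = 1\<^sub>m (Suc k)"
proof -
  define F where "F = E - u * v"
  have uv: "u * v \<in> carrier_mat n n" using u v by simp
  have F: "F \<in> carrier_mat n n" unfolding F_def by (rule minus_carrier_mat[OF uv])
  have Euv: "E * (u * v) = u * v" using assoc_mult_mat[OF E(1) u(1) v(1)] u(2) by simp
  have uvE: "(u * v) * E = u * v" using assoc_mult_mat[OF u(1) v(1) E(1)] v(2) by simp
  have EF: "E * F = F"
    unfolding F_def using mult_minus_distrib_mat[OF E(1) E(1) uv] E(2) Euv by simp
  have FE: "F * E = F"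
    unfolding F_def using minus_mult_distrib_mat[OF E(1) uv E(1)] E(2) uvE by simp
  have vF: "v * F = 0\<^sub>m k n"
  proof -
    have "v * (u * v) = v" using assoc_mult_mat[OF v(1) u(1) v(1)] vu v(1) by simp
    then show ?thesis
      unfolding F_def using mult_minus_distrib_mat[OF v(1) E(1) uv] v by simp
  qed
  have Fu: "F * u = 0\<^sub>m n k"
  proof -
    have "(u * v) * u = u" using assoc_mult_mat[OF u(1) v(1) u(1)] vu u(1) by simp
    then show ?thesis
      unfolding F_def using minus_mult_distrib_mat[OF E(1) uv u(1)] u by simp
  qed
  have FF: "F * F = F"
  proof -
    have "F * (u * v) = 0\<^sub>m n n" using assoc_mult_mat[OF F u(1) v(1)] Fu v(1) by simp
    then have "F * (E - u * v) = F" using mult_minus_distrib_mat[OF F E(1) uv] FE F by auto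
    then show ?thesis by (simp add: F_def)
  qed
  have "\<exists>i<n. \<exists>j<n. F $$ (i, j) \<noteq> 0"
  proof (rule ccontr)
    assume *: "\<not> ?thesis"
    have "E = u * v"
    proof (rule eq_matI)
      fix i j assume "i < dim_row (u * v)" "j < dim_col (u * v)"
      then have ij: "i < n" "j < n" using u v by auto
      then have "F $$ (i, j) = 0" using * by blast
      then show "E $$ (i, j) = (u * v) $$ (i, j)"
        using index_minus_mat(1)[of i "u * v" j E] ij carrier_matD[OF uv] unfolding F_def by simp
    qed (use E uv in auto)
    with neq show False by simp
  qed
  then obtain i j where ij: "i < n" "j < n" and nz: "F $$ (i, j) \<noteq> 0" by blast
  \<comment> \<open>The new column is column \<open>j\<close> of \<open>F\<close>, the new row is
    row \<open>i\<close> divided by the pivot. Their product is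
    \<open>(F F) (i, j) / F (i, j) = 1\<close> by idempotency, and the mixed products vanish because
    \<open>v F = 0\<close> and \<open>F u = 0\<close>.\<close>
  define u' where "u' = mat n (Suc k) (\<lambda>(a, l). if l < k then u $$ (a, l) else F $$ (a, j))"
  define v' where "v' = mat (Suc k) n (\<lambda>(l, b). if l < k then v $$ (l, b) else F $$ (i, b) / F $$ (i, j))"
  have u': "u' \<in> carrier_mat n (Suc k)" and v': "v' \<in> carrier_mat (Suc k) n"
    by (auto simp: u'_def v'_def)
  show thesis
  proof (rule that[OF u' _ v'])
    show "E * u' = u'"
    proof (rule eq_matI)
      fix a l assume "a < dim_row u'" "l < dim_col u'"
      then have al: "a < n" "l < Suc k" using u' by auto
      have "(E * u') $$ (a, l) = (\<Sum>b = 0..<n. E $$ (a, b) * u' $$ (b, l))"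
        by (rule index_mult_mat_sum[OF E(1) u' al])
      also have "\<dots> = u' $$ (a, l)"
      proof (cases "l < k")
        case True
        then have "(\<Sum>b = 0..<n. E $$ (a, b) * u' $$ (b, l)) = (E * u) $$ (a, l)"
          unfolding index_mult_mat_sum[OF E(1) u(1) al(1) True]
          by (intro sum.cong) (auto simp: u'_def)
        then show ?thesis using u(2) al True by (simp add: u'_def)
      next
        case False
        then have "(\<Sum>b = 0..<n. E $$ (a, b) * u' $$ (b, l)) = (E * F) $$ (a, j)"
          unfolding index_mult_mat_sum[OF E(1) F al(1) ij(2)] using al
          by (intro sum.cong) (auto simp: u'_def)
        then show ?thesis using EF al False by (simp add: u'_def)
      qed
      finally show "(E * u') $$ (a, l) = u' $$ (a, l)" .
    qed (use E u' in auto)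
    show "v' * E = v'"
    proof (rule eq_matI)
      fix l b assume "l < dim_row v'" "b < dim_col v'"
      then have lb: "l < Suc k" "b < n" using v' by auto
      have "(v' * E) $$ (l, b) = (\<Sum>a = 0..<n. v' $$ (l, a) * E $$ (a, b))"
        by (rule index_mult_mat_sum[OF v' E(1) lb])
      also have "\<dots> = v' $$ (l, b)"
      proof (cases "l < k")
        case True
        then have "(\<Sum>a = 0..<n. v' $$ (l, a) * E $$ (a, b)) = (v * E) $$ (l, b)"
          unfolding index_mult_mat_sum[OF v(1) E(1) True lb(2)]
          by (intro sum.cong) (auto simp: v'_def)
        then show ?thesis using v(2) lb True by (simp add: v'_def)
      next
        case False
        then have "(\<Sum>a = 0..<n. v' $$ (l, a) * E $$ (a, b)) = (F * E) $$ (i, b) / F $$ (i, j)"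
          unfolding index_mult_mat_sum[OF F E(1) ij(1) lb(2)] sum_divide_distrib using lb
          by (intro sum.cong) (auto simp: v'_def)
        then show ?thesis using FE lb False by (simp add: v'_def)
      qed
      finally show "(v' * E) $$ (l, b) = v' $$ (l, b)" .
    qed (use E v' in auto)
    show "v' * u' = 1\<^sub>m (Suc k)"
    proof (rule eq_matI)
      fix l m assume "l < dim_row (1\<^sub>m (Suc k) :: complex mat)" "m < dim_col (1\<^sub>m (Suc k) :: complex mat)"
      then have lm: "l < Suc k" "m < Suc k" by auto
      have eq: "(v' * u') $$ (l, m) = (\<Sum>a = 0..<n. v' $$ (l, a) * u' $$ (a, m))"
        by (rule index_mult_mat_sum[OF v' u' lm])
      consider "l < k" "m < k" | "l < k" "m = k" | "l = k" "m < k" | "l = k" "m = k"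
        using lm by linarith
      then show "(v' * u') $$ (l, m) = 1\<^sub>m (Suc k) $$ (l, m)"
      proof cases
        case 1
        have "(v' * u') $$ (l, m) = (v * u) $$ (l, m)"
          unfolding eq index_mult_mat_sum[OF v(1) u(1) 1]
          using 1 by (intro sum.cong) (auto simp: u'_def v'_def)
        then show ?thesis using vu 1 by simp
      next
        case 2
        have "(v' * u') $$ (l, m) = (v * F) $$ (l, j)"
          unfolding eq index_mult_mat_sum[OF v(1) F 2(1) ij(2)]
          using 2 by (intro sum.cong) (auto simp: u'_def v'_def)
        then show ?thesis using vF 2 ij by simp
      next
        case 3
        have "(v' * u') $$ (l, m) = (F * u) $$ (i, m) / F $$ (i, j)"
          unfolding eq index_mult_mat_sum[OF F u(1) ij(1) 3(2)] sum_divide_distrib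
          using 3 by (intro sum.cong) (auto simp: u'_def v'_def)
        then show ?thesis using Fu 3 ij by simp
      next
        case 4
        have "(v' * u') $$ (l, m) = (F * F) $$ (i, j) / F $$ (i, j)"
          unfolding eq index_mult_mat_sum[OF F F ij] sum_divide_distrib
          using 4 by (intro sum.cong) (auto simp: u'_def v'_def)
        then show ?thesis using FF 4 nz by simp
      qed
    qed (use u' v' in auto)
  qed
qed

lemma idempotent_mat_splits:
  fixes E :: "complex mat"
  assumes E: "E \<in> carrier_mat n n" "E * E = E"
  obtains k u v where "u \<in> carrier_mat n k" "v \<in> carrier_mat k n" "u * v = E" "v * u = 1\<^sub>m k"
proof -
  define S where "S = {k. \<exists>u v. u \<in> carrier_mat n k \<and> E * u = u \<and> v \<in> carrier_mat k n \<and> v * E = v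
    \<and> v * u = 1\<^sub>m k}"
  have "S \<subseteq> {..n}" using left_inverse_dim_le by (auto simp: S_def)
  then have fin: "finite S" by (rule finite_subset) simp
  \<comment> \<open>Matrices with no columns and no rows form the partial splitting of size
    0.\<close>
  have "0 \<in> S"
    unfolding S_def mem_Collect_eq
    using E by (intro exI[of _ "0\<^sub>m n 0"] exI[of _ "0\<^sub>m 0 n"]) auto
  define k where "k = Max S"
  have "k \<in> S" unfolding k_def using fin \<open>0 \<in> S\<close> by (intro Max_in) auto
  then obtain u v where u: "u \<in> carrier_mat n k" "E * u = u"
    and v: "v \<in> carrier_mat k n" "v * E = v" and vu: "v * u = 1\<^sub>m k"
    unfolding S_def mem_Collect_eq by blast
  have "E = u * v"
  proof (rule ccontr)
    assume "E \<noteq> u * v"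
    then obtain u' v' where "u' \<in> carrier_mat n (Suc k)" "E * u' = u'" "v' \<in> carrier_mat (Suc k) n"
      "v' * E = v'" "v' * u' = 1\<^sub>m (Suc k)"
      by (rule extend_partial_splitting[OF E u v vu])
    then have "Suc k \<in> S" unfolding S_def by blast
    then show False using Max_ge[OF fin] unfolding k_def by fastforce
  qed
  then show thesis using that[OF u(1) v(1) _ vu] by simp
qed

text \<open>Relative to the decompositions of the space given by \<open>E\<close> and by
  \<open>P\<close>, the matrix \<open>T\<close> keeps the two diagonal blocks of \<open>H\<close>
  and discards the others. It thus maps the range of \<open>E\<close> into that of \<open>P\<close>
  and the kernel of \<open>E\<close> into that of \<open>P\<close>, whatever \<open>H\<close>
  is.\<close>

lemma corner_mat_intertwines:
  fixes P E H :: "complex mat"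
  assumes P: "P \<in> carrier_mat n n" "P * P = P" and E: "E \<in> carrier_mat n n" "E * E = E"
    and H: "H \<in> carrier_mat n n"
  defines "T \<equiv> P * (H * E) + (1\<^sub>m n - P) * (H * (1\<^sub>m n - E))"
  shows "P * T = T * E"
proof -
  define Pc where "Pc = 1\<^sub>m n - P"
  define Ec where "Ec = 1\<^sub>m n - E"
  define Y where "Y = H * E"
  define Z where "Z = H * Ec"
  note p = idempotent_complement[OF P, folded Pc_def] and e = idempotent_complement[OF E, folded Ec_def]
  have Y: "Y \<in> carrier_mat n n" unfolding Y_def by (rule mult_carrier_mat[OF H E(1)])
  have Z: "Z \<in> carrier_mat n n" unfolding Z_def by (rule mult_carrier_mat[OF H e(1)])
  have PY: "P * Y \<in> carrier_mat n n" by (rule mult_carrier_mat[OF P(1) Y])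
  have PZ: "Pc * Z \<in> carrier_mat n n" by (rule mult_carrier_mat[OF p(1) Z])
  have YE: "Y * E = Y" unfolding Y_def assoc_mult_mat[OF H E(1) E(1)] E(2) ..
  have ZE: "Z * E = 0\<^sub>m n n" unfolding Z_def assoc_mult_mat[OF H e(1) E(1)] e(4) by (rule right_mult_zero_mat[OF H])
  have T: "T = P * Y + Pc * Z" by (simp only: T_def Pc_def Ec_def Y_def Z_def)
  have "P * T = P * (P * Y) + P * (Pc * Z)"
    unfolding T by (rule mult_add_distrib_mat[OF P(1) PY PZ])
  also have "P * (P * Y) = P * Y"
    unfolding assoc_mult_mat[OF P(1) P(1) Y, symmetric] P(2) ..
  also have "P * (Pc * Z) = 0\<^sub>m n n"
    unfolding assoc_mult_mat[OF P(1) p(1) Z, symmetric] p(3) by (rule left_mult_zero_mat[OF Z])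
  finally have 1: "P * T = P * Y + 0\<^sub>m n n" .
  have "T * E = (P * Y) * E + (Pc * Z) * E"
    unfolding T by (rule add_mult_distrib_mat[OF PY PZ E(1)])
  also have "(P * Y) * E = P * Y"
    unfolding assoc_mult_mat[OF P(1) Y E(1)] YE ..
  also have "(Pc * Z) * E = 0\<^sub>m n n"
    unfolding assoc_mult_mat[OF p(1) Z E(1)] ZE by (rule right_mult_zero_mat[OF p(1)])
  finally show ?thesis unfolding 1 ..
qed

text \<open>The passage from \<open>H\<close> to \<open>T\<close> is linear and fixes
  \<open>G\<close>, because \<open>G\<close> already intertwines \<open>P\<close> and
  \<open>E\<close>. So \<open>G - T\<close> arises from \<open>G - H\<close> by the same formula,
  and the constant involves only bounds on the idempotents and their complements.\<close>

lemma corner_mat_close: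
  fixes P E G H :: "complex mat"
  assumes P: "P \<in> carrier_mat n n" and E: "E \<in> carrier_mat n n" "E * E = E"
    and G: "G \<in> carrier_mat n n" "P * G = G * E" and H: "H \<in> carrier_mat n n"
    and KP: "entries_le P KP" "KP \<ge> 0" and KQ: "entries_le (1\<^sub>m n - P) KQ" "KQ \<ge> 0"
    and KE: "entries_le E KE" and KF: "entries_le (1\<^sub>m n - E) KF"
    and \<epsilon>: "entries_le (G - H) \<epsilon>" "\<epsilon> \<ge> 0"
  shows "entries_le (G - (P * (H * E) + (1\<^sub>m n - P) * (H * (1\<^sub>m n - E))))
    ((real n * (KP * (real n * KE)) + real n * (KQ * (real n * KF))) * \<epsilon>)"
proof -
  define Pc where "Pc = 1\<^sub>m n - P"
  define Ec where "Ec = 1\<^sub>m n - E"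
  note e = idempotent_complement[OF E, folded Ec_def]
  have p: "Pc \<in> carrier_mat n n" unfolding Pc_def by (rule minus_carrier_mat[OF P])
  have gh: "G - H \<in> carrier_mat n n" by (rule minus_carrier_mat[OF H])
  have m: "M * N \<in> carrier_mat n n" if "M \<in> carrier_mat n n" "N \<in> carrier_mat n n" for M N :: "complex mat"
    using that by (rule mult_carrier_mat)
  have "Pc * G = G - G * E"
    unfolding Pc_def minus_mult_distrib_mat[OF one_carrier_mat P G(1)] G(2) left_mult_one_mat[OF G(1)] ..
  also have "\<dots> = G * Ec"
    unfolding Ec_def mult_minus_distrib_mat[OF G(1) one_carrier_mat E(1)] right_mult_one_mat[OF G(1)] ..
  finally have PcG: "Pc * G = G * Ec" .
  have "P * (G * E) = G * E"
    unfolding assoc_mult_mat[OF P G(1) E(1), symmetric] G(2) assoc_mult_mat[OF G(1) E(1) E(1)] E(2) ..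
  moreover have "Pc * (G * Ec) = G * Ec"
    unfolding assoc_mult_mat[OF p G(1) e(1), symmetric] PcG assoc_mult_mat[OF G(1) e(1) e(1)] e(5) ..
  moreover have "G * E + G * Ec = G"
    unfolding mult_add_distrib_mat[OF G(1) E(1) e(1), symmetric] e(2) by (rule right_mult_one_mat[OF G(1)])
  ultimately have G_eq: "P * (G * E) + Pc * (G * Ec) = G" by simp
  have lin: "M * ((G - H) * N) = M * (G * N) - M * (H * N)"
    if "M \<in> carrier_mat n n" "N \<in> carrier_mat n n" for M N
    unfolding minus_mult_distrib_mat[OF G(1) H that(2)]
    by (rule mult_minus_distrib_mat[OF that(1) m[OF G(1) that(2)] m[OF H that(2)]])
  have diff: "(A + B) - (C + D) = (A - C) + (B - D)"
    if "A \<in> carrier_mat n n" "B \<in> carrier_mat n n" "C \<in> carrier_mat n n" "D \<in> carrier_mat n n"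
    for A B C D :: "complex mat"
    using that by (intro eq_matI) auto
  have "G - (P * (H * E) + Pc * (H * Ec))
      = (P * (G * E) + Pc * (G * Ec)) - (P * (H * E) + Pc * (H * Ec))" unfolding G_eq ..
  also have "\<dots> = (P * (G * E) - P * (H * E)) + (Pc * (G * Ec) - Pc * (H * Ec))"
    by (intro diff m P p G H E e(1))
  also have "\<dots> = P * ((G - H) * E) + Pc * ((G - H) * Ec)"
    unfolding lin[OF P E(1)] lin[OF p e(1)] ..
  finally have eq: "G - (P * (H * E) + Pc * (H * Ec)) = P * ((G - H) * E) + Pc * ((G - H) * Ec)" .
  have "entries_le (P * ((G - H) * E)) (real n * (KP * (real n * (\<epsilon> * KE))))"
    by (intro entries_le_mult[OF P KP(1) m[OF gh E(1)]] entries_le_mult[OF gh \<epsilon>(1) E(1) KE] KP \<epsilon>)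
  moreover have "entries_le (Pc * ((G - H) * Ec)) (real n * (KQ * (real n * (\<epsilon> * KF))))"
    unfolding Pc_def Ec_def
    by (intro entries_le_mult[OF p[unfolded Pc_def] KQ(1) m[OF gh e(1)[unfolded Ec_def]]]
      entries_le_mult[OF gh \<epsilon>(1) e(1)[unfolded Ec_def] KF] KQ \<epsilon>)
  ultimately have "entries_le (P * ((G - H) * E) + Pc * ((G - H) * Ec))
      (real n * (KP * (real n * (\<epsilon> * KE))) + real n * (KQ * (real n * (\<epsilon> * KF))))"
    by (intro entries_le_add[OF m[OF P m[OF gh E(1)]] _ m[OF p m[OF gh e(1)]]])
  then show ?thesis
    unfolding Pc_def[symmetric] Ec_def[symmetric] eq by (rule entries_le_mono) (simp add: algebra_simps)
qed


section \<open>From the uniform closure back to the algebra\<close>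

context wiener_function_algebra
begin

text \<open>Cramer's rule: the adjugate is polynomial in the entries, and only the reciprocal of the
  determinant calls on the Wiener property.\<close>

lemma invertible_mat_over:
  assumes T: "mem.mat_over n n T" and "\<delta> > 0" and \<delta>: "\<And>x. x \<in> X \<Longrightarrow> \<delta> \<le> cmod (det (T x))"
  obtains W where "mem.mat_over n n W"
    "\<And>x. x \<in> X \<Longrightarrow> T x * W x = 1\<^sub>m n" "\<And>x. x \<in> X \<Longrightarrow> W x * T x = 1\<^sub>m n"
proof -
  note Tc = mem.mat_over_carrier[OF T]
  define W where "W = (\<lambda>x. (1 / det (T x)) \<cdot>\<^sub>m adj_mat (T x))"
  have "restrict (\<lambda>x. det (T x)) X \<in> A" using mem.det_mem[OF T] by (simp add: mem_def)
  from wiener[OF this \<open>\<delta> > 0\<close>] \<delta> have "(\<lambda>x\<in>X. 1 / restrict (\<lambda>x. det (T x)) X x) \<in> A" by simp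
  then have "mem (\<lambda>x. 1 / det (T x))" by (simp add: mem_def restrict_def cong: if_cong)
  then have "mem.mat_over n n W"
    unfolding W_def by (intro mem.mat_over_smult mem.adj_mat_mem T)
  moreover have "T x * W x = 1\<^sub>m n" "W x * T x = 1\<^sub>m n" if "x \<in> X" for x
  proof -
    have nz: "det (T x) \<noteq> 0" using \<delta>[OF that] \<open>\<delta> > 0\<close> by auto
    show "T x * W x = 1\<^sub>m n"
      unfolding W_def mult_smult_distrib[OF Tc adj_mat(1)[OF Tc]] adj_mat(2)[OF Tc] using nz by auto
    show "W x * T x = 1\<^sub>m n"
      unfolding W_def mult_smult_assoc_mat[OF adj_mat(1)[OF Tc] Tc] adj_mat(3)[OF Tc] using nz by auto
  qed
  ultimately show thesis using that by blast
qed

theorem idempotent_splits: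
  assumes P: "mem.mat_over n n P" and idem: "\<And>x. x \<in> X \<Longrightarrow> P x * P x = P x"
    and E: "E \<in> carrier_mat n n" "E * E = E" and PE: "intertwined n P (\<lambda>x. E)"
  obtains k u v where "mem.mat_over n k u" "mem.mat_over k n v"
    "\<And>x. x \<in> X \<Longrightarrow> u x * v x = P x" "\<And>x. x \<in> X \<Longrightarrow> v x * u x = 1\<^sub>m k"
proof -
  from PE obtain G \<delta> where G: "approximable.mat_over n n G" and \<delta>: "\<delta> > 0"
    "\<forall>x\<in>X. \<delta> \<le> cmod (det (G x)) \<and> P x * G x = G x * E"
    unfolding intertwined_def by blast
  define Pc where "Pc = (\<lambda>x. 1\<^sub>m n - P x)"
  define Ec where "Ec = 1\<^sub>m n - E"
  have Pcm: "mem.mat_over n n Pc"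
    unfolding Pc_def by (intro mem.mat_over_minus mem.mat_over_const P one_carrier_mat)
  note c = mem.mat_over_carrier[OF P] mem.mat_over_carrier[OF Pcm] approximable.mat_over_carrier[OF G]
  note e = idempotent_complement[OF E, folded Ec_def]
  \<comment> \<open>Bounds on matrix functions are stated at points of \<open>X\<close>; a single
    point extracts bounds for the constant matrices \<open>E\<close> and \<open>Ec\<close>.\<close>
  obtain x0 where x0: "x0 \<in> X" using nonempty by blast
  have \<delta>2: "\<delta> / 2 > 0" using \<delta>(1) by simp
  obtain K where K: "\<And>x. x \<in> X \<Longrightarrow> entries_le (G x) K" using mat_over_bounded[OF G] by blast
  obtain KP where KP: "KP \<ge> 0" "\<And>x. x \<in> X \<Longrightarrow> entries_le (P x) KP"
    using mat_over_bounded[OF mat_over_approximable[OF P]] by blast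
  obtain KQ where KQ: "KQ \<ge> 0" "\<And>x. x \<in> X \<Longrightarrow> entries_le (Pc x) KQ"
    using mat_over_bounded[OF mat_over_approximable[OF Pcm]] by blast
  obtain KE where KE: "KE \<ge> 0" "entries_le E KE"
    using mat_over_bounded[OF approximable.mat_over_const[OF E(1)]] x0 by metis
  obtain KF where KF: "KF \<ge> 0" "entries_le Ec KF"
    using mat_over_bounded[OF approximable.mat_over_const[OF e(1)]] x0 by metis
  obtain d where d: "d > 0" and close: "\<And>M N. M \<in> carrier_mat n n \<Longrightarrow> N \<in> carrier_mat n n \<Longrightarrow>
      entries_le M K \<Longrightarrow> entries_le (M - N) d \<Longrightarrow> cmod (det M - det N) < \<delta> / 2"
    by (rule det_uniformly_continuous[OF \<delta>2, of n K]) (rule that)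
  \<comment> \<open>The enlargement factor of \<open>corner_mat_close\<close>, increased by 1 to be
    positive: an approximation of \<open>G\<close> within \<open>\<epsilon> = d / L\<close> yields a
    \<open>T\<close> within \<open>d\<close> of \<open>G\<close>.\<close>
  define L where "L = (real n * (KP * (real n * KE)) + real n * (KQ * (real n * KF))) + 1"
  have L: "L > 0" unfolding L_def using KP KQ KE KF by (intro add_nonneg_pos add_nonneg_nonneg mult_nonneg_nonneg) auto
  define \<epsilon> where "\<epsilon> = d / L"
  have \<epsilon>: "\<epsilon> > 0" using d L by (simp add: \<epsilon>_def)
  have \<epsilon>L: "\<epsilon> * L = d" using L by (simp add: \<epsilon>_def)
  obtain H where H: "mem.mat_over n n H" "\<And>x. x \<in> X \<Longrightarrow> entries_le (G x - H x) \<epsilon>"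
    using mat_over_approximate[OF G \<epsilon>] by blast
  note h = mem.mat_over_carrier[OF H(1)]
  define T where "T = (\<lambda>x. P x * (H x * E) + (1\<^sub>m n - P x) * (H x * (1\<^sub>m n - E)))"
  have Tm: "mem.mat_over n n T"
    unfolding T_def
    by (intro mem.mat_over_add mem.mat_over_mult[of n n] mem.mat_over_minus mem.mat_over_const P H(1) E(1) one_carrier_mat)
  note t = mem.mat_over_carrier[OF Tm]
  have PT: "P x * T x = T x * E" if x: "x \<in> X" for x
    unfolding T_def by (rule corner_mat_intertwines[OF c(1) idem[OF x] E h])
  have GT: "entries_le (G x - T x) d" if x: "x \<in> X" for x
  proof -
    have "P x * G x = G x * E" using \<delta>(2) x by blast
    from corner_mat_close[OF c(1) E c(3) this h KP(2)[OF x] KP(1) KQ(2)[OF x, unfolded Pc_def] KQ(1)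
      KE(2) KF(2)[unfolded Ec_def] H(2)[OF x] less_imp_le[OF \<epsilon>]]
    show ?thesis
      unfolding T_def by (rule entries_le_mono) (use \<epsilon> in \<open>simp_all add: \<epsilon>L[symmetric] L_def algebra_simps\<close>)
  qed
  have det_T: "\<delta> / 2 \<le> cmod (det (T x))" if x: "x \<in> X" for x
    using close[OF c(3) t K[OF x] GT[OF x]] \<delta>(2) x
      norm_triangle_ineq[of "det (G x) - det (T x)" "det (T x)"]
    by (auto dest!: bspec[OF _ x])
  obtain W where W: "mem.mat_over n n W" "\<And>x. x \<in> X \<Longrightarrow> T x * W x = 1\<^sub>m n"
    "\<And>x. x \<in> X \<Longrightarrow> W x * T x = 1\<^sub>m n"
    using invertible_mat_over[OF Tm \<delta>2 det_T] by blast
  note w = mem.mat_over_carrier[OF W(1)]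
  obtain k u v where u: "u \<in> carrier_mat n k" and v: "v \<in> carrier_mat k n"
    and uv: "u * v = E" and vu: "v * u = 1\<^sub>m k"
    by (rule idempotent_mat_splits[OF E])
  show thesis
  proof (rule that)
    \<comment> \<open>The constant splitting \<open>E = u v\<close> is transported by conjugation
      with \<open>T\<close>: \<open>T u v W = T E W = P T W = P\<close>.\<close>
    show "mem.mat_over n k (\<lambda>x. T x * u)" by (intro mem.mat_over_mult[of n n] Tm mem.mat_over_const u)
    show "mem.mat_over k n (\<lambda>x. v * W x)" by (intro mem.mat_over_mult[of k n] W mem.mat_over_const v)
    fix x assume x: "x \<in> X"
    have "(T x * u) * (v * W x) = T x * (u * (v * W x))"
      by (rule assoc_mult_mat[OF t u mult_carrier_mat[OF v w]])
    also have "u * (v * W x) = E * W x"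
      using assoc_mult_mat[OF u v w] uv by simp
    also have "T x * (E * W x) = (T x * E) * W x"
      by (rule assoc_mult_mat[OF t E(1) w, symmetric])
    also have "\<dots> = P x * (T x * W x)"
      unfolding PT[OF x, symmetric] by (rule assoc_mult_mat[OF c(1) t w])
    also have "\<dots> = P x" using W(2)[OF x] c(1)[of x] by simp
    finally show "(T x * u) * (v * W x) = P x" .
    have "(v * W x) * (T x * u) = v * (W x * (T x * u))"
      by (rule assoc_mult_mat[OF v w mult_carrier_mat[OF t u]])
    also have "W x * (T x * u) = u"
      unfolding assoc_mult_mat[OF w t u, symmetric] W(3)[OF x] by (rule left_mult_one_mat[OF u])
    finally show "(v * W x) * (T x * u) = 1\<^sub>m k" using vu by simp
  qed
qed

end

section \<open>Smooth subalgebras of bounded Dirichlet series\<close>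

lemma open_Cplus: "open Cplus"
  unfolding Cplus_def by (rule open_halfspace_Re_gt)

lemma convex_Cplus: "convex Cplus"
  unfolding Cplus_def by (rule convex_halfspace_Re_gt)

lemma one_in_Cplus: "1 \<in> Cplus"
  by (simp add: Cplus_def)

text \<open>Derivatives depend only on the germ of a function and \<open>Cplus\<close> is open; this
  permits inserting or dropping \<open>restrict\<close> under \<open>deriv\<close>.\<close>

lemma deriv_cong_Cplus:
  assumes "s \<in> Cplus" "\<And>w. w \<in> Cplus \<Longrightarrow> f w = g w"
  shows "(deriv ^^ n) f s = (deriv ^^ n) g s"
  using assms open_Cplus by (intro higher_deriv_cong_ev eventually_nhds_in_open[THEN eventually_mono]) auto

lemma Hinf_holomorphic:
  assumes "f \<in> Hinf"
  shows "f holomorphic_on Cplus"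
proof -
  obtain a :: "nat \<Rightarrow> complex" where a: "\<And>s. s \<in> Cplus \<Longrightarrow> (\<lambda>n. a (Suc n) / of_nat (Suc n) powr s) sums f s"
    using assms unfolding Hinf_def by blast
  have "x / of_nat (Suc n) powr s = x * exp (- s * of_real (ln (real (Suc n))))" for x s :: complex and n
    by (simp add: powr_def divide_inverse exp_minus Ln_of_nat del: of_nat_Suc)
  with a show ?thesis
    by (intro Dirichlet_series_holomorphic[where lam = "\<lambda>n. ln (real (Suc n))"]) (auto simp: incseq_def)
qed

lemma Hinf_has_deriv: "f \<in> Hinf \<Longrightarrow> s \<in> Cplus \<Longrightarrow> (f has_field_derivative deriv f s) (at s)"
  by (rule holomorphic_derivI[OF Hinf_holomorphic open_Cplus])

lemma smooth_subalgebra_0: "smooth_subalgebra 0 B = B"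
  by (simp add: smooth_subalgebra_def)

text \<open>This recursion lets the closure properties be proved by induction on the order, with the
  first-order product and quotient rules in place of Leibniz formulas for higher
  derivatives.\<close>

lemma smooth_subalgebra_Suc:
  "f \<in> smooth_subalgebra (Suc m) B \<longleftrightarrow> f \<in> B \<and> restrict (deriv f) Cplus \<in> smooth_subalgebra m B"
proof -
  have eq: "restrict ((deriv ^^ l) (restrict (deriv f) Cplus)) Cplus = restrict ((deriv ^^ Suc l) f) Cplus" for l
    unfolding funpow_Suc_right o_apply
    by (intro restrict_ext deriv_cong_Cplus) auto
  have set_eq: "{1..Suc m} = insert 1 (Suc ` {1..m})"
    by (auto simp: image_Suc_atLeastAtMost)
  have ball: "(\<forall>l\<in>{1..Suc m}. Q l) \<longleftrightarrow> Q 1 \<and> (\<forall>l\<in>{1..m}. Q (Suc l))" for Q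
    unfolding set_eq by blast
  have d1: "(deriv ^^ 1) f = deriv f" by simp
  show ?thesis
    unfolding smooth_subalgebra_def mem_Collect_eq eq ball d1 by (rule refl)
qed

lemma smooth_subalgebra_mono: "f \<in> smooth_subalgebra (Suc m) B \<Longrightarrow> f \<in> smooth_subalgebra m B"
  by (simp add: smooth_subalgebra_def)

lemma smooth_subalgebra_subset: "f \<in> smooth_subalgebra m B \<Longrightarrow> f \<in> B"
  by (simp add: smooth_subalgebra_def)

section \<open>Closure properties of the smooth subalgebras\<close>

locale Dirichlet_algebra =
  fixes B :: "(complex \<Rightarrow> complex) set"
  assumes polynomials: "Dirichlet_polynomials \<subseteq> B" and subset_Hinf: "B \<subseteq> Hinf"
    and add_mem: "f \<in> B \<Longrightarrow> g \<in> B \<Longrightarrow> (\<lambda>s\<in>Cplus. f s + g s) \<in> B"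
    and mult_mem: "f \<in> B \<Longrightarrow> g \<in> B \<Longrightarrow> (\<lambda>s\<in>Cplus. f s * g s) \<in> B"
    and inverse_mem: "f \<in> B \<Longrightarrow> (INF s\<in>Cplus. cmod (f s)) > 0 \<Longrightarrow> (\<lambda>s\<in>Cplus. 1 / f s) \<in> B"
begin

lemma has_deriv: "f \<in> B \<Longrightarrow> s \<in> Cplus \<Longrightarrow> (f has_field_derivative deriv f s) (at s)"
  using subset_Hinf by (intro Hinf_has_deriv) auto

lemma restrict_deriv_eqI:
  assumes "\<And>s. s \<in> Cplus \<Longrightarrow> (f has_field_derivative f' s) (at s)"
  shows "restrict (deriv (restrict f Cplus)) Cplus = restrict f' Cplus"
proof (rule restrict_ext)
  fix s assume s: "s \<in> Cplus"
  have "deriv (restrict f Cplus) s = deriv f s"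
    using deriv_cong_Cplus[OF s, of "restrict f Cplus" f 1] by simp
  then show "deriv (restrict f Cplus) s = f' s" using DERIV_imp_deriv[OF assms[OF s]] by simp
qed

lemma smooth_restrict_SucI:
  assumes "restrict f Cplus \<in> B" "\<And>s. s \<in> Cplus \<Longrightarrow> (f has_field_derivative f' s) (at s)"
    and "restrict f' Cplus \<in> smooth_subalgebra m B"
  shows "restrict f Cplus \<in> smooth_subalgebra (Suc m) B"
proof -
  have eq: "restrict (deriv (restrict f Cplus)) Cplus = restrict f' Cplus"
    by (rule restrict_deriv_eqI) (rule assms(2))
  show ?thesis unfolding smooth_subalgebra_Suc eq using assms(1,3) by blast
qed

lemma polynomial_mem: "(\<lambda>s\<in>Cplus. \<Sum>n=1..N. a n / of_nat n powr s) \<in> B"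
  using polynomials unfolding Dirichlet_polynomials_def by blast

text \<open>Differentiation multiplies the coefficient of index \<open>n\<close> by
  \<open>- ln n\<close> and so maps Dirichlet polynomials to Dirichlet polynomials; the induction
  therefore varies the coefficients.\<close>

lemma smooth_polynomial:
  "(\<lambda>s\<in>Cplus. \<Sum>n=1..N. a n / of_nat n powr s) \<in> smooth_subalgebra m B"
proof (induction m arbitrary: a)
  case 0
  show ?case unfolding smooth_subalgebra_0 by (rule polynomial_mem)
next
  case (Suc m)
  show ?case
  proof (rule smooth_restrict_SucI)
    show "(\<lambda>s\<in>Cplus. \<Sum>n=1..N. a n / of_nat n powr s) \<in> B"
      by (rule polynomial_mem)
    show "(\<lambda>s\<in>Cplus. \<Sum>n=1..N. (- Ln (of_nat n) * a n) / of_nat n powr s) \<in> smooth_subalgebra m B"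
      by (rule Suc)
    fix s :: complex
    have "((\<lambda>s. a n / of_nat n powr s) has_field_derivative (- Ln (of_nat n) * a n) / of_nat n powr s) (at s)"
      if "n \<in> {1..N}" for n
    proof -
      have "((\<lambda>s. a n * exp (- s * Ln (of_nat n))) has_field_derivative
          a n * (exp (- s * Ln (of_nat n)) * - Ln (of_nat n))) (at s)"
        by (auto intro!: derivative_eq_intros)
      moreover have "a n / of_nat n powr s = a n * exp (- s * Ln (of_nat n))" for s
        using that by (simp add: powr_def exp_minus divide_inverse)
      ultimately show ?thesis using that by (simp add: powr_def exp_minus divide_inverse mult_ac)
    qed
    then show "((\<lambda>s. \<Sum>n=1..N. a n / of_nat n powr s) has_field_derivative
        (\<Sum>n=1..N. (- Ln (of_nat n) * a n) / of_nat n powr s)) (at s)"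
      by (rule DERIV_sum)
  qed
qed

lemma smooth_const: "(\<lambda>s\<in>Cplus. c) \<in> smooth_subalgebra m B"
  using smooth_polynomial[where N = 1 and a = "\<lambda>_. c" and m = m] by simp

lemma smooth_add:
  "f \<in> smooth_subalgebra m B \<Longrightarrow> g \<in> smooth_subalgebra m B \<Longrightarrow>
    (\<lambda>s\<in>Cplus. f s + g s) \<in> smooth_subalgebra m B"
proof (induction m arbitrary: f g)
  case 0
  then show ?case unfolding smooth_subalgebra_0 by (rule add_mem)
next
  case (Suc m)
  note fg = Suc.prems[unfolded smooth_subalgebra_Suc]
  show ?case
  proof (rule smooth_restrict_SucI)
    show "(\<lambda>s\<in>Cplus. f s + g s) \<in> B" using fg add_mem by blast
    have "(\<lambda>s\<in>Cplus. restrict (deriv f) Cplus s + restrict (deriv g) Cplus s) \<in> smooth_subalgebra m B"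
      using fg Suc.IH by blast
    then show "(\<lambda>s\<in>Cplus. deriv f s + deriv g s) \<in> smooth_subalgebra m B"
      by (simp add: restrict_def cong: if_cong)
    show "((\<lambda>s. f s + g s) has_field_derivative (deriv f s + deriv g s)) (at s)" if "s \<in> Cplus" for s
      using fg that by (intro DERIV_add has_deriv) auto
  qed
qed

lemma smooth_mult:
  "f \<in> smooth_subalgebra m B \<Longrightarrow> g \<in> smooth_subalgebra m B \<Longrightarrow>
    (\<lambda>s\<in>Cplus. f s * g s) \<in> smooth_subalgebra m B"
proof (induction m arbitrary: f g)
  case 0
  then show ?case unfolding smooth_subalgebra_0 by (rule mult_mem)
next
  case (Suc m)
  note fg = Suc.prems[unfolded smooth_subalgebra_Suc]
  \<comment> \<open>The product rule pairs a derivative of order \<open>m\<close> with an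
    undifferentiated factor, which must be known to have order \<open>m\<close> too.\<close>
  note fg' = Suc.prems[THEN smooth_subalgebra_mono]
  show ?case
  proof (rule smooth_restrict_SucI)
    show "(\<lambda>s\<in>Cplus. f s * g s) \<in> B" using fg mult_mem by blast
    have "(\<lambda>s\<in>Cplus. (\<lambda>s\<in>Cplus. restrict (deriv f) Cplus s * g s) s
        + (\<lambda>s\<in>Cplus. restrict (deriv g) Cplus s * f s) s) \<in> smooth_subalgebra m B"
      using fg fg' Suc.IH by (intro smooth_add) blast+
    then show "(\<lambda>s\<in>Cplus. deriv f s * g s + deriv g s * f s) \<in> smooth_subalgebra m B"
      by (simp add: restrict_def cong: if_cong)
    show "((\<lambda>s. f s * g s) has_field_derivative (deriv f s * g s + deriv g s * f s)) (at s)"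
      if "s \<in> Cplus" for s
      using fg that by (intro DERIV_mult has_deriv) auto
  qed
qed

text \<open>The derivative of \<open>1 / f\<close> is \<open>- f' / f\<^sup>2\<close>, a product of
  functions already known to have order \<open>m\<close>. The Wiener property enters only at order
  0, and the same lower bound on \<open>f\<close> serves at every order.\<close>

lemma smooth_inverse:
  assumes "\<delta> > 0"
  shows "f \<in> smooth_subalgebra m B \<Longrightarrow> \<forall>s\<in>Cplus. \<delta> \<le> cmod (f s) \<Longrightarrow>
    (\<lambda>s\<in>Cplus. 1 / f s) \<in> smooth_subalgebra m B"
proof (induction m arbitrary: f)
  case 0
  have "\<delta> \<le> (INF s\<in>Cplus. cmod (f s))"
    using 0 one_in_Cplus by (intro cINF_greatest) auto
  with assms have "(INF s\<in>Cplus. cmod (f s)) > 0" by linarith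
  with 0 show ?case unfolding smooth_subalgebra_0 by (intro inverse_mem)
next
  case (Suc m)
  note f = Suc.prems(1)[unfolded smooth_subalgebra_Suc]
  have inv: "(\<lambda>s\<in>Cplus. 1 / f s) \<in> smooth_subalgebra m B"
    by (rule Suc.IH[OF smooth_subalgebra_mono[OF Suc.prems(1)] Suc.prems(2)])
  show ?case
  proof (rule smooth_restrict_SucI)
    show "(\<lambda>s\<in>Cplus. 1 / f s) \<in> B" using inv by (rule smooth_subalgebra_subset)
    have "(\<lambda>s\<in>Cplus. (\<lambda>s\<in>Cplus. (\<lambda>s\<in>Cplus. - 1) s * restrict (deriv f) Cplus s) s
        * (\<lambda>s\<in>Cplus. (\<lambda>s\<in>Cplus. 1 / f s) s * (\<lambda>s\<in>Cplus. 1 / f s) s) s) \<in> smooth_subalgebra m B"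
      by (intro smooth_mult smooth_const inv conjunct2[OF f])
    then show "(\<lambda>s\<in>Cplus. - deriv f s * ((1 / f s) * (1 / f s))) \<in> smooth_subalgebra m B"
      by (simp add: restrict_def cong: if_cong)
    fix s assume s: "s \<in> Cplus"
    then have "f s \<noteq> 0" using bspec[OF Suc.prems(2) s] assms by auto
    moreover have "(f has_field_derivative deriv f s) (at s)" using f s has_deriv by blast
    ultimately show "((\<lambda>s. 1 / f s) has_field_derivative - deriv f s * ((1 / f s) * (1 / f s))) (at s)"
      by (auto intro!: derivative_eq_intros simp: field_simps)
  qed
qed

lemma bounded_on_Cplus: "f \<in> B \<Longrightarrow> \<exists>K. \<forall>s\<in>Cplus. cmod (f s) \<le> K"
proof -
  assume "f \<in> B"
  then have "f \<in> Hinf" using subset_Hinf by blast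
  then have "bounded (f ` Cplus)" unfolding Hinf_def mem_Collect_eq by (elim conjE)
  then show ?thesis unfolding bounded_iff by blast
qed

sublocale smooth: wiener_function_algebra Cplus "smooth_subalgebra m B" for m
proof
  show "Cplus \<noteq> {}" using one_in_Cplus by blast
  have "Hinf \<subseteq> extensional Cplus" by (auto simp: Hinf_def)
  then show "smooth_subalgebra m B \<subseteq> extensional Cplus"
    using subset_Hinf smooth_subalgebra_subset by blast
  show "\<exists>K. \<forall>s\<in>Cplus. cmod (f s) \<le> K" if "f \<in> smooth_subalgebra m B" for f
    using that smooth_subalgebra_subset bounded_on_Cplus by blast
  show "(\<lambda>s\<in>Cplus. 1 / f s) \<in> smooth_subalgebra m B"
    if "f \<in> smooth_subalgebra m B" "\<delta> > 0" "\<And>s. s \<in> Cplus \<Longrightarrow> \<delta> \<le> cmod (f s)" for f \<delta>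
    using that(3) by (intro smooth_inverse[OF that(2,1)]) blast
  show "(\<lambda>x\<in>Cplus. c) \<in> smooth_subalgebra m B" for c by (rule smooth_const)
  show "(\<lambda>x\<in>Cplus. f x + g x) \<in> smooth_subalgebra m B"
    if "f \<in> smooth_subalgebra m B" "g \<in> smooth_subalgebra m B" for f g
    using that by (rule smooth_add)
  show "(\<lambda>x\<in>Cplus. f x * g x) \<in> smooth_subalgebra m B"
    if "f \<in> smooth_subalgebra m B" "g \<in> smooth_subalgebra m B" for f g
    using that by (rule smooth_mult)
qed

section \<open>Uniform approximation, translation and behaviour at infinity\<close>

lemma smooth_lipschitz:
  assumes "m \<ge> 1" "f \<in> smooth_subalgebra m B"
  obtains L where "L \<ge> 0" "\<And>s t. s \<in> Cplus \<Longrightarrow> t \<in> Cplus \<Longrightarrow> cmod (f s - f t) \<le> L * cmod (s - t)"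
proof -
  have f: "f \<in> B" by (rule smooth_subalgebra_subset[OF assms(2)])
  \<comment> \<open>Here \<open>m \<ge> 1\<close> provides a bounded first derivative; convexity of
    \<open>Cplus\<close> converts it into a Lipschitz bound.\<close>
  have "1 \<in> {1..m}" using assms(1) by simp
  then have f': "restrict ((deriv ^^ 1) f) Cplus \<in> B"
    using assms(2) unfolding smooth_subalgebra_def by blast
  obtain L where L: "\<And>s. s \<in> Cplus \<Longrightarrow> cmod (restrict ((deriv ^^ 1) f) Cplus s) \<le> L"
    using bounded_on_Cplus[OF f'] by blast
  have L': "cmod (deriv f s) \<le> L" if "s \<in> Cplus" for s using L[OF that] that by simp
  show thesis
  proof (rule that)
    show "L \<ge> 0" using L'[OF one_in_Cplus] norm_ge_zero order_trans by blast
    show "cmod (f s - f t) \<le> L * cmod (s - t)" if "s \<in> Cplus" "t \<in> Cplus" for s t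
      by (rule field_differentiable_bound[OF convex_Cplus _ L' that])
         (rule has_field_derivative_at_within[OF has_deriv[OF f]])
  qed
qed

lemma smooth_approximable_by_polynomial:
  assumes "m \<ge> 1" "f \<in> smooth_subalgebra m B" "e > 0"
  obtains N :: nat and c :: "nat \<Rightarrow> complex" where
    "\<And>s. s \<in> Cplus \<Longrightarrow> cmod (f s - (\<Sum>n=1..N. c n / of_nat n powr s)) < e"
proof -
  have "f \<in> Hinf" using assms(2) smooth_subalgebra_subset subset_Hinf by blast
  then obtain a :: "nat \<Rightarrow> complex" where a: "\<And>s. s \<in> Cplus \<Longrightarrow> (\<lambda>n. a (Suc n) / of_nat (Suc n) powr s) sums f s"
    unfolding Hinf_def by blast
  obtain L where "L \<ge> 0"
    and L: "\<And>s t. s \<in> Cplus \<Longrightarrow> t \<in> Cplus \<Longrightarrow> cmod (f s - f t) \<le> L * cmod (s - t)"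
    by (rule smooth_lipschitz[OF assms(1,2)]) (rule that)
  have lip: "cmod (f (s + \<i> * of_real t) - f s) \<le> L * \<bar>t\<bar>" if "s \<in> Cplus" for s t
    using L[of "s + \<i> * of_real t" s] that by (simp add: Cplus_def norm_mult)
  show thesis
  proof (rule lipschitz_Dirichlet_approximable[OF _ _ assms(3)])
    show "(\<lambda>n. a (Suc n) / of_nat (Suc n) powr s) sums f s" if "s \<in> Cplus" for s
      using that by (rule a)
    show "cmod (f (s + \<i> * of_real t) - f s) \<le> L * \<bar>t\<bar>" if "s \<in> Cplus" for s t
      using that by (rule lip)
  qed (rule that)
qed

text \<open>Translating a Dirichlet polynomial by \<open>h\<close> only multiplies its coefficients
  by \<open>n\<close> to the power \<open>- h\<close>, so polynomials remain in the algebra when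
  \<open>f\<close> itself may not. Since \<open>h \<ge> 0\<close> keeps \<open>Cplus\<close> inside
  itself, the approximation error does not grow.\<close>

lemma translate_approximable:
  assumes "m \<ge> 1" "f \<in> smooth_subalgebra m B" "h \<ge> 0"
  shows "smooth.approximable m (\<lambda>s. f (s + of_real h))"
  unfolding smooth.approximable_def
proof (intro allI impI)
  fix e :: real assume e: "e > 0"
  obtain N :: nat and c :: "nat \<Rightarrow> complex" where c:
    "\<And>s. s \<in> Cplus \<Longrightarrow> cmod (f s - (\<Sum>n=1..N. c n / of_nat n powr s)) < e"
    by (rule smooth_approximable_by_polynomial[OF assms(1,2) e]) (rule that)
  show "\<exists>g\<in>smooth_subalgebra m B. \<forall>x\<in>Cplus. cmod (f (x + of_real h) - g x) < e"
  proof (intro bexI ballI)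
    show "(\<lambda>s\<in>Cplus. \<Sum>n=1..N. (c n / of_nat n powr of_real h) / of_nat n powr s) \<in> smooth_subalgebra m B"
      by (rule smooth_polynomial)
    fix s assume s: "s \<in> Cplus"
    then have "s + of_real h \<in> Cplus" using assms(3) by (simp add: Cplus_def)
    from c[OF this] show "cmod (f (s + of_real h) -
        (\<lambda>s\<in>Cplus. \<Sum>n=1..N. (c n / of_nat n powr of_real h) / of_nat n powr s) s) < e"
      using s by (simp add: powr_add mult_ac)
  qed
qed

text \<open>Each term with \<open>n \<ge> 2\<close> decays with \<open>Re s\<close>. The filter
  \<open>filtercomap Re at_top\<close> makes the limit uniform in the imaginary part.\<close>

lemma polynomial_tendsto:
  "((\<lambda>s. \<Sum>n=1..N. c n / of_nat n powr s) \<longlongrightarrow> (\<Sum>n=1..N. if n = 1 then c n else 0)) (filtercomap Re at_top)"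
proof (rule tendsto_sum)
  fix n assume n: "n \<in> {1..N}"
  show "((\<lambda>s. c n / of_nat n powr s) \<longlongrightarrow> (if n = 1 then c n else 0)) (filtercomap Re at_top)"
  proof (cases "n = 1")
    case False
    then have "real n > 1" using n by simp
    then have "((\<lambda>x. cmod (c n) * real n powr - x) \<longlongrightarrow> 0) at_top" by real_asymp
    then have "((\<lambda>s. cmod (c n) * real n powr - Re s) \<longlongrightarrow> 0) (filtercomap Re at_top)"
      by (rule filterlim_compose[OF _ filterlim_filtercomap])
    moreover have "cmod (c n / of_nat n powr s) = cmod (c n) * real n powr - Re s" for s
    proof -
      have "cmod (of_nat n powr s) = real n powr Re s"
        by (subst norm_powr_real_powr) simp_all
      then show ?thesis by (simp add: norm_divide powr_minus_divide)
    qed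
    ultimately have "((\<lambda>s. cmod (c n / of_nat n powr s)) \<longlongrightarrow> 0) (filtercomap Re at_top)"
      by presburger
    then have "((\<lambda>s. c n / of_nat n powr s) \<longlongrightarrow> 0) (filtercomap Re at_top)"
      by (rule tendsto_norm_zero_cancel)
    then show ?thesis using False by (simp only: if_False)
  qed simp
qed

text \<open>A uniformly approximating Dirichlet polynomial has a limit far to the right; going from
  \<open>f s\<close> to \<open>f t\<close> through it costs four errors of \<open>e / 4\<close>. The
  Cauchy form avoids naming a limit of \<open>f\<close>.\<close>

lemma smooth_limit_at_infinity:
  assumes "m \<ge> 1" "f \<in> smooth_subalgebra m B" "e > 0"
  obtains H where "\<And>s t. s \<in> Cplus \<Longrightarrow> t \<in> Cplus \<Longrightarrow> Re s \<ge> H \<Longrightarrow> Re t \<ge> H \<Longrightarrow> cmod (f s - f t) \<le> e"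
proof -
  have e4: "e / 4 > 0" using assms(3) by simp
  obtain N :: nat and c :: "nat \<Rightarrow> complex" where c:
    "\<And>s. s \<in> Cplus \<Longrightarrow> cmod (f s - (\<Sum>n=1..N. c n / of_nat n powr s)) < e / 4"
    by (rule smooth_approximable_by_polynomial[OF assms(1,2) e4]) (rule that)
  define p where "p = (\<lambda>s. \<Sum>n=1..N. c n / of_nat n powr s)"
  obtain l where "(p \<longlongrightarrow> l) (filtercomap Re at_top)"
    using polynomial_tendsto unfolding p_def by blast
  then have "\<forall>\<^sub>F s in filtercomap Re at_top. dist (p s) l < e / 4"
    using e4 by (rule tendstoD)
  then obtain H where H: "\<And>s. Re s \<ge> H \<Longrightarrow> dist (p s) l < e / 4"
    unfolding eventually_filtercomap_at_top_linorder by blast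
  show thesis
  proof (rule that)
    fix s t assume st: "s \<in> Cplus" "t \<in> Cplus" "Re s \<ge> H" "Re t \<ge> H"
    have "dist (f s) (p s) < e / 4" "dist (f t) (p t) < e / 4"
      using c st by (simp_all add: p_def dist_norm)
    then have "dist (f s) (f t) \<le> e"
      using H[OF st(3)] H[OF st(4)] dist_triangle[of "f s" "f t" "p s"] dist_triangle[of "p s" "f t" l]
        dist_triangle[of l "f t" "p t"] dist_commute[of l "p t"] dist_commute[of "p t" "f t"] by linarith
    then show "cmod (f s - f t) \<le> e" by (simp add: dist_norm)
  qed
qed

text \<open>The translates \<open>P (s + j h)\<close>, \<open>j = 0, 1, \<dots>, k\<close>, form a chain of close idempotents which, for
  large \<open>k\<close>, ends close to the constant \<open>P (k h)\<close>.\<close>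

lemma smooth_idempotent_intertwined_const:
  assumes m: "m \<ge> 1" and P: "smooth.mem.mat_over m n n P"
    and idem: "\<And>s. s \<in> Cplus \<Longrightarrow> P s * P s = P s"
  obtains E where "E \<in> carrier_mat n n" "E * E = E" "smooth.intertwined m n P (\<lambda>s. E)"
proof -
  note c = smooth.mem.mat_over_carrier[OF P]
  \<comment> \<open>\<open>P\<close> may take any values off \<open>Cplus\<close>; its entries
    belong to the smooth subalgebra only after restriction.\<close>
  define p where "p = (\<lambda>i j. \<lambda>s\<in>Cplus. P s $$ (i, j))"
  have p: "p i j \<in> smooth_subalgebra m B" if "i < n" "j < n" for i j
    using P that by (simp add: p_def smooth.mem.mat_over_def smooth.mem_def)
  obtain K where K: "K \<ge> 0" "\<And>s. s \<in> Cplus \<Longrightarrow> entries_le (P s) K"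
    using smooth.mat_over_bounded[OF smooth.mat_over_approximable[OF P]] by blast
  obtain d where d: "d > 0" and close: "\<And>P Q. smooth.approximable.mat_over m n n P \<Longrightarrow>
    smooth.approximable.mat_over m n n Q \<Longrightarrow>
    \<forall>x\<in>Cplus. P x * P x = P x \<and> Q x * Q x = Q x \<and> entries_le (P x) K \<and> entries_le (Q x - P x) d \<Longrightarrow>
    smooth.intertwined m n P Q"
    by (rule smooth.close_idempotents_intertwined[OF K(1), of m n]) (rule that)
  have "\<exists>L\<ge>0. \<forall>s\<in>Cplus. \<forall>t\<in>Cplus. cmod (p i j s - p i j t) \<le> L * cmod (s - t)" if "i < n" "j < n" for i j
    by (rule smooth_lipschitz[OF m p[OF that]]) blast
  then obtain L where L: "\<And>i j. i < n \<Longrightarrow> j < n \<Longrightarrow>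
      L i j \<ge> 0 \<and> (\<forall>s\<in>Cplus. \<forall>t\<in>Cplus. cmod (p i j s - p i j t) \<le> L i j * cmod (s - t))"
    by metis
  have "\<exists>H. \<forall>s\<in>Cplus. \<forall>t\<in>Cplus. Re s \<ge> H \<longrightarrow> Re t \<ge> H \<longrightarrow> cmod (p i j s - p i j t) \<le> d"
    if "i < n" "j < n" for i j
    by (rule smooth_limit_at_infinity[OF m p[OF that] d]) blast
  then obtain H where H: "\<And>i j. i < n \<Longrightarrow> j < n \<Longrightarrow>
      \<forall>s\<in>Cplus. \<forall>t\<in>Cplus. Re s \<ge> H i j \<longrightarrow> Re t \<ge> H i j \<longrightarrow> cmod (p i j s - p i j t) \<le> d"
    by metis
  \<comment> \<open>Sums of nonnegative numbers serve as bounds common to all entries. The 1 keeps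
    \<open>LL\<close> positive for the division below, and absolute values appear in
    \<open>HH\<close> because thresholds may be negative.\<close>
  define LL where "LL = (\<Sum>i<n. \<Sum>j<n. L i j) + 1"
  define HH where "HH = (\<Sum>i<n. \<Sum>j<n. \<bar>H i j\<bar>)"
  have L0: "L i j \<ge> 0" if "i < n" "j < n" for i j using L that by blast
  have le_sum: "x i j \<le> (\<Sum>i<n. \<Sum>j<n. x i j)"
    if x: "\<And>i j. i < n \<Longrightarrow> j < n \<Longrightarrow> x i j \<ge> 0" and "i < n" "j < n" for x :: "nat \<Rightarrow> nat \<Rightarrow> real" and i j
  proof -
    have "x i j \<le> (\<Sum>j<n. x i j)" using that by (intro member_le_sum) auto
    also have "\<dots> \<le> (\<Sum>i<n. \<Sum>j<n. x i j)"
      using that by (intro member_le_sum[where f = "\<lambda>i. \<Sum>j<n. x i j"] sum_nonneg) auto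
    finally show ?thesis .
  qed
  have LL: "L i j \<le> LL" if "i < n" "j < n" for i j
    using le_sum[of L, OF L0 that] by (simp add: LL_def)
  have HH: "H i j \<le> HH" if "i < n" "j < n" for i j
    using le_sum[of "\<lambda>i j. \<bar>H i j\<bar>", OF _ that] by (simp add: HH_def)
  have LL0: "LL > 0" unfolding LL_def using L0 by (intro add_nonneg_pos sum_nonneg) auto
  \<comment> \<open>One shift by \<open>h\<close> moves every entry by at most
    \<open>LL h = d\<close>, the distance allowed between consecutive idempotents.\<close>
  define h where "h = d / LL"
  have h: "h > 0" using d LL0 by (simp add: h_def)
  have hL: "LL * h = d" using LL0 by (simp add: h_def)
  define Q where "Q = (\<lambda>k s. P (s + of_real (real k * h)))"
  have shift: "s + of_real (real k * h) \<in> Cplus" if "s \<in> Cplus" for s k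
    using that h by (simp add: Cplus_def add_pos_nonneg)
  have Q: "smooth.approximable.mat_over m n n (Q k)" for k
    unfolding smooth.approximable.mat_over_def
  proof (intro conjI allI impI)
    show "Q k s \<in> carrier_mat n n" for s by (simp add: Q_def c)
    fix i j assume ij: "i < n" "j < n"
    have "smooth.approximable m (\<lambda>s. p i j (s + of_real (real k * h)))"
      using h by (intro translate_approximable m p ij) simp
    then show "smooth.approximable m (\<lambda>s. Q k s $$ (i, j))"
      using shift unfolding smooth.approximable_def p_def Q_def by simp
  qed
  have Q_idem: "Q k s * Q k s = Q k s" if "s \<in> Cplus" for k s
    unfolding Q_def by (rule idem[OF shift[OF that]])
  have QK: "entries_le (Q k s) K" if "s \<in> Cplus" for k s
    unfolding Q_def by (rule K(2)[OF shift[OF that]])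
  have step: "smooth.intertwined m n (Q k) (Q (Suc k))" for k
  proof (rule close[OF Q Q], rule ballI)
    fix s assume s: "s \<in> Cplus"
    have "entries_le (Q (Suc k) s - Q k s) d"
    proof (rule entries_leI[OF minus_carrier_mat])
      show "Q k s \<in> carrier_mat n n" by (simp add: Q_def c)
      fix i j assume ij: "i < n" "j < n"
      let ?s = "s + of_real (real k * h)" and ?t = "s + of_real (real (Suc k) * h)"
      have "(Q (Suc k) s - Q k s) $$ (i, j) = p i j ?t - p i j ?s"
        using ij carrier_matD[OF c] shift[OF s, of k] shift[OF s, of "Suc k"]
        by (simp add: Q_def p_def del: of_nat_Suc)
      also have "cmod \<dots> \<le> L i j * cmod (?t - ?s)" using L[OF ij] shift[OF s] by blast
      also have "?t - ?s = of_real h" by (simp add: algebra_simps)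
      also have "L i j * cmod (of_real h) \<le> LL * h" using LL[OF ij] h by (simp add: mult_right_mono)
      finally show "cmod ((Q (Suc k) s - Q k s) $$ (i, j)) \<le> d" using hL by simp
    qed
    then show "Q k s * Q k s = Q k s \<and> Q (Suc k) s * Q (Suc k) s = Q (Suc k) s
        \<and> entries_le (Q k s) K \<and> entries_le (Q (Suc k) s - Q k s) d"
      using Q_idem QK s by blast
  qed
  have chain: "smooth.intertwined m n (Q 0) (Q k)" for k
  proof (induction k)
    case 0
    show ?case by (rule smooth.intertwined_refl[OF Q])
  next
    case (Suc k)
    show ?case by (rule smooth.intertwined_trans[OF Q Q Q Suc step])
  qed
  \<comment> \<open>From here on both \<open>w = k h\<close> and \<open>s + w\<close> have real part
    above every threshold, so \<open>Q k\<close> stays within \<open>d\<close> of the constant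
    matrix \<open>P w\<close>. As \<open>HH \<ge> 0\<close>, the point \<open>w\<close> lies in
    \<open>Cplus\<close>, where \<open>P\<close> is idempotent.\<close>
  obtain k :: nat where k: "HH < real k * h" using reals_Archimedean3[OF h] by blast
  have HH0: "HH \<ge> 0" unfolding HH_def by (intro sum_nonneg) auto
  let ?w = "of_real (real k * h) :: complex"
  have w: "?w \<in> Cplus" using k HH0 by (simp add: Cplus_def)
  have "smooth.intertwined m n (Q k) (\<lambda>s. P ?w)"
  proof (rule close[OF Q smooth.approximable.mat_over_const[OF c]], rule ballI)
    fix s assume s: "s \<in> Cplus"
    have "entries_le (P ?w - Q k s) d"
    proof (rule entries_leI[OF minus_carrier_mat])
      show "Q k s \<in> carrier_mat n n" by (simp add: Q_def c)
      fix i j assume ij: "i < n" "j < n"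
      have "(P ?w - Q k s) $$ (i, j) = p i j ?w - p i j (s + ?w)"
        using ij carrier_matD[OF c] shift[OF s] w by (simp add: Q_def p_def)
      moreover have "Re ?w \<ge> H i j" "Re (s + ?w) \<ge> H i j"
        using HH[OF ij] k s by (auto simp: Cplus_def)
      ultimately show "cmod ((P ?w - Q k s) $$ (i, j)) \<le> d"
        using H[OF ij] w shift[OF s] by metis
    qed
    then show "Q k s * Q k s = Q k s \<and> P ?w * P ?w = P ?w
        \<and> entries_le (Q k s) K \<and> entries_le (P ?w - Q k s) d"
      using Q_idem QK s idem[OF w] by blast
  qed
  from smooth.intertwined_trans[OF Q Q smooth.approximable.mat_over_const[OF c] chain this]
  have "smooth.intertwined m n (Q 0) (\<lambda>s. P ?w)" .
  moreover have "Q 0 = P" by (simp add: Q_def)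
  ultimately show thesis using that[OF c idem[OF w]] by simp
qed

theorem smooth_idempotent_splits:
  assumes "m \<ge> 1" "smooth.mem.mat_over m n n P" "\<And>s. s \<in> Cplus \<Longrightarrow> P s * P s = P s"
  obtains k u v where "smooth.mem.mat_over m n k u" "smooth.mem.mat_over m k n v"
    "\<And>s. s \<in> Cplus \<Longrightarrow> u s * v s = P s" "\<And>s. s \<in> Cplus \<Longrightarrow> v s * u s = 1\<^sub>m k"
proof -
  obtain E where E: "E \<in> carrier_mat n n" "E * E = E" "smooth.intertwined m n P (\<lambda>s. E)"
    by (rule smooth_idempotent_intertwined_const[OF assms])
  show thesis
  proof (rule smooth.idempotent_splits[OF assms(2) _ E])
    show "P s * P s = P s" if "s \<in> Cplus" for s using that by (rule assms(3))
  qed (rule that)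
qed

end

section \<open>Projective modules and idempotent matrices\<close>

lemma (in abelian_monoid) finsum_swap:
  assumes "finite I" "finite J" "\<And>i j. i \<in> I \<Longrightarrow> j \<in> J \<Longrightarrow> g i j \<in> carrier G"
  shows "(\<Oplus>i\<in>I. \<Oplus>j\<in>J. g i j) = (\<Oplus>j\<in>J. \<Oplus>i\<in>I. g i j)"
  using assms(1,3)
proof (induction I rule: finite_induct)
  case empty
  show ?case by (simp add: finsum_zero)
next
  case (insert a I)
  have g: "(\<lambda>j. g a j) \<in> J \<rightarrow> carrier G" "(\<lambda>j. \<Oplus>i\<in>I. g i j) \<in> J \<rightarrow> carrier G"
    using insert.prems by (auto intro!: finsum_closed)
  have "(\<Oplus>i\<in>insert a I. \<Oplus>j\<in>J. g i j) = (\<Oplus>j\<in>J. g a j) \<oplus> (\<Oplus>j\<in>J. \<Oplus>i\<in>I. g i j)"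
    using insert by (subst finsum_insert) (auto intro!: finsum_closed)
  also have "\<dots> = (\<Oplus>j\<in>J. g a j \<oplus> (\<Oplus>i\<in>I. g i j))"
    using g by (rule finsum_addf[symmetric])
  also have "\<dots> = (\<Oplus>j\<in>J. \<Oplus>i\<in>insert a I. g i j)"
    using insert g by (intro finsum_cong') (auto simp: finsum_insert Pi_def intro!: finsum_closed)
  finally show ?case .
qed

lemma additive_finsum:
  assumes M: "abelian_monoid M" and N: "abelian_monoid N"
    and f: "\<And>x. x \<in> carrier M \<Longrightarrow> f x \<in> carrier N"
    and zero: "f \<zero>\<^bsub>M\<^esub> = \<zero>\<^bsub>N\<^esub>"
    and add: "\<And>x y. x \<in> carrier M \<Longrightarrow> y \<in> carrier M \<Longrightarrow> f (x \<oplus>\<^bsub>M\<^esub> y) = f x \<oplus>\<^bsub>N\<^esub> f y"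
    and "finite A" "\<And>a. a \<in> A \<Longrightarrow> g a \<in> carrier M"
  shows "f (\<Oplus>\<^bsub>M\<^esub>a\<in>A. g a) = (\<Oplus>\<^bsub>N\<^esub>a\<in>A. f (g a))"
  using assms(6,7)
proof (induction A rule: finite_induct)
  case empty
  show ?case
    unfolding abelian_monoid.finsum_empty[OF M] abelian_monoid.finsum_empty[OF N] by (rule zero)
next
  case (insert a A)
  have "f (\<Oplus>\<^bsub>M\<^esub>a\<in>insert a A. g a) = f (g a \<oplus>\<^bsub>M\<^esub> (\<Oplus>\<^bsub>M\<^esub>a\<in>A. g a))"
    using insert by (subst abelian_monoid.finsum_insert[OF M]) auto
  also have "\<dots> = f (g a) \<oplus>\<^bsub>N\<^esub> (\<Oplus>\<^bsub>N\<^esub>a\<in>A. f (g a))"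
    using insert by (subst add) (auto intro!: abelian_monoid.finsum_closed[OF M])
  also have "\<dots> = (\<Oplus>\<^bsub>N\<^esub>a\<in>insert a A. f (g a))"
    using insert f by (subst abelian_monoid.finsum_insert[OF N]) auto
  finally show ?case .
qed

text \<open>The dual basis lemma: only finitely many coordinates of the ambient free module are needed,
  since they suffice for the finitely many generators.\<close>

lemma dual_basis:
  fixes R :: "('a, 'r) ring_scheme" (structure) and M :: "('a, 'c) module"
  assumes "module R M" and fg: "finitely_generated_module R M" and proj: "projective_module R M"
  obtains n :: nat and e :: "nat \<Rightarrow> 'c" and f :: "nat \<Rightarrow> 'c \<Rightarrow> 'a"
  where "\<And>i. i < n \<Longrightarrow> e i \<in> carrier M"
    and "\<And>i x. i < n \<Longrightarrow> x \<in> carrier M \<Longrightarrow> f i x \<in> carrier R"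
    and "\<And>i x y. i < n \<Longrightarrow> x \<in> carrier M \<Longrightarrow> y \<in> carrier M \<Longrightarrow> f i (x \<oplus>\<^bsub>M\<^esub> y) = f i x \<oplus> f i y"
    and "\<And>i a x. i < n \<Longrightarrow> a \<in> carrier R \<Longrightarrow> x \<in> carrier M \<Longrightarrow> f i (a \<odot>\<^bsub>M\<^esub> x) = a \<otimes> f i x"
    and "\<And>x. x \<in> carrier M \<Longrightarrow> x = (\<Oplus>\<^bsub>M\<^esub>i\<in>{..<n}. f i x \<odot>\<^bsub>M\<^esub> e i)"
proof -
  interpret module R M by (rule assms(1))
  obtain N :: "('a, 'c \<Rightarrow> 'a) module" and I :: "'c set"
    where N: "module R N" and "module_isomorphic R (module_direct_sum M N) (free_module R I)"
    using proj unfolding projective_module_def by blast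
  then obtain \<phi> where \<phi>: "\<phi> \<in> iso (add_monoid (module_direct_sum M N)) (add_monoid (free_module R I))"
    and \<phi>s: "\<And>a x. a \<in> carrier R \<Longrightarrow> x \<in> carrier M \<times> carrier N \<Longrightarrow>
      \<phi> (a \<odot>\<^bsub>module_direct_sum M N\<^esub> x) = a \<odot>\<^bsub>free_module R I\<^esub> \<phi> x"
    unfolding module_isomorphic_def by (auto simp: module_direct_sum_def)
  interpret N: module R N by (rule N)
  define F where "F = carrier (free_module R I)"
  have F: "F = {x \<in> I \<rightarrow>\<^sub>E carrier R. finite {i \<in> I. x i \<noteq> \<zero>}}"
    by (simp add: F_def free_module_def)
  have bij: "bij_betw \<phi> (carrier M \<times> carrier N) F"
    using \<phi> by (simp add: iso_def module_direct_sum_def F_def)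
  have \<phi>a: "\<phi> (fst x \<oplus>\<^bsub>M\<^esub> fst y, snd x \<oplus>\<^bsub>N\<^esub> snd y) = (\<lambda>i\<in>I. \<phi> x i \<oplus> \<phi> y i)"
    if "x \<in> carrier M \<times> carrier N" "y \<in> carrier M \<times> carrier N" for x y
    using \<phi> that by (auto simp: iso_def hom_def module_direct_sum_def free_module_def)
  have \<phi>m: "\<phi> (a \<odot>\<^bsub>M\<^esub> fst x, a \<odot>\<^bsub>N\<^esub> snd x) = (\<lambda>i\<in>I. a \<otimes> \<phi> x i)"
    if "a \<in> carrier R" "x \<in> carrier M \<times> carrier N" for a x
    using \<phi>s[OF that] by (simp add: module_direct_sum_def free_module_def)
  \<comment> \<open>Coordinates of an element of \<open>M\<close>, embedded in the free module as
    the first summand.\<close>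
  define \<iota> where "\<iota> = (\<lambda>i x. \<phi> (x, \<zero>\<^bsub>N\<^esub>) i)"
  have \<iota>F: "\<phi> (x, \<zero>\<^bsub>N\<^esub>) \<in> F" if "x \<in> carrier M" for x
    using bij that by (auto simp: bij_betw_def)
  have \<iota>c: "\<iota> i x \<in> carrier R" if "i \<in> I" "x \<in> carrier M" for i x
    using \<iota>F[OF that(2)] that(1) by (auto simp: F \<iota>_def)
  have \<iota>a: "\<iota> i (x \<oplus>\<^bsub>M\<^esub> y) = \<iota> i x \<oplus> \<iota> i y" if "i \<in> I" "x \<in> carrier M" "y \<in> carrier M" for i x y
    using \<phi>a[of "(x, \<zero>\<^bsub>N\<^esub>)" "(y, \<zero>\<^bsub>N\<^esub>)"] that by (simp add: \<iota>_def)
  have \<iota>m: "\<iota> i (a \<odot>\<^bsub>M\<^esub> x) = a \<otimes> \<iota> i x" if "i \<in> I" "a \<in> carrier R" "x \<in> carrier M" for i a x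
    using \<phi>m[of a "(x, \<zero>\<^bsub>N\<^esub>)"] that by (simp add: \<iota>_def)
  have \<iota>0: "\<iota> i \<zero>\<^bsub>M\<^esub> = \<zero>" if "i \<in> I" for i
    using \<iota>m[OF that R.zero_closed M.zero_closed] \<iota>c[OF that M.zero_closed] by simp

  obtain S where S: "finite S" "S \<subseteq> carrier M"
    "\<And>x. x \<in> carrier M \<Longrightarrow> \<exists>c \<in> S \<rightarrow> carrier R. x = (\<Oplus>\<^bsub>M\<^esub>s\<in>S. c s \<odot>\<^bsub>M\<^esub> s)"
    using fg unfolding finitely_generated_module_def by blast
  \<comment> \<open>The union of the finite supports of the generators; by linearity all coordinates
    of elements of \<open>M\<close> vanish outside it.\<close>
  define J where "J = (\<Union>s\<in>S. {i \<in> I. \<iota> i s \<noteq> \<zero>})"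
  have "finite {i \<in> I. \<iota> i s \<noteq> \<zero>}" if "s \<in> S" for s
    using \<iota>F[of s] S(2) that by (auto simp: F \<iota>_def)
  then have finJ: "finite J" using S(1) by (simp add: J_def)
  have JI: "J \<subseteq> I" by (auto simp: J_def)
  have outside: "\<iota> i x = \<zero>" if "i \<in> I" "i \<notin> J" "x \<in> carrier M" for i x
  proof -
    obtain c where c: "c \<in> S \<rightarrow> carrier R" and x: "x = (\<Oplus>\<^bsub>M\<^esub>s\<in>S. c s \<odot>\<^bsub>M\<^esub> s)"
      using S(3)[OF \<open>x \<in> carrier M\<close>] by blast
    have "\<iota> i x = (\<Oplus>s\<in>S. \<iota> i (c s \<odot>\<^bsub>M\<^esub> s))"
      unfolding x
      by (rule additive_finsum[OF M.abelian_monoid_axioms R.abelian_monoid_axioms \<iota>c[OF that(1)] \<iota>0[OF that(1)]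
        \<iota>a[OF that(1)] S(1)]) (use c S(2) in auto)
    also have "\<dots> = (\<Oplus>s\<in>S. \<zero>)"
    proof (rule R.finsum_cong')
      fix s assume s: "s \<in> S"
      then have "\<iota> i s = \<zero>" using that by (auto simp: J_def)
      then show "\<iota> i (c s \<odot>\<^bsub>M\<^esub> s) = \<zero>"
        using \<iota>m[OF that(1), of "c s" s] c S(2) s by auto
    qed auto
    finally show ?thesis by simp
  qed

  define \<psi> where "\<psi> = inv_into (carrier M \<times> carrier N) \<phi>"
  \<comment> \<open>The projection of the free module onto \<open>M\<close>, a left inverse of the
    embedding.\<close>
  define \<rho> where "\<rho> = (\<lambda>y. fst (\<psi> y))"
  have \<psi>c: "\<psi> y \<in> carrier M \<times> carrier N" and \<phi>\<psi>: "\<phi> (\<psi> y) = y" if "y \<in> F" for y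
    using that bij unfolding \<psi>_def bij_betw_def
    by (metis inv_into_into, metis f_inv_into_f)
  have \<psi>\<phi>: "\<psi> (\<phi> x) = x" if "x \<in> carrier M \<times> carrier N" for x
    using that bij unfolding \<psi>_def bij_betw_def by (metis inv_into_f_f)
  have \<rho>c: "\<rho> y \<in> carrier M" if "y \<in> F" for y
    using \<psi>c[OF that] by (auto simp: \<rho>_def)
  have \<rho>a: "\<rho> (\<lambda>i\<in>I. x i \<oplus> y i) = \<rho> x \<oplus>\<^bsub>M\<^esub> \<rho> y" if "x \<in> F" "y \<in> F" for x y
  proof -
    let ?z = "(fst (\<psi> x) \<oplus>\<^bsub>M\<^esub> fst (\<psi> y), snd (\<psi> x) \<oplus>\<^bsub>N\<^esub> snd (\<psi> y))"
    have "?z \<in> carrier M \<times> carrier N"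
      using \<psi>c[OF that(1)] \<psi>c[OF that(2)] by (simp add: mem_Times_iff)
    from \<psi>\<phi>[OF this] have "\<psi> (\<lambda>i\<in>I. x i \<oplus> y i) = ?z"
      unfolding \<phi>a[OF \<psi>c[OF that(1)] \<psi>c[OF that(2)]] \<phi>\<psi>[OF that(1)] \<phi>\<psi>[OF that(2)] .
    then show ?thesis by (simp add: \<rho>_def)
  qed
  have \<rho>m: "\<rho> (\<lambda>i\<in>I. a \<otimes> x i) = a \<odot>\<^bsub>M\<^esub> \<rho> x" if "a \<in> carrier R" "x \<in> F" for a x
  proof -
    let ?z = "(a \<odot>\<^bsub>M\<^esub> fst (\<psi> x), a \<odot>\<^bsub>N\<^esub> snd (\<psi> x))"
    have "?z \<in> carrier M \<times> carrier N"
      using that(1) \<psi>c[OF that(2)] by (simp add: mem_Times_iff)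
    from \<psi>\<phi>[OF this] have "\<psi> (\<lambda>i\<in>I. a \<otimes> x i) = ?z"
      unfolding \<phi>m[OF that(1) \<psi>c[OF that(2)]] \<phi>\<psi>[OF that(2)] .
    then show ?thesis by (simp add: \<rho>_def)
  qed
  define b where "b = (\<lambda>j. \<lambda>i\<in>I. if i = j then \<one> else \<zero>)"
  have bF: "b j \<in> F" if "j \<in> I" for j
  proof -
    have "{i \<in> I. b j i \<noteq> \<zero>} \<subseteq> {j}" by (auto simp: b_def)
    then have "finite {i \<in> I. b j i \<noteq> \<zero>}" by (rule finite_subset) simp
    then show ?thesis unfolding F mem_Collect_eq by (intro conjI) (auto simp: b_def)
  qed
  \<comment> \<open>Finitely supported vectors are expanded in unit vectors by splitting off one
    coordinate at a time. With no coordinate left, \<open>y\<close> equals \<open>0 y\<close>, so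
    homogeneity gives the value 0.\<close>
  have expand: "\<rho> y = (\<Oplus>\<^bsub>M\<^esub>j\<in>K. y j \<odot>\<^bsub>M\<^esub> \<rho> (b j))"
    if "finite K" "K \<subseteq> I" "y \<in> F" "\<And>i. i \<in> I \<Longrightarrow> i \<notin> K \<Longrightarrow> y i = \<zero>" for K y
    using that
  proof (induction K arbitrary: y rule: finite_induct)
    case empty
    have "y = (\<lambda>i\<in>I. \<zero> \<otimes> y i)"
      using empty by (auto simp: F PiE_iff extensional_def fun_eq_iff)
    then have "\<rho> y = \<zero> \<odot>\<^bsub>M\<^esub> \<rho> y" using \<rho>m[OF R.zero_closed \<open>y \<in> F\<close>] by simp
    then show ?case using \<rho>c[OF \<open>y \<in> F\<close>] by simp
  next
    case (insert j K)
    have j: "j \<in> I" using insert by auto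
    have yc: "y i \<in> carrier R" if "i \<in> I" for i using \<open>y \<in> F\<close> that by (auto simp: F)
    define y' where "y' = (\<lambda>i\<in>I. if i = j then \<zero> else y i)"
    have "{i \<in> I. y' i \<noteq> \<zero>} \<subseteq> {i \<in> I. y i \<noteq> \<zero>}" by (auto simp: y'_def)
    then have "finite {i \<in> I. y' i \<noteq> \<zero>}"
      by (rule finite_subset) (use \<open>y \<in> F\<close> in \<open>simp add: F\<close>)
    then have y'F: "y' \<in> F"
      unfolding F mem_Collect_eq by (intro conjI) (auto simp: y'_def yc)
    have s: "(\<lambda>i\<in>I. y j \<otimes> b j i) \<in> F"
    proof -
      have "{i \<in> I. (\<lambda>i\<in>I. y j \<otimes> b j i) i \<noteq> \<zero>} \<subseteq> {j}" using yc[OF j] by (auto simp: b_def)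
      then have "finite {i \<in> I. (\<lambda>i\<in>I. y j \<otimes> b j i) i \<noteq> \<zero>}" by (rule finite_subset) simp
      then show ?thesis
        unfolding F mem_Collect_eq by (intro conjI) (use yc[OF j] in \<open>auto simp: b_def\<close>)
    qed
    have "y = (\<lambda>i\<in>I. (\<lambda>i\<in>I. y j \<otimes> b j i) i \<oplus> y' i)"
    proof
      fix i
      show "y i = (\<lambda>i\<in>I. (\<lambda>i\<in>I. y j \<otimes> b j i) i \<oplus> y' i) i"
        using \<open>y \<in> F\<close> yc j by (cases "i \<in> I") (auto simp: b_def y'_def F PiE_iff extensional_def)
    qed
    then have "\<rho> y = \<rho> (\<lambda>i\<in>I. y j \<otimes> b j i) \<oplus>\<^bsub>M\<^esub> \<rho> y'"
      using \<rho>a[OF s y'F] by simp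
    also have "\<rho> (\<lambda>i\<in>I. y j \<otimes> b j i) = y j \<odot>\<^bsub>M\<^esub> \<rho> (b j)"
      by (rule \<rho>m[OF yc[OF j] bF[OF j]])
    also have "\<rho> y' = (\<Oplus>\<^bsub>M\<^esub>i\<in>K. y' i \<odot>\<^bsub>M\<^esub> \<rho> (b i))"
      by (rule insert.IH[OF _ y'F]) (use insert.prems in \<open>auto simp: y'_def\<close>)
    also have "\<dots> = (\<Oplus>\<^bsub>M\<^esub>i\<in>K. y i \<odot>\<^bsub>M\<^esub> \<rho> (b i))"
      using insert yc bF \<rho>c by (intro M.finsum_cong') (auto simp: y'_def)
    also have "y j \<odot>\<^bsub>M\<^esub> \<rho> (b j) \<oplus>\<^bsub>M\<^esub> \<dots> = (\<Oplus>\<^bsub>M\<^esub>i\<in>insert j K. y i \<odot>\<^bsub>M\<^esub> \<rho> (b i))"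
      using insert yc bF \<rho>c by (intro M.finsum_insert[symmetric]) auto
    finally show ?case .
  qed

  obtain h where h: "bij_betw h {..<card J} J"
    using ex_bij_betw_nat_finite[OF finJ] by (auto simp: atLeast0LessThan)
  have hJ: "h i \<in> J" if "i < card J" for i using h that by (auto simp: bij_betw_def)
  then have hI: "h i \<in> I" if "i < card J" for i using that JI by blast
  show thesis
  proof (rule that[where n = "card J" and e = "\<lambda>i. \<rho> (b (h i))" and f = "\<lambda>i. \<iota> (h i)"])
    fix x assume x: "x \<in> carrier M"
    have "x = \<rho> (\<phi> (x, \<zero>\<^bsub>N\<^esub>))" using \<psi>\<phi>[of "(x, \<zero>\<^bsub>N\<^esub>)"] x by (simp add: \<rho>_def)
    also have "\<dots> = (\<Oplus>\<^bsub>M\<^esub>j\<in>J. \<iota> j x \<odot>\<^bsub>M\<^esub> \<rho> (b j))"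
      using expand[OF finJ JI \<iota>F[OF x]] outside x by (simp add: \<iota>_def)
    also have "\<dots> = (\<Oplus>\<^bsub>M\<^esub>j\<in>h ` {..<card J}. \<iota> j x \<odot>\<^bsub>M\<^esub> \<rho> (b j))"
      using h by (simp add: bij_betw_def)
    also have "\<dots> = (\<Oplus>\<^bsub>M\<^esub>i\<in>{..<card J}. \<iota> (h i) x \<odot>\<^bsub>M\<^esub> \<rho> (b (h i)))"
      using h hJ JI x \<iota>c bF \<rho>c by (intro M.finsum_reindex) (auto simp: bij_betw_def)
    finally show "x = (\<Oplus>\<^bsub>M\<^esub>i\<in>{..<card J}. \<iota> (h i) x \<odot>\<^bsub>M\<^esub> \<rho> (b (h i)))" .
  qed (use hI \<rho>c bF \<iota>c \<iota>a \<iota>m in auto)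
qed

text \<open>The ring operations are fields of a record and not type class operations, so matrices
  over \<open>R\<close> are plain index functions, whose values outside the stated range never
  enter.\<close>

definition (in ring) mat_vec :: "nat \<Rightarrow> (nat \<Rightarrow> nat \<Rightarrow> 'a) \<Rightarrow> (nat \<Rightarrow> 'a) \<Rightarrow> nat \<Rightarrow> 'a" where
  "mat_vec n A x i = (\<Oplus>j\<in>{..<n}. A i j \<otimes> x j)"

lemma (in cring) mat_vec_mat_vec:
  assumes A: "\<And>j. j < n \<Longrightarrow> A i j \<in> carrier R" and B: "\<And>j l. j < n \<Longrightarrow> l < k \<Longrightarrow> B j l \<in> carrier R"
    and x: "\<And>l. l < k \<Longrightarrow> x l \<in> carrier R"
  shows "mat_vec n A (mat_vec k B x) i = (\<Oplus>l\<in>{..<k}. (\<Oplus>j\<in>{..<n}. A i j \<otimes> B j l) \<otimes> x l)"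
proof -
  have "mat_vec n A (mat_vec k B x) i = (\<Oplus>j\<in>{..<n}. \<Oplus>l\<in>{..<k}. A i j \<otimes> B j l \<otimes> x l)"
    unfolding mat_vec_def using A B x
    by (intro finsum_cong') (auto simp: finsum_rdistr m_assoc Pi_def intro!: finsum_closed finsum_cong')
  also have "\<dots> = (\<Oplus>l\<in>{..<k}. \<Oplus>j\<in>{..<n}. A i j \<otimes> B j l \<otimes> x l)"
    using A B x by (intro finsum_swap) auto
  also have "\<dots> = (\<Oplus>l\<in>{..<k}. (\<Oplus>j\<in>{..<n}. A i j \<otimes> B j l) \<otimes> x l)"
    using A B x by (intro finsum_cong') (auto simp: finsum_ldistr Pi_def intro!: finsum_closed)
  finally show ?thesis .
qed

lemma (in ring) mat_vec_closed:
  "(\<And>j. j < n \<Longrightarrow> A i j \<in> carrier R) \<Longrightarrow> (\<And>j. j < n \<Longrightarrow> x j \<in> carrier R) \<Longrightarrow> mat_vec n A x i \<in> carrier R"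
  unfolding mat_vec_def by (intro finsum_closed) auto

lemma (in ring) mat_vec_cong:
  "(\<And>j. j < n \<Longrightarrow> A i j = B i j) \<Longrightarrow> (\<And>j. j < n \<Longrightarrow> x j = y j) \<Longrightarrow>
    (\<And>j. j < n \<Longrightarrow> B i j \<in> carrier R) \<Longrightarrow> (\<And>j. j < n \<Longrightarrow> y j \<in> carrier R) \<Longrightarrow>
    mat_vec n A x i = mat_vec n B y i"
  unfolding mat_vec_def by (intro finsum_cong') auto

text \<open>Expresses that the image of every idempotent matrix is free: the factor \<open>u\<close>
  maps the free module of rank \<open>k\<close> onto the image of \<open>p\<close>, and
  \<open>v\<close> inverts it there.\<close>

definition idempotent_matrices_split :: "('a, 'c) ring_scheme \<Rightarrow> bool" where
  "idempotent_matrices_split R \<longleftrightarrow> (\<forall>(n::nat) p.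
    (\<forall>i<n. \<forall>j<n. p i j \<in> carrier R) \<longrightarrow>
    (\<forall>i<n. \<forall>j<n. (\<Oplus>\<^bsub>R\<^esub>l\<in>{..<n}. p i l \<otimes>\<^bsub>R\<^esub> p l j) = p i j) \<longrightarrow>
    (\<exists>(k::nat) u v. (\<forall>i<n. \<forall>l<k. u i l \<in> carrier R) \<and> (\<forall>l<k. \<forall>j<n. v l j \<in> carrier R) \<and>
      (\<forall>i<n. \<forall>j<n. (\<Oplus>\<^bsub>R\<^esub>l\<in>{..<k}. u i l \<otimes>\<^bsub>R\<^esub> v l j) = p i j) \<and>
      (\<forall>l<k. \<forall>l'<k. (\<Oplus>\<^bsub>R\<^esub>j\<in>{..<n}. v l j \<otimes>\<^bsub>R\<^esub> u j l') = (if l = l' then \<one>\<^bsub>R\<^esub> else \<zero>\<^bsub>R\<^esub>))))"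

lemma idempotent_matrices_splitE:
  fixes R :: "('a, 'r) ring_scheme" (structure) and n :: nat and p :: "nat \<Rightarrow> nat \<Rightarrow> 'a"
  assumes "idempotent_matrices_split R" and "\<forall>i<n. \<forall>j<n. p i j \<in> carrier R"
    and "\<forall>i<n. \<forall>j<n. (\<Oplus>l\<in>{..<n}. p i l \<otimes> p l j) = p i j"
  obtains k :: nat and u v where
    "\<forall>i<n. \<forall>l<k. u i l \<in> carrier R" "\<forall>l<k. \<forall>j<n. v l j \<in> carrier R"
    "\<forall>i<n. \<forall>j<n. (\<Oplus>l\<in>{..<k}. u i l \<otimes> v l j) = p i j"
    "\<forall>l<k. \<forall>l'<k. (\<Oplus>j\<in>{..<n}. v l j \<otimes> u j l') = (if l = l' then \<one> else \<zero>)"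
  using assms(1)[unfolded idempotent_matrices_split_def, THEN spec[of _ n], THEN spec[of _ p],
    THEN mp, OF assms(2), THEN mp, OF assms(3)]
  by (elim exE conjE) (rule that)

text \<open>The dual basis gives \<open>f\<close> from \<open>M\<close> to the free module of rank
  \<open>n\<close> and \<open>\<theta>\<close> back, with \<open>\<theta> f = 1\<close>; then
  \<open>p = f \<theta>\<close> is idempotent. If \<open>p = u v\<close> and \<open>v u = 1\<close>,
  the maps \<open>v f\<close> and \<open>\<theta> u\<close> are mutually inverse, since
  \<open>\<theta> u v f = \<theta> f \<theta> f = 1\<close> and
  \<open>v f \<theta> u = v u v u = 1\<close>.\<close>

lemma free_if_idempotent_matrices_split:
  fixes R :: "('a, 'r) ring_scheme" (structure) and M :: "('a, 'c) module"
  assumes "module R M" and split: "idempotent_matrices_split R"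
    and fg: "finitely_generated_module R M" and proj: "projective_module R M"
  shows "\<exists>k::nat. module_isomorphic R M (free_module R {..<k})"
proof -
  interpret module R M by (rule assms(1))
  obtain n :: nat and e f where e: "\<And>i. i < n \<Longrightarrow> e i \<in> carrier M"
    and f: "\<And>i x. i < n \<Longrightarrow> x \<in> carrier M \<Longrightarrow> f i x \<in> carrier R"
    and fa: "\<And>i x y. i < n \<Longrightarrow> x \<in> carrier M \<Longrightarrow> y \<in> carrier M \<Longrightarrow> f i (x \<oplus>\<^bsub>M\<^esub> y) = f i x \<oplus> f i y"
    and fm: "\<And>i a x. i < n \<Longrightarrow> a \<in> carrier R \<Longrightarrow> x \<in> carrier M \<Longrightarrow> f i (a \<odot>\<^bsub>M\<^esub> x) = a \<otimes> f i x"
    and ef: "\<And>x. x \<in> carrier M \<Longrightarrow> x = (\<Oplus>\<^bsub>M\<^esub>i\<in>{..<n}. f i x \<odot>\<^bsub>M\<^esub> e i)"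
    by (rule dual_basis[OF assms(1) fg proj]) (rule that)
  have f0: "f i \<zero>\<^bsub>M\<^esub> = \<zero>" if "i < n" for i
    using fm[OF that R.zero_closed M.zero_closed] f[OF that M.zero_closed] by simp
  define \<theta> where "\<theta> = (\<lambda>z. \<Oplus>\<^bsub>M\<^esub>i\<in>{..<n}. z i \<odot>\<^bsub>M\<^esub> e i)"
  have \<theta>c: "\<theta> z \<in> carrier M" if "\<And>i. i < n \<Longrightarrow> z i \<in> carrier R" for z
    unfolding \<theta>_def using that e by (intro M.finsum_closed) auto
  define p where "p = (\<lambda>i j. f i (e j))"
  have p: "p i j \<in> carrier R" if "i < n" "j < n" for i j
    using that e f by (simp add: p_def)
  have f\<theta>: "f i (\<theta> z) = mat_vec n p z i" if "\<And>i. i < n \<Longrightarrow> z i \<in> carrier R" "i < n" for z i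
  proof -
    have "f i (\<theta> z) = (\<Oplus>j\<in>{..<n}. f i (z j \<odot>\<^bsub>M\<^esub> e j))"
      unfolding \<theta>_def
      by (rule additive_finsum[OF M.abelian_monoid_axioms R.abelian_monoid_axioms f[OF that(2)] f0[OF that(2)]
        fa[OF that(2)]]) (use that e in auto)
    also have "\<dots> = mat_vec n p z i"
      unfolding mat_vec_def p_def using that e f fm
      by (intro R.finsum_cong') (auto simp: R.m_comm)
    finally show ?thesis .
  qed
  have pf: "mat_vec n p (\<lambda>j. f j x) i = f i x" if "i < n" "x \<in> carrier M" for i x
    using f\<theta>[of "\<lambda>j. f j x" i] ef[OF that(2)] that f by (simp add: \<theta>_def)
  have idem: "(\<Oplus>l\<in>{..<n}. p i l \<otimes> p l j) = p i j" if "i < n" "j < n" for i j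
    using pf[OF that(1) e[OF that(2)]] by (simp add: p_def mat_vec_def)
  have p': "\<forall>i<n. \<forall>j<n. p i j \<in> carrier R" using p by blast
  have idem': "\<forall>i<n. \<forall>j<n. (\<Oplus>l\<in>{..<n}. p i l \<otimes> p l j) = p i j" using idem by blast
  obtain k :: nat and u v where
    u: "\<forall>i<n. \<forall>l<k. u i l \<in> carrier R" and v: "\<forall>l<k. \<forall>j<n. v l j \<in> carrier R"
    and uv: "\<forall>i<n. \<forall>j<n. (\<Oplus>l\<in>{..<k}. u i l \<otimes> v l j) = p i j"
    and vu: "\<forall>l<k. \<forall>l'<k. (\<Oplus>j\<in>{..<n}. v l j \<otimes> u j l') = (if l = l' then \<one> else \<zero>)"
    by (rule idempotent_matrices_splitE[OF split p' idem'])
  note u = u[rule_format] and v = v[rule_format] and uv = uv[rule_format] and vu = vu[rule_format]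
  have uvz: "mat_vec k u (mat_vec n v z) i = mat_vec n p z i"
    if "i < n" "\<And>j. j < n \<Longrightarrow> z j \<in> carrier R" for z i
  proof -
    have "mat_vec k u (mat_vec n v z) i = (\<Oplus>l\<in>{..<n}. (\<Oplus>j\<in>{..<k}. u i j \<otimes> v j l) \<otimes> z l)"
      by (rule mat_vec_mat_vec) (use u v that in auto)
    also have "\<dots> = mat_vec n p z i"
      unfolding mat_vec_def using uv that p by (intro R.finsum_cong') auto
    finally show ?thesis .
  qed
  have vuy: "mat_vec n v (mat_vec k u y) l = y l"
    if "l < k" "\<And>j. j < k \<Longrightarrow> y j \<in> carrier R" for y l
  proof -
    have "mat_vec n v (mat_vec k u y) l = (\<Oplus>l'\<in>{..<k}. (\<Oplus>j\<in>{..<n}. v l j \<otimes> u j l') \<otimes> y l')"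
      by (rule mat_vec_mat_vec) (use u v that in auto)
    also have "\<dots> = (\<Oplus>l'\<in>{..<k}. (if l = l' then y l' else \<zero>))"
      using vu that by (intro R.finsum_cong') auto
    also have "\<dots> = y l" using that by (intro R.finsum_singleton) auto
    finally show ?thesis .
  qed
  let ?K = "free_module R {..<k}"
  define \<psi> where "\<psi> = (\<lambda>x. \<lambda>l\<in>{..<k}. mat_vec n v (\<lambda>j. f j x) l)"
  have K: "carrier ?K = {..<k} \<rightarrow>\<^sub>E carrier R" by (auto simp: free_module_def)
  have \<psi>c: "\<psi> x \<in> carrier ?K" if "x \<in> carrier M" for x
    unfolding K \<psi>_def using that v f by (auto intro!: mat_vec_closed)
  have \<psi>a: "\<psi> (x \<oplus>\<^bsub>M\<^esub> y) = \<psi> x \<oplus>\<^bsub>?K\<^esub> \<psi> y" if "x \<in> carrier M" "y \<in> carrier M" for x y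
  proof -
    have "mat_vec n v (\<lambda>j. f j (x \<oplus>\<^bsub>M\<^esub> y)) l = mat_vec n v (\<lambda>j. f j x) l \<oplus> mat_vec n v (\<lambda>j. f j y) l"
      if "l < k" for l
    proof -
      have "mat_vec n v (\<lambda>j. f j (x \<oplus>\<^bsub>M\<^esub> y)) l = (\<Oplus>j\<in>{..<n}. v l j \<otimes> f j x \<oplus> v l j \<otimes> f j y)"
        unfolding mat_vec_def using that v f fa \<open>x \<in> carrier M\<close> \<open>y \<in> carrier M\<close>
        by (intro R.finsum_cong') (auto simp: R.r_distr)
      also have "\<dots> = mat_vec n v (\<lambda>j. f j x) l \<oplus> mat_vec n v (\<lambda>j. f j y) l"
        unfolding mat_vec_def using that v f \<open>x \<in> carrier M\<close> \<open>y \<in> carrier M\<close>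
        by (intro R.finsum_addf) auto
      finally show ?thesis .
    qed
    then show ?thesis unfolding \<psi>_def free_module_def by (auto simp: fun_eq_iff)
  qed
  have \<psi>m: "\<psi> (a \<odot>\<^bsub>M\<^esub> x) = a \<odot>\<^bsub>?K\<^esub> \<psi> x" if "a \<in> carrier R" "x \<in> carrier M" for a x
  proof -
    have "mat_vec n v (\<lambda>j. f j (a \<odot>\<^bsub>M\<^esub> x)) l = a \<otimes> mat_vec n v (\<lambda>j. f j x) l" if "l < k" for l
    proof -
      have "mat_vec n v (\<lambda>j. f j (a \<odot>\<^bsub>M\<^esub> x)) l = (\<Oplus>j\<in>{..<n}. a \<otimes> (v l j \<otimes> f j x))"
        unfolding mat_vec_def using that v f fm \<open>a \<in> carrier R\<close> \<open>x \<in> carrier M\<close>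
        by (intro R.finsum_cong') (auto simp: R.m_lcomm)
      also have "\<dots> = a \<otimes> mat_vec n v (\<lambda>j. f j x) l"
        unfolding mat_vec_def using that v f \<open>a \<in> carrier R\<close> \<open>x \<in> carrier M\<close>
        by (intro R.finsum_rdistr[symmetric]) auto
      finally show ?thesis .
    qed
    then show ?thesis unfolding \<psi>_def free_module_def by (auto simp: fun_eq_iff)
  qed
  have bij: "bij_betw \<psi> (carrier M) (carrier ?K)"
  proof (rule bij_betw_byWitness[where f' = "\<lambda>y. \<theta> (mat_vec k u y)"])
    show "\<psi> ` carrier M \<subseteq> carrier ?K" using \<psi>c by blast
    show "(\<lambda>y. \<theta> (mat_vec k u y)) ` carrier ?K \<subseteq> carrier M"
      unfolding K using u by (auto intro!: \<theta>c mat_vec_closed)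
    show "\<forall>x\<in>carrier M. \<theta> (mat_vec k u (\<psi> x)) = x"
    proof
      fix x assume x: "x \<in> carrier M"
      have "mat_vec k u (\<psi> x) i = f i x" if i: "i < n" for i
      proof -
        have "mat_vec k u (\<psi> x) i = mat_vec k u (mat_vec n v (\<lambda>j. f j x)) i"
          using u v f x i by (intro R.mat_vec_cong) (auto simp: \<psi>_def intro!: mat_vec_closed)
        also have "\<dots> = f i x" using uvz[OF i] pf[OF i x] f x by simp
        finally show ?thesis .
      qed
      then have "\<theta> (mat_vec k u (\<psi> x)) = \<theta> (\<lambda>i. f i x)"
        unfolding \<theta>_def using f e x by (intro M.finsum_cong') auto
      then show "\<theta> (mat_vec k u (\<psi> x)) = x" using ef[OF x] by (simp add: \<theta>_def)
    qed
    show "\<forall>y\<in>carrier ?K. \<psi> (\<theta> (mat_vec k u y)) = y"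
    proof
      fix y assume y: "y \<in> carrier ?K"
      then have yc: "y l \<in> carrier R" if "l < k" for l using that by (auto simp: K)
      have uy: "mat_vec k u y i \<in> carrier R" if "i < n" for i
        using that u yc by (intro mat_vec_closed) auto
      \<comment> \<open>The columns of \<open>u\<close> lie in the image of \<open>p\<close>:
        \<open>f \<theta> u y = p u y = u v u y = u y\<close>.\<close>
      have *: "f i (\<theta> (mat_vec k u y)) = mat_vec k u y i" if i: "i < n" for i
      proof -
        have "f i (\<theta> (mat_vec k u y)) = mat_vec k u (mat_vec n v (mat_vec k u y)) i"
          using f\<theta>[OF uy i] uvz[OF i uy] by simp
        also have "\<dots> = mat_vec k u y i"
          using u yc i vuy by (intro R.mat_vec_cong) auto
        finally show ?thesis .
      qed
      have "mat_vec n v (\<lambda>i. f i (\<theta> (mat_vec k u y))) l = y l" if l: "l < k" for l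
      proof -
        have "mat_vec n v (\<lambda>i. f i (\<theta> (mat_vec k u y))) l = mat_vec n v (mat_vec k u y) l"
          using * uy v l by (intro R.mat_vec_cong) auto
        then show ?thesis using vuy[OF l yc] by simp
      qed
      then show "\<psi> (\<theta> (mat_vec k u y)) = y"
        using y by (auto simp: \<psi>_def K PiE_iff extensional_def fun_eq_iff)
    qed
  qed
  have "\<psi> \<in> iso (add_monoid M) (add_monoid ?K)"
    using bij \<psi>c \<psi>a by (auto simp: iso_def hom_def)
  then show ?thesis unfolding module_isomorphic_def using \<psi>m by blast
qed

lemma projective_free_if_idempotent_matrices_split:
  assumes "cring R" "idempotent_matrices_split R"
  shows "projective_free TYPE('b) R"
  unfolding projective_free_def
  using assms free_if_idempotent_matrices_split by blast

section \<open>Projective freeness\<close>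

lemma pointwise_ring_simps:
  "carrier (pointwise_ring X A) = A"
  "f \<oplus>\<^bsub>pointwise_ring X A\<^esub> g = (\<lambda>x\<in>X. f x + g x)"
  "f \<otimes>\<^bsub>pointwise_ring X A\<^esub> g = (\<lambda>x\<in>X. f x * g x)"
  "\<zero>\<^bsub>pointwise_ring X A\<^esub> = (\<lambda>x\<in>X. 0)"
  "\<one>\<^bsub>pointwise_ring X A\<^esub> = (\<lambda>x\<in>X. 1)"
  by (simp_all add: pointwise_ring_def)

section \<open>Matrices over the pointwise ring\<close>

context wiener_function_algebra
begin

lemma mem_extensional: "f \<in> A \<Longrightarrow> restrict f X = f"
  using extensional by (meson extensional_restrict subsetD)

lemma eq_on_X: "f \<in> A \<Longrightarrow> (\<And>x. x \<in> X \<Longrightarrow> g x = f x) \<Longrightarrow> restrict g X = f"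
  by (metis mem_extensional restrict_ext)

lemma cring_pointwise_ring: "cring (pointwise_ring X A)"
proof (rule cringI)
  let ?R = "pointwise_ring X A"
  show "abelian_group ?R"
  proof (rule abelian_groupI)
    show "\<exists>g\<in>carrier ?R. g \<oplus>\<^bsub>?R\<^esub> f = \<zero>\<^bsub>?R\<^esub>" if "f \<in> carrier ?R" for f
    proof
      show "(\<lambda>x\<in>X. (\<lambda>x\<in>X. - 1) x * f x) \<in> carrier ?R"
        using mult_mem[OF const_mem] that unfolding pointwise_ring_def by simp
      show "(\<lambda>x\<in>X. (\<lambda>x\<in>X. - 1) x * f x) \<oplus>\<^bsub>?R\<^esub> f = \<zero>\<^bsub>?R\<^esub>"
        unfolding pointwise_ring_def by (auto intro: restrict_ext)
    qed
    show "\<zero>\<^bsub>?R\<^esub> \<oplus>\<^bsub>?R\<^esub> f = f" if "f \<in> carrier ?R" for f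
      using that unfolding pointwise_ring_def ring_record_simps partial_object.simps
      by (intro eq_on_X) simp_all
  qed (auto simp: pointwise_ring_def const_mem add_mem intro!: restrict_ext)
  show "comm_monoid ?R"
  proof (rule comm_monoidI)
    show "\<one>\<^bsub>?R\<^esub> \<otimes>\<^bsub>?R\<^esub> f = f" if "f \<in> carrier ?R" for f
      using that unfolding pointwise_ring_def ring_record_simps monoid.simps partial_object.simps
      by (intro eq_on_X) simp_all
  qed (auto simp: pointwise_ring_def const_mem mult_mem intro!: restrict_ext)
qed (auto simp: pointwise_ring_def algebra_simps intro!: restrict_ext)

lemma finsum_pointwise_ring:
  assumes "finite I" "\<And>i. i \<in> I \<Longrightarrow> g i \<in> A"
  shows "(\<Oplus>\<^bsub>pointwise_ring X A\<^esub>i\<in>I. g i) = (\<lambda>x\<in>X. \<Sum>i\<in>I. g i x)"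
  using assms
proof (induction I rule: finite_induct)
  case empty
  interpret cring "pointwise_ring X A" by (rule cring_pointwise_ring)
  show ?case unfolding finsum_empty pointwise_ring_simps by simp
next
  case (insert i I)
  interpret cring "pointwise_ring X A" by (rule cring_pointwise_ring)
  have "(\<Oplus>\<^bsub>pointwise_ring X A\<^esub>i\<in>insert i I. g i)
      = g i \<oplus>\<^bsub>pointwise_ring X A\<^esub> (\<Oplus>\<^bsub>pointwise_ring X A\<^esub>i\<in>I. g i)"
    using insert by (intro finsum_insert) (auto simp: pointwise_ring_def)
  also have "(\<Oplus>\<^bsub>pointwise_ring X A\<^esub>i\<in>I. g i) = (\<lambda>x\<in>X. \<Sum>i\<in>I. g i x)"
    using insert.IH insert.prems by blast
  also have "g i \<oplus>\<^bsub>pointwise_ring X A\<^esub> \<dots> = (\<lambda>x\<in>X. \<Sum>i\<in>insert i I. g i x)"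
    using insert.hyps unfolding pointwise_ring_def by (auto intro!: restrict_ext)
  finally show ?case .
qed

lemma finsum_mult_pointwise_ring:
  fixes n :: nat
  assumes "\<And>l. l < n \<Longrightarrow> f l \<in> A" "\<And>l. l < n \<Longrightarrow> g l \<in> A"
  shows "(\<Oplus>\<^bsub>pointwise_ring X A\<^esub>l\<in>{..<n}. f l \<otimes>\<^bsub>pointwise_ring X A\<^esub> g l)
    = (\<lambda>x\<in>X. \<Sum>l = 0..<n. f l x * g l x)"
proof -
  have fg: "(\<lambda>x\<in>X. f l x * g l x) \<in> A" if "l \<in> {..<n}" for l
    using that by (intro mult_mem assms) simp_all
  have "(\<Oplus>\<^bsub>pointwise_ring X A\<^esub>l\<in>{..<n}. (\<lambda>x\<in>X. f l x * g l x))
      = (\<lambda>x\<in>X. \<Sum>l\<in>{..<n}. (\<lambda>x\<in>X. f l x * g l x) x)"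
    by (rule finsum_pointwise_ring[where g = "\<lambda>l. \<lambda>x\<in>X. f l x * g l x"]) (simp, rule fg)
  also have "\<dots> = (\<lambda>x\<in>X. \<Sum>l = 0..<n. f l x * g l x)"
    by (rule restrict_ext) (simp add: atLeast0LessThan)
  finally show ?thesis unfolding pointwise_ring_simps .
qed

text \<open>A matrix of functions is the same as a matrix-valued function, and finite ring sums are
  evaluated pointwise, so the splitting of complex matrix functions carries over to the
  ring.\<close>

lemma idempotent_matrices_split_pointwise_ring:
  assumes split: "\<And>n P. mem.mat_over n n P \<Longrightarrow> \<forall>x\<in>X. P x * P x = P x \<Longrightarrow>
    \<exists>k u v. mem.mat_over n k u \<and> mem.mat_over k n v \<and> (\<forall>x\<in>X. u x * v x = P x \<and> v x * u x = 1\<^sub>m k)"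
  shows "idempotent_matrices_split (pointwise_ring X A)"
  unfolding idempotent_matrices_split_def
proof (intro allI impI)
  let ?R = "pointwise_ring X A"
  have carrier: "carrier ?R = A" by (simp add: pointwise_ring_def)
  fix n :: nat and p
  assume "\<forall>i<n. \<forall>j<n. p i j \<in> carrier ?R"
    and idem: "\<forall>i<n. \<forall>j<n. (\<Oplus>\<^bsub>?R\<^esub>l\<in>{..<n}. p i l \<otimes>\<^bsub>?R\<^esub> p l j) = p i j"
  then have p: "p i j \<in> A" if "i < n" "j < n" for i j using that by (simp add: carrier)
  define P where "P = (\<lambda>x. mat n n (\<lambda>(i, j). p i j x))"
  have Pc: "P x \<in> carrier_mat n n" for x by (simp add: P_def)
  have "mem.mat_over n n P"
    unfolding mem.mat_over_def mem_def by (auto simp: P_def mem_extensional p)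
  moreover have "P x * P x = P x" if x: "x \<in> X" for x
  proof (rule eq_matI)
    fix i j assume "i < dim_row (P x)" "j < dim_col (P x)"
    then have ij: "i < n" "j < n" by (auto simp: P_def)
    have "(P x * P x) $$ (i, j) = (\<Sum>l = 0..<n. p i l x * p l j x)"
      unfolding index_mult_mat_sum[OF Pc Pc ij] using ij by (intro sum.cong) (auto simp: P_def)
    also have "\<dots> = (\<lambda>x\<in>X. \<Sum>l = 0..<n. p i l x * p l j x) x" using x by simp
    also have "(\<lambda>x\<in>X. \<Sum>l = 0..<n. p i l x * p l j x)
        = (\<Oplus>\<^bsub>?R\<^esub>l\<in>{..<n}. p i l \<otimes>\<^bsub>?R\<^esub> p l j)"
      by (rule finsum_mult_pointwise_ring[symmetric]) (use p ij in auto)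
    also have "\<dots> = p i j" using idem ij by blast
    finally show "(P x * P x) $$ (i, j) = P x $$ (i, j)" using ij by (simp add: P_def)
  qed (auto simp: P_def)
  ultimately obtain k u v where u: "mem.mat_over n k u" and v: "mem.mat_over k n v"
    and uv: "\<forall>x\<in>X. u x * v x = P x \<and> v x * u x = 1\<^sub>m k"
    using split by blast
  note uc = mem.mat_over_carrier[OF u] and vc = mem.mat_over_carrier[OF v]
  \<comment> \<open>The factors are only controlled on \<open>X\<close>; restricting their entries
    yields ring elements, for which equality on \<open>X\<close> is equality.\<close>
  define u' where "u' = (\<lambda>i l. \<lambda>x\<in>X. u x $$ (i, l))"
  define v' where "v' = (\<lambda>l j. \<lambda>x\<in>X. v x $$ (l, j))"
  have u': "u' i l \<in> A" if "i < n" "l < k" for i l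
    using u that by (simp add: mem.mat_over_def mem_def u'_def)
  have v': "v' l j \<in> A" if "l < k" "j < n" for l j
    using v that by (simp add: mem.mat_over_def mem_def v'_def)
  have "(\<Oplus>\<^bsub>?R\<^esub>l\<in>{..<k}. u' i l \<otimes>\<^bsub>?R\<^esub> v' l j) = p i j" if ij: "i < n" "j < n" for i j
  proof -
    have "(\<Oplus>\<^bsub>?R\<^esub>l\<in>{..<k}. u' i l \<otimes>\<^bsub>?R\<^esub> v' l j) = (\<lambda>x\<in>X. \<Sum>l = 0..<k. u' i l x * v' l j x)"
      by (rule finsum_mult_pointwise_ring) (use u' v' ij in auto)
    also have "\<dots> = p i j"
    proof (rule eq_on_X[OF p[OF ij]])
    fix x assume x: "x \<in> X"
    have "(\<Sum>l = 0..<k. u' i l x * v' l j x) = (u x * v x) $$ (i, j)"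
      unfolding index_mult_mat_sum[OF uc vc ij] using x by (simp add: u'_def v'_def)
    then show "(\<Sum>l = 0..<k. u' i l x * v' l j x) = p i j x"
      using uv x ij by (simp add: P_def)
    qed
    finally show ?thesis .
  qed
  moreover have "(\<Oplus>\<^bsub>?R\<^esub>j\<in>{..<n}. v' l j \<otimes>\<^bsub>?R\<^esub> u' j l') = (if l = l' then \<one>\<^bsub>?R\<^esub> else \<zero>\<^bsub>?R\<^esub>)"
    if l: "l < k" "l' < k" for l l'
  proof -
    have "(\<Oplus>\<^bsub>?R\<^esub>j\<in>{..<n}. v' l j \<otimes>\<^bsub>?R\<^esub> u' j l') = (\<lambda>x\<in>X. \<Sum>j = 0..<n. v' l j x * u' j l' x)"
      by (rule finsum_mult_pointwise_ring) (use u' v' l in auto)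
    also have "\<dots> = (if l = l' then \<one>\<^bsub>?R\<^esub> else \<zero>\<^bsub>?R\<^esub>)"
    proof (rule eq_on_X)
    show "(if l = l' then \<one>\<^bsub>?R\<^esub> else \<zero>\<^bsub>?R\<^esub>) \<in> A"
      using const_mem by (simp add: pointwise_ring_simps)
    fix x assume x: "x \<in> X"
    have "(\<Sum>j = 0..<n. v' l j x * u' j l' x) = (v x * u x) $$ (l, l')"
      unfolding index_mult_mat_sum[OF vc uc l] using x by (simp add: u'_def v'_def)
    then show "(\<Sum>j = 0..<n. v' l j x * u' j l' x) = (if l = l' then \<one>\<^bsub>?R\<^esub> else \<zero>\<^bsub>?R\<^esub>) x"
      using uv x l by (simp add: pointwise_ring_simps)
    qed
    finally show ?thesis .
  qed
  ultimately show "\<exists>(k::nat) u v. (\<forall>i<n. \<forall>l<k. u i l \<in> carrier ?R) \<and> (\<forall>l<k. \<forall>j<n. v l j \<in> carrier ?R) \<and>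
      (\<forall>i<n. \<forall>j<n. (\<Oplus>\<^bsub>?R\<^esub>l\<in>{..<k}. u i l \<otimes>\<^bsub>?R\<^esub> v l j) = p i j) \<and>
      (\<forall>l<k. \<forall>l'<k. (\<Oplus>\<^bsub>?R\<^esub>j\<in>{..<n}. v l j \<otimes>\<^bsub>?R\<^esub> u j l') = (if l = l' then \<one>\<^bsub>?R\<^esub> else \<zero>\<^bsub>?R\<^esub>))"
    using u' v' unfolding carrier by (intro exI[of _ k] exI[of _ u'] exI[of _ v'] conjI allI impI)
qed

end

theorem corollary3p3:
  fixes m :: nat
    and B :: "(complex \<Rightarrow> complex) set"
    and nrm :: "(complex \<Rightarrow> complex) \<Rightarrow> real"
  assumes "m \<ge> 1"
    and "banach_function_algebra Cplus B nrm"
    and "Dirichlet_polynomials \<subseteq> B" and "B \<subseteq> Hinf"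
    and "\<exists>C>0. \<forall>f\<in>B. Hinf_norm f \<le> C * nrm f"
    and wiener: "\<forall>f\<in>B. (INF s\<in>Cplus. cmod (f s)) > 0 \<longrightarrow> (\<lambda>s\<in>Cplus. 1 / f s) \<in> B"
  shows "projective_free TYPE('b) (pointwise_ring Cplus (smooth_subalgebra m B))"
proof (rule projective_free_if_idempotent_matrices_split)
  interpret B: banach_function_algebra Cplus B nrm by (rule assms(2))
  interpret Dirichlet_algebra B
  proof
    show "(\<lambda>s\<in>Cplus. 1 / f s) \<in> B" if "f \<in> B" "(INF s\<in>Cplus. cmod (f s)) > 0" for f
      using wiener that by blast
  qed (fact assms(3), fact assms(4), fact B.add_mem, fact B.mult_mem)
  show "cring (pointwise_ring Cplus (smooth_subalgebra m B))"
    by (rule smooth.cring_pointwise_ring)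
  show "idempotent_matrices_split (pointwise_ring Cplus (smooth_subalgebra m B))"
  proof (rule smooth.idempotent_matrices_split_pointwise_ring)
    fix n P assume P: "smooth.mem.mat_over m n n P" "\<forall>s\<in>Cplus. P s * P s = P s"
    show "\<exists>k u v. smooth.mem.mat_over m n k u \<and> smooth.mem.mat_over m k n v
        \<and> (\<forall>s\<in>Cplus. u s * v s = P s \<and> v s * u s = 1\<^sub>m k)"
      by (rule smooth_idempotent_splits[OF assms(1) P(1) bspec[OF P(2)]]) blast+
  qed
qed

end
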